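(* Let $E,F$ be complex Banach spaces, $U\subseteq E$ open, $v$ a weight on $U$, and $p\in[1,\infty)$. Let $f\in\mathcal H_v^\infty(U,F)$ and $g\in\mathcal H^\infty_{v\mathcal K}(U,F^* )$. Assume that $T_f\in\Pi_p(\mathcal G_v^\infty(U),F)$. Then $f^t\circ g\in\mathcal H^\infty_{v\mathcal K_p}(U,\mathcal H_v^\infty(U))$ with $$\|f^t\circ g\|_{\mathcal H^\infty_{v\mathcal K_p}}\le\pi_p(T_f)\,\|g\|_v.$$
   Context: A weight on $U$ is a strictly positive continuous function. $\mathcal H_v^\infty(U,F)$ is the Banach space of holomorphic $f\colon U\to F$ with $\|f\|_v:=\sup_{x\in U}v(x)\|f(x)\|<\infty$; $\mathcal H_v^\infty(U):=\mathcal H_v^\infty(U,\mathbb C)$. For a complex Banach space $Y$, $\mathcal H^\infty_{v\mathcal K}(U,Y)$ is the space of holomorphic $h\colon U\to Y$ such that $(vh)(U)=\{v(x)h(x):x\in U\}$ is relatively compact in $Y$. The transpose of $f\in\mathcal H_v^\infty(U,F)$ is the bounded linear operator $f^t\colon F^*\to\mathcal H_v^\infty(U)$, $f^t(y^* )=y^*\circ f$. $p^*$ is the conjugate index of $p$. Linearization: $\mathcal G_v^\infty(U)$ is the closed subspace of $\mathcal H_v^\infty(U)^*$ consisting of all linear functionals on $\mathcal H_v^\infty(U)$ whose restriction to the closed unit ball of $\mathcal H_v^\infty(U)$ is continuous for the compact-open topology. $\Delta_v\colon U\to\mathcal G_v^\infty(U)$ is $\Delta_v(x)=\delta_x$, where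 $\delta_x(g)=g(x)$. For $f\in\mathcal H_v^\infty(U,F)$, $T_f\colon\mathcal G_v^\infty(U)\to F$ is the unique bounded linear operator with $T_f\circ\Delta_v=f$. For a Banach space $X$ and $(x_n)\in\ell_p(X)$ (i.e. $\|(x_n)\|_p=(\sum\|x_n\|^p)^{1/p}<\infty$), $p\text{-}\mathrm{conv}(x_n)=\{\sum_n a_nx_n:(a_n)\in B\}$, where $B=B_{\ell_{p^*}}$ if $1<p<\infty$ and $B=B_{c_0}$ if $p=1$. A set $K\subseteq X$ is relatively $p$-compact if $K\subseteq p\text{-}\mathrm{conv}(x_n)$ for some $(x_n)\in\ell_p(X)$, and $m_{\mathcal K_p}(K)$ is the infimum of $\|(x_n)\|_p$ over all such sequences. $\mathcal H^\infty_{v\mathcal K_p}(U,Y)$ is the set of $h\in\mathcal H_v^\infty(U,Y)$ with $(vh)(U)$ relatively $p$-compact, with $\|h\|_{\mathcal H^\infty_{v\mathcal K_p}}=m_{\mathcal K_p}((vh)(U))$. $\Pi_p(X,Y)$ is the space of $p$-summing operators $T\colon X\to Y$, i.e. those for which there is $C\ge0$ with $(\sum_{i=1}^n\|T(x_i)\|^p)^{1/p}\le C\sup_{x^*\in B_{X^*}}(\sum_{i=1}^n|x^*(x_i)|^p)^{1/p}$ for all finite families $x_1,\dots,x_n\in X$; $\pi_p(T)$ is the infimum of such $C$. *)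

theory Defs
  imports "HOL-Analysis.Analysis" "HOL-Library.Function_Algebras"
begin

section \<open>Complex vector spaces and complex Banach spaces\<close>

class complex_vector = ab_group_add +
  fixes scaleC :: "complex \<Rightarrow> 'a \<Rightarrow> 'a"  (infixr "*\<^sub>C" 75)
  assumes scaleC_add_right: "c *\<^sub>C (x + y) = c *\<^sub>C x + c *\<^sub>C y"
    and scaleC_add_left: "(c + d) *\<^sub>C x = c *\<^sub>C x + d *\<^sub>C x"
    and scaleC_scaleC: "c *\<^sub>C d *\<^sub>C x = (c * d) *\<^sub>C x"
    and scaleC_one: "1 *\<^sub>C x = x"

class complex_normed_vector = complex_vector + real_normed_vector +
  assumes scaleR_eq_scaleC: "r *\<^sub>R x = complex_of_real r *\<^sub>C x"
    and norm_scaleC: "norm (c *\<^sub>C x) = cmod c * norm x"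

class complex_banach = complex_normed_vector + complete_space

instantiation complex :: complex_banach
begin
definition scaleC_complex :: "complex \<Rightarrow> complex \<Rightarrow> complex"
  where "scaleC_complex c x = c * x"
instance
  by standard
    (auto simp: scaleC_complex_def algebra_simps scaleR_conv_of_real norm_mult)
end

instantiation "fun" :: (type, complex_vector) complex_vector
begin
definition scaleC_fun :: "complex \<Rightarrow> ('a \<Rightarrow> 'b) \<Rightarrow> 'a \<Rightarrow> 'b"
  where "scaleC_fun c f = (\<lambda>x. c *\<^sub>C f x)"
instance
  by standard
    (auto simp: scaleC_fun_def fun_eq_iff scaleC_add_right scaleC_add_left scaleC_scaleC scaleC_one)
end


section \<open>Normed spaces as subspaces of an ambient complex vector space\<close>

text \<open>
  The function spaces below depend on the set \<open>U\<close> and the weight \<open>v\<close>, so they are not types.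
  A normed space is given by its set of points, a linear subspace of an ambient type of class
  \<^class>\<open>complex_vector\<close>, together with its norm; the norm is only meaningful on these points.
  A function defined on a proper subset of a type is represented by its extension by \<open>0\<close>, so
  that functions on the subset and their representatives correspond one to one.
\<close>

record 'a nspace =
  pts :: "'a set"
  nrm :: "'a \<Rightarrow> real"

definition whole :: "'a::complex_normed_vector nspace"
  where "whole = \<lparr>pts = UNIV, nrm = norm\<rparr>"

definition unit_ball :: "'a nspace \<Rightarrow> 'a set"
  where "unit_ball X = {x \<in> pts X. nrm X x \<le> 1}"

text \<open>The case distinction makes the distance nonnegative off the points as well, as required by
  \<^locale>\<open>Metric_space\<close>.\<close>

definition ndist :: "'a::complex_vector nspace \<Rightarrow> 'a \<Rightarrow> 'a \<Rightarrow> real"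
  where "ndist X x y = (if x \<in> pts X \<and> y \<in> pts X then nrm X (x - y) else 0)"

definition ntop :: "'a::complex_vector nspace \<Rightarrow> 'a topology"
  where "ntop X = Metric_space.mtopology (pts X) (ndist X)"

definition relatively_compact :: "'a::complex_vector nspace \<Rightarrow> 'a set \<Rightarrow> bool"
  where "relatively_compact X K \<longleftrightarrow> K \<subseteq> pts X \<and> compactin (ntop X) (ntop X closure_of K)"

definition bounded_ops ::
    "'a::complex_vector nspace \<Rightarrow> 'b::complex_vector nspace \<Rightarrow> ('a \<Rightarrow> 'b) set"
  where "bounded_ops X Y = {T.
    (\<forall>x. x \<notin> pts X \<longrightarrow> T x = 0) \<and>
    (\<forall>x\<in>pts X. T x \<in> pts Y) \<and>
    (\<forall>x\<in>pts X. \<forall>y\<in>pts X. T (x + y) = T x + T y) \<and>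
    (\<forall>c. \<forall>x\<in>pts X. T (c *\<^sub>C x) = c *\<^sub>C T x) \<and>
    (\<exists>C. \<forall>x\<in>pts X. nrm Y (T x) \<le> C * nrm X x)}"

definition dual :: "'a::complex_vector nspace \<Rightarrow> ('a \<Rightarrow> complex) nspace"
  where "dual X = \<lparr>pts = bounded_ops X whole, nrm = (\<lambda>\<phi>. SUP x\<in>unit_ball X. cmod (\<phi> x))\<rparr>"


section \<open>Weighted spaces of holomorphic mappings\<close>

definition holomorphic_into ::
    "'a::complex_normed_vector set \<Rightarrow> 'b::complex_vector nspace \<Rightarrow> ('a \<Rightarrow> 'b) \<Rightarrow> bool"
  where "holomorphic_into U Y f \<longleftrightarrow> f ` U \<subseteq> pts Y \<and>
    (\<forall>x\<in>U. \<exists>D\<in>bounded_ops whole Y.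
      ((\<lambda>h. nrm Y (f (x + h) - f x - D h) / norm h) \<longlongrightarrow> 0) (at 0))"

lemma holomorphic_into_whole_iff:
  fixes f :: "'a::complex_normed_vector \<Rightarrow> 'b::complex_normed_vector"
  shows "holomorphic_into U whole f \<longleftrightarrow>
    (\<forall>x\<in>U. \<exists>D. (f has_derivative D) (at x) \<and> (\<forall>c h. D (c *\<^sub>C h) = c *\<^sub>C D h))"
proof -
  have ops: "D \<in> bounded_ops whole whole \<longleftrightarrow>
      bounded_linear D \<and> (\<forall>c h. D (c *\<^sub>C h) = c *\<^sub>C D h)" for D :: "'a \<Rightarrow> 'b"
  proof
    assume "D \<in> bounded_ops whole whole"
    then have add: "D (x + y) = D x + D y" and sc: "D (c *\<^sub>C x) = c *\<^sub>C D x"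
      and bd: "\<exists>C. \<forall>x. norm (D x) \<le> C * norm x" for x y c
      by (auto simp: bounded_ops_def whole_def)
    from bd obtain C where "\<forall>x. norm (D x) \<le> C * norm x" by blast
    then have "bounded_linear D"
      by (intro bounded_linear_intro[where K = C]) (auto simp: add sc scaleR_eq_scaleC mult.commute)
    with sc show "bounded_linear D \<and> (\<forall>c h. D (c *\<^sub>C h) = c *\<^sub>C D h)" by blast
  next
    assume D: "bounded_linear D \<and> (\<forall>c h. D (c *\<^sub>C h) = c *\<^sub>C D h)"
    then obtain K where "\<forall>x. norm (D x) \<le> norm x * K"
      using bounded_linear.bounded by blast
    with D show "D \<in> bounded_ops whole whole"
      by (auto simp: bounded_ops_def whole_def linear_simps mult.commute intro!: exI[of _ K])
  qed
  have lim: "((\<lambda>h. norm (g h) / norm h) \<longlongrightarrow> 0) (at 0) \<longleftrightarrow>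
      ((\<lambda>h. inverse (norm h) *\<^sub>R g h) \<longlongrightarrow> 0) (at 0)" for g :: "'a \<Rightarrow> 'b"
    by (subst (2) tendsto_norm_zero_iff [symmetric]) (simp add: divide_inverse mult.commute)
  show ?thesis
    unfolding holomorphic_into_def Bex_def ops
    by (simp add: whole_def has_derivative_at lim divide_inverse mult.commute) blast
qed

definition weight :: "'a::topological_space set \<Rightarrow> ('a \<Rightarrow> real) \<Rightarrow> bool"
  where "weight U v \<longleftrightarrow> continuous_on U v \<and> (\<forall>x\<in>U. v x > 0)"

definition weighted_image ::
    "'a set \<Rightarrow> ('a \<Rightarrow> real) \<Rightarrow> ('a \<Rightarrow> 'b::complex_vector) \<Rightarrow> 'b set"
  where "weighted_image U v h = (\<lambda>x. complex_of_real (v x) *\<^sub>C h x) ` U"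

text \<open>Inserting \<open>0\<close> only matters for empty \<open>U\<close>: suprema of norms are taken in \<open>[0, \<infinity>)\<close>,
  whereas the supremum of the empty set of reals is unspecified.\<close>

definition Hv ::
    "'a::complex_normed_vector set \<Rightarrow> ('a \<Rightarrow> real) \<Rightarrow> 'b::complex_vector nspace \<Rightarrow> ('a \<Rightarrow> 'b) nspace"
  where "Hv U v Y = \<lparr>
    pts = {f. holomorphic_into U Y f \<and> (\<forall>x. x \<notin> U \<longrightarrow> f x = 0) \<and>
      bdd_above ((\<lambda>x. v x * nrm Y (f x)) ` U)},
    nrm = (\<lambda>f. Sup (insert 0 ((\<lambda>x. v x * nrm Y (f x)) ` U)))\<rparr>"

abbreviation HvC ::
    "'a::complex_normed_vector set \<Rightarrow> ('a \<Rightarrow> real) \<Rightarrow> ('a \<Rightarrow> complex) nspace"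
  where "HvC U v \<equiv> Hv U v whole"

definition HvK ::
    "'a::complex_normed_vector set \<Rightarrow> ('a \<Rightarrow> real) \<Rightarrow> 'b::complex_vector nspace \<Rightarrow> ('a \<Rightarrow> 'b) set"
  where "HvK U v Y = {h. holomorphic_into U Y h \<and> (\<forall>x. x \<notin> U \<longrightarrow> h x = 0) \<and>
    relatively_compact Y (weighted_image U v h)}"

text \<open>\<open>f\<^sup>t(y\<^sup>*) = y\<^sup>* \<circ> f\<close>\<close>

definition transposed :: "('a \<Rightarrow> 'b) \<Rightarrow> ('b \<Rightarrow> complex) \<Rightarrow> 'a \<Rightarrow> complex"
  where "transposed f y = y \<circ> f"


section \<open>Linearization\<close>

definition compact_open :: "'a::topological_space set \<Rightarrow> ('a \<Rightarrow> 'b::topological_space) topology"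
  where "compact_open U =
    topology_generated_by {{f. f ` K \<subseteq> W} |K W. compact K \<and> K \<subseteq> U \<and> open W}"

definition Gv ::
    "'a::complex_normed_vector set \<Rightarrow> ('a \<Rightarrow> real) \<Rightarrow> (('a \<Rightarrow> complex) \<Rightarrow> complex) nspace"
  where "Gv U v = \<lparr>
    pts = {\<phi> \<in> pts (dual (HvC U v)).
      continuous_map (subtopology (compact_open U) (unit_ball (HvC U v))) euclidean \<phi>},
    nrm = nrm (dual (HvC U v))\<rparr>"

definition Delta ::
    "'a::complex_normed_vector set \<Rightarrow> ('a \<Rightarrow> real) \<Rightarrow> 'a \<Rightarrow> ('a \<Rightarrow> complex) \<Rightarrow> complex"
  where "Delta U v x = (\<lambda>g. if g \<in> pts (HvC U v) then g x else 0)"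

text \<open>For \<open>f\<close> in the weighted space there is exactly one such operator, \<open>T\<^sub>f\<close>.\<close>

definition is_linearization ::
    "'a::complex_normed_vector set \<Rightarrow> ('a \<Rightarrow> real) \<Rightarrow> 'b::complex_vector nspace \<Rightarrow>
     ('a \<Rightarrow> 'b) \<Rightarrow> ((('a \<Rightarrow> complex) \<Rightarrow> complex) \<Rightarrow> 'b) \<Rightarrow> bool"
  where "is_linearization U v Y f T \<longleftrightarrow>
    T \<in> bounded_ops (Gv U v) Y \<and> (\<forall>x\<in>U. T (Delta U v x) = f x)"


section \<open>Relatively \<open>p\<close>-compact sets\<close>

definition conjugate_index :: "real \<Rightarrow> real"
  where "conjugate_index p = p / (p - 1)"  \<comment> \<open>only for \<open>1 < p\<close>\<close>

definition lp_seqs :: "real \<Rightarrow> 'a nspace \<Rightarrow> (nat \<Rightarrow> 'a) set"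
  where "lp_seqs p X = {x. (\<forall>n. x n \<in> pts X) \<and> summable (\<lambda>n. nrm X (x n) powr p)}"

definition lp_norm :: "real \<Rightarrow> 'a nspace \<Rightarrow> (nat \<Rightarrow> 'a) \<Rightarrow> real"
  where "lp_norm p X x = (\<Sum>n. nrm X (x n) powr p) powr (1 / p)"

definition coefficient_ball :: "real \<Rightarrow> (nat \<Rightarrow> complex) set"
  where "coefficient_ball p =
    (if p = 1 then {a. a \<longlonglongrightarrow> 0 \<and> (\<forall>n. cmod (a n) \<le> 1)}
     else {a \<in> lp_seqs (conjugate_index p) whole. lp_norm (conjugate_index p) whole a \<le> 1})"

definition p_conv :: "real \<Rightarrow> 'a::complex_vector nspace \<Rightarrow> (nat \<Rightarrow> 'a) \<Rightarrow> 'a set"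
  where "p_conv p X x = {y \<in> pts X. \<exists>a\<in>coefficient_ball p.
    (\<lambda>N. nrm X (y - (\<Sum>n<N. a n *\<^sub>C x n))) \<longlonglongrightarrow> 0}"

definition relatively_p_compact :: "real \<Rightarrow> 'a::complex_vector nspace \<Rightarrow> 'a set \<Rightarrow> bool"
  where "relatively_p_compact p X K \<longleftrightarrow> (\<exists>x\<in>lp_seqs p X. K \<subseteq> p_conv p X x)"

definition mKp :: "real \<Rightarrow> 'a::complex_vector nspace \<Rightarrow> 'a set \<Rightarrow> real"
  where "mKp p X K = Inf {lp_norm p X x |x. x \<in> lp_seqs p X \<and> K \<subseteq> p_conv p X x}"

definition HvKp :: "real \<Rightarrow> 'a::complex_normed_vector set \<Rightarrow> ('a \<Rightarrow> real) \<Rightarrow>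
    'b::complex_vector nspace \<Rightarrow> ('a \<Rightarrow> 'b) nspace"
  where "HvKp p U v Y = \<lparr>
    pts = {h \<in> pts (Hv U v Y). relatively_p_compact p Y (weighted_image U v h)},
    nrm = (\<lambda>h. mKp p Y (weighted_image U v h))\<rparr>"


section \<open>\<open>p\<close>-summing operators\<close>

definition weak_lp_norm :: "real \<Rightarrow> 'a::complex_vector nspace \<Rightarrow> nat \<Rightarrow> (nat \<Rightarrow> 'a) \<Rightarrow> real"
  where "weak_lp_norm p X n x =
    (SUP \<phi>\<in>unit_ball (dual X). (\<Sum>i=1..n. cmod (\<phi> (x i)) powr p) powr (1 / p))"

definition summing_constants ::
    "real \<Rightarrow> 'a::complex_vector nspace \<Rightarrow> 'b nspace \<Rightarrow> ('a \<Rightarrow> 'b) \<Rightarrow> real set"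
  where "summing_constants p X Y T = {C. C \<ge> 0 \<and>
    (\<forall>n x. (\<forall>i\<in>{1..n}. x i \<in> pts X) \<longrightarrow>
      (\<Sum>i=1..n. nrm Y (T (x i)) powr p) powr (1 / p) \<le> C * weak_lp_norm p X n x)}"

definition p_summing ::
    "real \<Rightarrow> 'a::complex_vector nspace \<Rightarrow> 'b::complex_vector nspace \<Rightarrow> ('a \<Rightarrow> 'b) nspace"
  where "p_summing p X Y = \<lparr>
    pts = {T \<in> bounded_ops X Y. summing_constants p X Y T \<noteq> {}},
    nrm = (\<lambda>T. Inf (summing_constants p X Y T))\<rparr>"

end

theory Submission
  imports Defs "HOL-Complex_Analysis.Cauchy_Integral_Formula"
begin

text \<open>
  Write \<open>B\<close> for the unit ball of the scalar weighted space. By Cauchy's estimates it is compact for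
  pointwise convergence. Let \<open>D\<close> be a finite set of functionals of norm at most \<open>m\<close> and
  \<open>E > \<pi>\<^sub>p(T\<^sub>f) m\<close>. The representation to be found is \<open>y \<circ> f = E (\<Sum>q. \<lambda>\<^sub>q q\<^sub>y g\<^sub>q)\<close> for \<open>y \<in> D\<close>, with
  \<open>g\<^sub>q \<in> B\<close>, convex weights \<open>\<lambda>\<close> and \<open>\<Sum>q. \<lambda>\<^sub>q \<bar>q\<^sub>y\<bar>\<^bsup>p*\<^esup> \<le> 1\<close> (\<open>\<bar>q\<^sub>y\<bar> \<le> 1\<close> if \<open>p = 1\<close>), where \<open>q\<close> runs
  through a fixed finite net of coefficient vectors. The parameters \<open>(\<lambda>, g)\<close> form a compact set on
  which the constraints are convex, so if there is no such representation, finitely many of the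
  constraints are separated by a functional, that is, by finite combinations of point evaluations.
  Applied to these combinations, suitably rescaled, the \<open>p\<close>-summing inequality together with Young's
  inequality gives a contradiction. This replaces Pietsch's factorization theorem.

  A relatively compact set of functionals is reduced to finite ones by telescoping along finite
  nets: every element is a sum \<open>\<Sum>n. d\<^sub>n\<close> with \<open>d\<^sub>n\<close> in a finite set \<open>D\<^sub>n\<close>, where \<open>D\<^sub>0\<close> consists of
  elements of the given set and the bounds on the later \<open>D\<^sub>n\<close> are as small as desired.
\<close>

section \<open>Feasibility of convex constraints on a compact set\<close>

text \<open>The claimed bound leaves no constant to spare. Both sides are infima, however, so strict
  inequalities are available: an arbitrary summing constant \<open>C\<close> and any
  \<open>E > C * m\<close>. The gap pays for replacing the coefficient vectors by a finite net. With
  a finite net there is one weight and one function per net vector, and finite sums take the place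
  of a measure on a dual ball. The products of weights and functions are bilinear in the parameters.
  The constraints become convex because two functions with their weights can be merged into a
  weighted mean, which lies in \<open>B\<close> since \<open>B\<close> is absolutely convex.
  Functionals on \<open>Gv\<close> are never described. The norm of a combination of evaluations is
  by definition a supremum over \<open>B\<close>, and the summing inequality enters only through
  such norms. The centres of the first net are taken in the given set itself: only then does the
  first block obey the bound \<open>m\<close>, which must appear without any factor in the
  result.\<close>

lemma norm_sq_convex_combination:
  fixes w e :: complex and s :: real
  shows "(cmod (of_real (1 - s) * w + of_real s * e))\<^sup>2 =
    (1 - s)\<^sup>2 * (cmod w)\<^sup>2 + 2 * s * (1 - s) * Re (cnj w * e) + s\<^sup>2 * (cmod e)\<^sup>2"
  unfolding cmod_power2 by (simp add: power2_eq_square algebra_simps)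

text \<open>Minimise the total squared violation \<open>\<Phi>\<close> over \<open>\<Theta>\<close>.
  If the minimum were positive, the violations at the minimiser could be used as multipliers in
  \<open>dual\<close>, and a step towards the point obtained from \<open>dual\<close> would lower
  \<open>\<Phi>\<close>. The parameter space has a topology but no linear structure, hence the
  existential form of \<open>conv\<close>.\<close>

lemma finite_convex_feasibility:
  fixes L :: "'j \<Rightarrow> 't::topological_space \<Rightarrow> complex" and M :: "'i \<Rightarrow> 't \<Rightarrow> real"
  assumes "compact \<Theta>" and fin: "finite J" "finite I"
    and contL: "\<And>j. j \<in> J \<Longrightarrow> continuous_on \<Theta> (L j)"
    and contM: "\<And>i. i \<in> I \<Longrightarrow> continuous_on \<Theta> (M i)"
    and conv: "\<And>\<theta>\<^sub>1 \<theta>\<^sub>2 s. \<theta>\<^sub>1 \<in> \<Theta> \<Longrightarrow> \<theta>\<^sub>2 \<in> \<Theta> \<Longrightarrow> 0 \<le> s \<Longrightarrow> s \<le> 1 \<Longrightarrow> \<exists>\<theta>\<in>\<Theta>.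
        (\<forall>j\<in>J. L j \<theta> = of_real (1 - s) * L j \<theta>\<^sub>1 + of_real s * L j \<theta>\<^sub>2) \<and>
        (\<forall>i\<in>I. M i \<theta> \<le> (1 - s) * M i \<theta>\<^sub>1 + s * M i \<theta>\<^sub>2)"
    and dual: "\<And>c \<mu>. (\<And>i. 0 \<le> \<mu> i) \<Longrightarrow> \<exists>\<theta>\<in>\<Theta>.
        Re (\<Sum>j\<in>J. c j * L j \<theta>) + (\<Sum>i\<in>I. \<mu> i * M i \<theta>) \<le> 0"
  shows "\<exists>\<theta>\<in>\<Theta>. (\<forall>j\<in>J. L j \<theta> = 0) \<and> (\<forall>i\<in>I. M i \<theta> \<le> 0)"
proof -
  define \<Phi> where "\<Phi> \<theta> = (\<Sum>j\<in>J. (cmod (L j \<theta>))\<^sup>2) + (\<Sum>i\<in>I. (max 0 (M i \<theta>))\<^sup>2)" for \<theta>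
  have "continuous_on \<Theta> \<Phi>"
    unfolding \<Phi>_def using contL contM by (intro continuous_intros) auto
  moreover have "\<Theta> \<noteq> {}"
    using dual[of "\<lambda>_. 0" "\<lambda>_. 0"] by auto
  ultimately obtain \<theta>\<^sub>0 where t0: "\<theta>\<^sub>0 \<in> \<Theta>" and min: "\<And>\<theta>. \<theta> \<in> \<Theta> \<Longrightarrow> \<Phi> \<theta>\<^sub>0 \<le> \<Phi> \<theta>"
    using continuous_attains_inf[OF \<open>compact \<Theta>\<close>] by metis
  \<comment> \<open>Together with the conjugates of the \<open>L j\<close> these are half the
    gradient of \<open>\<Phi>\<close>, as a function of the values of \<open>L\<close> and
    \<open>M\<close>, at the minimiser.\<close>
  define \<mu> where "\<mu> i = max 0 (M i \<theta>\<^sub>0)" for i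
  obtain \<theta>\<^sub>1 where t1: "\<theta>\<^sub>1 \<in> \<Theta>" and
    neg: "Re (\<Sum>j\<in>J. cnj (L j \<theta>\<^sub>0) * L j \<theta>\<^sub>1) + (\<Sum>i\<in>I. \<mu> i * M i \<theta>\<^sub>1) \<le> 0"
    using dual[of \<mu> "\<lambda>j. cnj (L j \<theta>\<^sub>0)"] by (auto simp: \<mu>_def)
  define W where "W = \<Phi> \<theta>\<^sub>0"
  define E where "E = (\<Sum>j\<in>J. (cmod (L j \<theta>\<^sub>1))\<^sup>2) + (\<Sum>i\<in>I. (M i \<theta>\<^sub>1)\<^sup>2)"
  have W0: "W \<ge> 0" and E0: "E \<ge> 0"
    by (auto simp: W_def \<Phi>_def E_def intro!: add_nonneg_nonneg sum_nonneg)
  have "W = 0"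
  proof (rule ccontr)
    assume "W \<noteq> 0"
    with W0 have W: "W > 0" by simp
    \<comment> \<open>This \<open>s\<close> minimises \<open>(1 - s)^2 W + s^2 E\<close>; the
      minimum \<open>W E / (W + E)\<close> is below \<open>W\<close>.\<close>
    define s where "s = W / (W + E)"
    have s: "0 \<le> s" "s \<le> 1" using W E0 by (auto simp: s_def)
    obtain \<theta> where t: "\<theta> \<in> \<Theta>"
      and Lt: "\<And>j. j \<in> J \<Longrightarrow> L j \<theta> = of_real (1 - s) * L j \<theta>\<^sub>0 + of_real s * L j \<theta>\<^sub>1"
      and Mt: "\<And>i. i \<in> I \<Longrightarrow> M i \<theta> \<le> (1 - s) * M i \<theta>\<^sub>0 + s * M i \<theta>\<^sub>1"
      using conv[OF t0 t1 s] by blast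
    have "(max 0 (M i \<theta>))\<^sup>2 \<le> ((1 - s) * \<mu> i + s * M i \<theta>\<^sub>1)\<^sup>2" if "i \<in> I" for i
    proof -
      have "M i \<theta> \<le> (1 - s) * \<mu> i + s * M i \<theta>\<^sub>1"
        using Mt[OF that] s mult_left_mono[of "M i \<theta>\<^sub>0" "\<mu> i" "1 - s"] by (auto simp: \<mu>_def)
      then show ?thesis
        by (cases "M i \<theta> \<le> 0") (auto simp: max_def intro: power_mono)
    qed
    then have "\<Phi> \<theta> \<le> (\<Sum>j\<in>J. (cmod (of_real (1 - s) * L j \<theta>\<^sub>0 + of_real s * L j \<theta>\<^sub>1))\<^sup>2)
        + (\<Sum>i\<in>I. ((1 - s) * \<mu> i + s * M i \<theta>\<^sub>1)\<^sup>2)"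
      unfolding \<Phi>_def by (intro add_mono sum_mono) (auto simp: Lt)
    also have "\<dots> = (\<Sum>j\<in>J. (1 - s)\<^sup>2 * (cmod (L j \<theta>\<^sub>0))\<^sup>2
           + 2 * s * (1 - s) * Re (cnj (L j \<theta>\<^sub>0) * L j \<theta>\<^sub>1) + s\<^sup>2 * (cmod (L j \<theta>\<^sub>1))\<^sup>2)
        + (\<Sum>i\<in>I. (1 - s)\<^sup>2 * (\<mu> i)\<^sup>2 + 2 * s * (1 - s) * (\<mu> i * M i \<theta>\<^sub>1) + s\<^sup>2 * (M i \<theta>\<^sub>1)\<^sup>2)"
      unfolding norm_sq_convex_combination
      by (intro arg_cong2[of _ _ _ _ "(+)"] refl sum.cong) (auto simp: power2_eq_square algebra_simps)
    also have "\<dots> = (1 - s)\<^sup>2 * W + 2 * s * (1 - s) *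
          (Re (\<Sum>j\<in>J. cnj (L j \<theta>\<^sub>0) * L j \<theta>\<^sub>1) + (\<Sum>i\<in>I. \<mu> i * M i \<theta>\<^sub>1)) + s\<^sup>2 * E"
      by (simp add: W_def E_def \<Phi>_def \<mu>_def sum.distrib sum_distrib_left Re_sum distrib_left)
    also have "\<dots> \<le> (1 - s)\<^sup>2 * W + s\<^sup>2 * E"
      using neg s by (auto intro!: mult_nonneg_nonpos)
    also have "\<dots> = W * (E / (W + E))"
    proof -
      have s_eqs: "(1 - s) * (W + E) = E" "s * (W + E) = W"
        using W E0 by (auto simp: s_def field_simps)
      then have "(1 - s) * W = s * E" by (simp add: algebra_simps)
      then have "(1 - s)\<^sup>2 * W + s\<^sup>2 * E = (1 - s) * (s * E) + s * (s * E)"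
        by (simp add: power2_eq_square mult.assoc)
      also have "\<dots> = s * E" by (simp add: algebra_simps)
      finally show ?thesis by (simp add: s_def)
    qed
    also have "\<dots> < W"
      using W E0 by (simp add: field_simps)
    finally show False using min[OF t] by (simp add: W_def)
  qed
  then have "(\<Sum>j\<in>J. (cmod (L j \<theta>\<^sub>0))\<^sup>2) = 0" "(\<Sum>i\<in>I. (max 0 (M i \<theta>\<^sub>0))\<^sup>2) = 0"
    unfolding W_def \<Phi>_def by (smt (verit) sum_nonneg zero_le_power2)+
  then have "\<forall>j\<in>J. L j \<theta>\<^sub>0 = 0" "\<forall>i\<in>I. max 0 (M i \<theta>\<^sub>0) = 0"
    using fin by (simp_all add: sum_nonneg_eq_0_iff)
  then show ?thesis using t0 by (metis max.cobounded2)
qed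

text \<open>Compactness passes from finitely many equations to infinitely many; later there is one
  equation for each functional and each point of \<open>U\<close>.\<close>

lemma convex_feasibility:
  fixes L :: "'j \<Rightarrow> 't::topological_space \<Rightarrow> complex" and M :: "'i \<Rightarrow> 't \<Rightarrow> real"
  assumes "compact \<Theta>" and "finite I"
    and contL: "\<And>j. j \<in> J \<Longrightarrow> continuous_on \<Theta> (L j)"
    and contM: "\<And>i. i \<in> I \<Longrightarrow> continuous_on \<Theta> (M i)"
    and conv: "\<And>\<theta>\<^sub>1 \<theta>\<^sub>2 s. \<theta>\<^sub>1 \<in> \<Theta> \<Longrightarrow> \<theta>\<^sub>2 \<in> \<Theta> \<Longrightarrow> 0 \<le> s \<Longrightarrow> s \<le> 1 \<Longrightarrow> \<exists>\<theta>\<in>\<Theta>.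
        (\<forall>j\<in>J. L j \<theta> = of_real (1 - s) * L j \<theta>\<^sub>1 + of_real s * L j \<theta>\<^sub>2) \<and>
        (\<forall>i\<in>I. M i \<theta> \<le> (1 - s) * M i \<theta>\<^sub>1 + s * M i \<theta>\<^sub>2)"
    and dual: "\<And>J' c \<mu>. finite J' \<Longrightarrow> J' \<subseteq> J \<Longrightarrow> (\<And>i. 0 \<le> \<mu> i) \<Longrightarrow> \<exists>\<theta>\<in>\<Theta>.
        Re (\<Sum>j\<in>J'. c j * L j \<theta>) + (\<Sum>i\<in>I. \<mu> i * M i \<theta>) \<le> 0"
  shows "\<exists>\<theta>\<in>\<Theta>. (\<forall>j\<in>J. L j \<theta> = 0) \<and> (\<forall>i\<in>I. M i \<theta> \<le> 0)"
proof -
  have fin: "\<exists>\<theta>\<in>\<Theta>. (\<forall>j\<in>J'. L j \<theta> = 0) \<and> (\<forall>i\<in>I. M i \<theta> \<le> 0)"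
    if "finite J'" "J' \<subseteq> J" for J'
  proof (rule finite_convex_feasibility[OF \<open>compact \<Theta>\<close> \<open>finite J'\<close> \<open>finite I\<close>])
    show "\<exists>\<theta>\<in>\<Theta>. (\<forall>j\<in>J'. L j \<theta> = of_real (1 - s) * L j \<theta>\<^sub>1 + of_real s * L j \<theta>\<^sub>2) \<and>
        (\<forall>i\<in>I. M i \<theta> \<le> (1 - s) * M i \<theta>\<^sub>1 + s * M i \<theta>\<^sub>2)"
      if "\<theta>\<^sub>1 \<in> \<Theta>" "\<theta>\<^sub>2 \<in> \<Theta>" "0 \<le> s" "s \<le> 1" for \<theta>\<^sub>1 \<theta>\<^sub>2 s
      using conv[OF that] \<open>J' \<subseteq> J\<close> by blast
  qed (use that contL contM dual in auto)
  \<comment> \<open>Continuity holds on \<open>\<Theta>\<close> only, so the level sets are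
    represented as traces of closed sets, to which the finite intersection property applies.\<close>
  have "\<exists>C. closed C \<and> C \<inter> \<Theta> = L j -` {0} \<inter> \<Theta>" if "j \<in> J" for j
    using contL[OF that] unfolding continuous_on_closed_invariant by (metis closed_singleton)
  then obtain C where C: "\<And>j. j \<in> J \<Longrightarrow> closed (C j) \<and> C j \<inter> \<Theta> = L j -` {0} \<inter> \<Theta>"
    by metis
  have "\<exists>D. closed D \<and> D \<inter> \<Theta> = M i -` {..0} \<inter> \<Theta>" if "i \<in> I" for i
    using contM[OF that] unfolding continuous_on_closed_invariant by (metis closed_atMost)
  then obtain D where D: "\<And>i. i \<in> I \<Longrightarrow> closed (D i) \<and> D i \<inter> \<Theta> = M i -` {..0} \<inter> \<Theta>"
    by metis
  have "compact (\<Theta> \<inter> (\<Inter>i\<in>I. D i))"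
    using D \<open>compact \<Theta>\<close> by (auto intro!: compact_Int_closed closed_INT)
  then have "(\<Theta> \<inter> (\<Inter>i\<in>I. D i)) \<inter> (\<Inter>j\<in>J. C j) \<noteq> {}"
  proof (rule compact_imp_fip_image)
    show "(\<Theta> \<inter> (\<Inter>i\<in>I. D i)) \<inter> (\<Inter>j\<in>J'. C j) \<noteq> {}" if J': "finite J'" "J' \<subseteq> J" for J'
    proof -
      obtain \<theta> where "\<theta> \<in> \<Theta>" "\<forall>j\<in>J'. L j \<theta> = 0" "\<forall>i\<in>I. M i \<theta> \<le> 0"
        using fin[OF J'] by blast
      then have "\<theta> \<in> (\<Theta> \<inter> (\<Inter>i\<in>I. D i)) \<inter> (\<Inter>j\<in>J'. C j)"
        using C D J' by blast
      then show ?thesis by blast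
    qed
  qed (use C in auto)
  then obtain \<theta> where t: "\<theta> \<in> \<Theta>" "\<And>i. i \<in> I \<Longrightarrow> \<theta> \<in> D i" "\<And>j. j \<in> J \<Longrightarrow> \<theta> \<in> C j"
    by blast
  have "L j \<theta> = 0" if "j \<in> J" for j using C[OF that] t(3)[OF that] t(1) by blast
  moreover have "M i \<theta> \<le> 0" if "i \<in> I" for i using D[OF that] t(2)[OF that] t(1) by blast
  ultimately show ?thesis using t(1) by blast
qed

section \<open>Compactness of the unit ball of the weighted space\<close>

text \<open>Tychonoff's theorem; the topology of a function type is that of pointwise
  convergence.\<close>

lemma compact_Collect_fun:
  fixes K :: "'i \<Rightarrow> 'b::topological_space set"
  assumes "\<And>i. compact (K i)"
  shows "compact {f. \<forall>i. f i \<in> K i}"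
proof -
  have "compactin (product_topology (\<lambda>i. euclidean) UNIV) (PiE UNIV K)"
    using assms by (simp add: compactin_PiE)
  moreover have "PiE UNIV K = {f. \<forall>i. f i \<in> K i}" by auto
  ultimately show ?thesis by (simp add: euclidean_product_topology)
qed

section \<open>Cauchy estimates along complex lines\<close>

lemma bounded_linear_scaleC_left: "bounded_linear (\<lambda>z. z *\<^sub>C (k::'a::complex_normed_vector))"
  by (rule bounded_linear_intro[where K="norm k"])
    (auto simp: scaleC_add_left scaleR_eq_scaleC scaleR_conv_of_real scaleC_scaleC norm_scaleC scaleC_complex_def)

lemma holomorphic_into_line:
  fixes g :: "'a::complex_normed_vector \<Rightarrow> complex"
  assumes "(g has_derivative D) (at (x + z *\<^sub>C k))" and "\<And>c h. D (c *\<^sub>C h) = c *\<^sub>C D h"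
  shows "((\<lambda>z. g (x + z *\<^sub>C k)) has_field_derivative D k) (at z)"
proof -
  have "((\<lambda>z. x + z *\<^sub>C k) has_derivative (\<lambda>z. z *\<^sub>C k)) (at z)"
    using bounded_linear.has_derivative[OF bounded_linear_scaleC_left has_derivative_ident, of k]
    by (auto intro!: derivative_eq_intros)
  then have "((\<lambda>z. g (x + z *\<^sub>C k)) has_derivative (\<lambda>z. D (z *\<^sub>C k))) (at z)"
    using assms(1) by (rule has_derivative_compose)
  moreover have "(\<lambda>z. D (z *\<^sub>C k)) = (*) (D k)"
    by (auto simp: fun_eq_iff assms(2) scaleC_complex_def)
  ultimately show ?thesis
    by (simp add: has_field_derivative_def)
qed

text \<open>Cauchy's inequality and Taylor's formula on the line through \<open>x\<close> in
  direction \<open>k\<close>. The constants depend on \<open>L\<close> and \<open>r\<close> but not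
  on \<open>g\<close>, so the estimates survive pointwise limits.\<close>

lemma holomorphic_into_second_order:
  fixes g :: "'a::complex_normed_vector \<Rightarrow> complex"
  assumes g: "holomorphic_into U whole g" and "0 < r" and ball: "ball x (2 * r) \<subseteq> U"
    and bound: "\<And>y. y \<in> ball x (2 * r) \<Longrightarrow> cmod (g y) \<le> L"
    and D: "(g has_derivative D) (at x)" "\<And>c h. D (c *\<^sub>C h) = c *\<^sub>C D h"
  shows "cmod (D k) \<le> L / r * norm k"
    and "norm k < r \<Longrightarrow> cmod (g (x + k) - g x - D k) \<le> 2 * L / r\<^sup>2 * (norm k)\<^sup>2"
proof -
  interpret D: bounded_linear D using D(1) by (rule has_derivative_bounded_linear)
  have "cmod (D k) \<le> L / r * norm k \<and>
    (norm k < r \<longrightarrow> cmod (g (x + k) - g x - D k) \<le> 2 * L / r\<^sup>2 * (norm k)\<^sup>2)"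
  proof (cases "k = 0")
    case True
    then show ?thesis by simp
  next
    case False
    \<comment> \<open>Circles of radius \<open>\<rho>\<close> about points of
      \<open>ball 0 \<rho>\<close> stay in \<open>ball 0 (2 * \<rho>)\<close>, which the line maps
      into \<open>ball x (2 * r)\<close>. The point 1 belongs to \<open>ball 0 \<rho>\<close>
      exactly when \<open>norm k < r\<close>.\<close>
    define \<rho> where "\<rho> = r / norm k"
    have "\<rho> > 0" using False \<open>0 < r\<close> by (simp add: \<rho>_def)
    define \<phi> where "\<phi> z = g (x + z *\<^sub>C k)" for z
    have inball: "x + z *\<^sub>C k \<in> ball x (2 * r)" if "z \<in> ball 0 (2 * \<rho>)" for z
      using that False by (simp add: dist_norm norm_scaleC \<rho>_def field_simps)
    have deriv: "\<exists>w. (\<phi> has_field_derivative w) (at z)" if z: "z \<in> ball 0 (2 * \<rho>)" for z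
    proof -
      obtain D' where "(g has_derivative D') (at (x + z *\<^sub>C k))" "\<forall>c h. D' (c *\<^sub>C h) = c *\<^sub>C D' h"
        using g inball[OF z] ball unfolding holomorphic_into_whole_iff by blast
      then show ?thesis unfolding \<phi>_def by (blast intro: holomorphic_into_line)
    qed
    then have hol: "\<phi> holomorphic_on ball 0 (2 * \<rho>)"
      by (auto simp: holomorphic_on_open)
    have "0 *\<^sub>C k = 0" using norm_scaleC[of 0 k] by simp
    then have "(\<phi> has_field_derivative D k) (at 0)"
      unfolding \<phi>_def using D by (intro holomorphic_into_line) auto
    then have d0: "deriv \<phi> 0 = D k" by (rule DERIV_imp_deriv)
    have \<phi>b: "cmod (\<phi> z) \<le> L" if "z \<in> ball 0 (2 * \<rho>)" for z
      using bound[OF inball[OF that]] by (simp add: \<phi>_def)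
    have cauchy: "cmod ((deriv ^^ n) \<phi> z) \<le> fact n * L / \<rho> ^ n" if "z \<in> ball 0 \<rho>" for n z
    proof (rule Cauchy_inequality[OF _ _ \<open>\<rho> > 0\<close>])
      have sub: "cball z \<rho> \<subseteq> ball 0 (2 * \<rho>)"
      proof
        fix w assume "w \<in> cball z \<rho>"
        then show "w \<in> ball 0 (2 * \<rho>)"
          using that norm_triangle_ineq[of "z" "w - z"] by (simp add: dist_norm norm_minus_commute)
      qed
      show "\<phi> holomorphic_on ball z \<rho>"
        using hol sub ball_subset_cball by (blast intro: holomorphic_on_subset)
      show "continuous_on (cball z \<rho>) \<phi>"
        using hol sub by (blast intro: holomorphic_on_imp_continuous_on holomorphic_on_subset)
      show "cmod (\<phi> w) \<le> L" if "cmod (z - w) = \<rho>" for w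
        using that sub by (intro \<phi>b) (auto simp: dist_norm subset_iff)
    qed
    have 1: "cmod (D k) \<le> L / r * norm k"
      using cauchy[of 0 1] \<open>\<rho> > 0\<close> \<open>0 < r\<close> by (simp add: d0 \<rho>_def)
    have 2: "cmod (g (x + k) - g x - D k) \<le> 2 * L / r\<^sup>2 * (norm k)\<^sup>2" if "norm k < r"
    proof -
      have hol': "\<phi> holomorphic_on ball 0 \<rho>"
        using hol \<open>\<rho> > 0\<close> by (auto intro: holomorphic_on_subset)
      have d: "((deriv ^^ i) \<phi> has_field_derivative (deriv ^^ Suc i) \<phi> z) (at z within ball 0 \<rho>)"
        if "z \<in> ball 0 \<rho>" for i z
      proof -
        have "((deriv ^^ i) \<phi> has_field_derivative deriv ((deriv ^^ i) \<phi>) z) (at z)"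
          using holomorphic_higher_deriv[OF hol' open_ball, of i] that by (intro holomorphic_derivI[of _ "ball 0 \<rho>"]) auto
        then show ?thesis by (simp add: has_field_derivative_at_within)
      qed
      have b: "cmod ((deriv ^^ Suc 1) \<phi> z) \<le> 2 * L / \<rho>\<^sup>2" if "z \<in> ball 0 \<rho>" for z
        using cauchy[OF that, of 2] by (simp add: numeral_2_eq_2)
      have pts: "(0::complex) \<in> ball 0 \<rho>" "(1::complex) \<in> ball 0 \<rho>"
        using that False \<open>\<rho> > 0\<close> by (simp_all add: \<rho>_def dist_norm)
      have "cmod (\<phi> 1 - (\<phi> 0 + deriv \<phi> 0)) \<le> 2 * L / \<rho>\<^sup>2"
        using complex_Taylor[of "ball 0 \<rho>" 1 "\<lambda>i. (deriv ^^ i) \<phi>", OF convex_ball d b pts]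
        unfolding One_nat_def by simp
      moreover have "\<phi> 1 = g (x + k)" "\<phi> 0 = g x"
        by (simp_all add: \<phi>_def scaleC_one \<open>0 *\<^sub>C k = 0\<close>)
      moreover have "2 * L / \<rho>\<^sup>2 = 2 * L / r\<^sup>2 * (norm k)\<^sup>2"
        by (simp add: \<rho>_def power_divide)
      ultimately show ?thesis
        by (simp only: d0 diff_diff_eq)
    qed
    from 1 2 show ?thesis by blast
  qed
  then show "cmod (D k) \<le> L / r * norm k"
    and "norm k < r \<Longrightarrow> cmod (g (x + k) - g x - D k) \<le> 2 * L / r\<^sup>2 * (norm k)\<^sup>2" by auto
qed

lemma bounded_linear_complexI:
  fixes D :: "'a::complex_normed_vector \<Rightarrow> complex"
  assumes "\<And>h k. D (h + k) = D h + D k" "\<And>c k. D (c *\<^sub>C k) = c * D k" "\<And>k. cmod (D k) \<le> C * norm k"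
  shows "bounded_linear D"
  by (rule bounded_linear_intro[where K=C])
    (auto simp: assms scaleR_eq_scaleC scaleC_complex_def mult.commute)

lemma has_derivative_quadratic_remainder:
  fixes g :: "'a::real_normed_vector \<Rightarrow> 'b::real_normed_vector"
  assumes "bounded_linear D" "0 < r"
    and rem: "\<And>k. norm k < r \<Longrightarrow> norm (g (x + k) - g x - D k) \<le> C * (norm k)\<^sup>2"
  shows "(g has_derivative D) (at x)"
  unfolding has_derivative_at
proof (intro conjI \<open>bounded_linear D\<close>)
  show "(\<lambda>k. norm (g (x + k) - g x - D k) / norm k) \<midarrow>0\<rightarrow> 0"
  proof (rule Lim_null_comparison)
    show "((\<lambda>k::'a. C * norm k) \<longlongrightarrow> 0) (at 0)"
      by (auto intro!: tendsto_eq_intros)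
    have "\<forall>\<^sub>F k::'a in at 0. norm k < r \<and> k \<noteq> 0"
      unfolding eventually_at using \<open>0 < r\<close> by (auto simp: dist_norm)
    then show "\<forall>\<^sub>F k in at 0. norm (norm (g (x + k) - g x - D k) / norm k) \<le> C * norm k"
    proof eventually_elim
      case (elim k)
      then show ?case using rem[of k] by (simp add: field_simps power2_eq_square)
    qed
  qed
qed

lemma unit_ball_HvC_iff:
  "g \<in> unit_ball (HvC U v) \<longleftrightarrow> holomorphic_into U whole g \<and> (\<forall>x. x \<notin> U \<longrightarrow> g x = 0) \<and>
    (\<forall>x\<in>U. v x * cmod (g x) \<le> 1)"
proof
  assume g: "g \<in> unit_ball (HvC U v)"
  then have "bdd_above (insert 0 ((\<lambda>x. v x * cmod (g x)) ` U))"
    by (simp add: unit_ball_def Hv_def whole_def)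
  then have "v x * cmod (g x) \<le> Sup (insert 0 ((\<lambda>x. v x * cmod (g x)) ` U))" if "x \<in> U" for x
    using that by (intro cSup_upper) auto
  moreover have "Sup (insert 0 ((\<lambda>x. v x * cmod (g x)) ` U)) \<le> 1"
    using g by (simp add: unit_ball_def Hv_def whole_def)
  ultimately show "holomorphic_into U whole g \<and> (\<forall>x. x \<notin> U \<longrightarrow> g x = 0) \<and>
    (\<forall>x\<in>U. v x * cmod (g x) \<le> 1)"
    using g by (auto simp: unit_ball_def Hv_def intro: order_trans)
next
  assume g: "holomorphic_into U whole g \<and> (\<forall>x. x \<notin> U \<longrightarrow> g x = 0) \<and> (\<forall>x\<in>U. v x * cmod (g x) \<le> 1)"
  then have "Sup (insert 0 ((\<lambda>x. v x * cmod (g x)) ` U)) \<le> 1"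
    by (intro cSup_least) auto
  moreover have "bdd_above ((\<lambda>x. v x * cmod (g x)) ` U)"
    using g by (intro bdd_aboveI2[where M = 1]) auto
  moreover have "nrm whole = cmod" by (simp add: whole_def)
  ultimately show "g \<in> unit_ball (HvC U v)"
    using g by (simp add: unit_ball_def Hv_def)
qed

text \<open>Yields at each point one radius and one bound valid for the whole unit ball, whose
  members satisfy \<open>cmod (g y) \<le> 1 / v y\<close>.\<close>

lemma weight_locally_bounded_below:
  fixes U :: "'a::real_normed_vector set"
  assumes "open U" "weight U v" "x \<in> U"
  shows "\<exists>r L. 0 < r \<and> ball x (2 * r) \<subseteq> U \<and> (\<forall>y\<in>ball x (2 * r). 1 / v y \<le> L)"
proof -
  have vx: "v x > 0" and contv: "isCont v x"
    using assms by (auto simp: weight_def continuous_on_eq_continuous_at)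
  have "\<forall>\<^sub>F y in nhds x. v y > v x / 2"
    using contv vx
    unfolding isCont_def tendsto_at_iff_tendsto_nhds
    using order_tendstoD(1)[of v "v x" "nhds x" "v x / 2"] by simp
  moreover have "\<forall>\<^sub>F y in nhds x. y \<in> U"
    using assms by (simp add: eventually_nhds_in_open)
  ultimately have "\<forall>\<^sub>F y in nhds x. v y > v x / 2 \<and> y \<in> U" by (rule eventually_conj)
  then obtain d where d: "d > 0" "\<And>y. dist y x < d \<Longrightarrow> v y > v x / 2 \<and> y \<in> U"
    by (auto simp: eventually_nhds_metric)
  have "1 / v y \<le> 2 / v x" if "dist y x < d" for y
    using d(2)[OF that] vx by (simp add: field_simps)
  with d show ?thesis
    by (intro exI[of _ "d / 2"] exI[of _ "2 / v x"]) (auto simp: dist_commute)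
qed

text \<open>Differentiability is not visibly a closed condition for pointwise convergence. It
  becomes one when the derivative is adjoined as a second coordinate: additivity, homogeneity and
  the quadratic remainder bound are closed conditions on the pair. The unit ball is then a
  projection of a compact set.\<close>

lemma compact_unit_ball_HvC:
  fixes U :: "'a::complex_normed_vector set"
  assumes "open U" "weight U v"
  shows "compact (unit_ball (HvC U v))"
proof -
  have v: "v x > 0" if "x \<in> U" for x using assms that by (simp add: weight_def)
  obtain r L where r: "\<And>x. x \<in> U \<Longrightarrow> 0 < r x \<and> ball x (2 * r x) \<subseteq> U \<and> (\<forall>y\<in>ball x (2 * r x). 1 / v y \<le> L x)"
    using weight_locally_bounded_below[OF assms] by metis
  define G where "G = {g :: 'a \<Rightarrow> complex. \<forall>x. g x \<in> (if x \<in> U then cball 0 (1 / v x) else {0})}"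
  \<comment> \<open>The first Cauchy estimate confines all derivatives to a product of discs; fixing
    the value 0 off \<open>U\<close> keeps every factor compact.\<close>
  define \<D> where "\<D> = {D :: 'a \<Rightarrow> 'a \<Rightarrow> complex. \<forall>x. D x \<in> {D'. \<forall>k. D' k \<in>
    (if x \<in> U then cball 0 (L x / r x * norm k) else {0})}}"
  define R where "R = {(g :: 'a \<Rightarrow> complex, D :: 'a \<Rightarrow> 'a \<Rightarrow> complex). \<forall>x\<in>U.
    (\<forall>h k. D x (h + k) = D x h + D x k) \<and> (\<forall>c k. D x (c *\<^sub>C k) = c * D x k) \<and>
    (\<forall>k. norm k < r x \<longrightarrow> cmod (g (x + k) - g x - D x k) \<le> 2 * L x / (r x)\<^sup>2 * (norm k)\<^sup>2)}"
  have cont1: "continuous_on UNIV (\<lambda>p :: ('a \<Rightarrow> complex) \<times> ('a \<Rightarrow> 'a \<Rightarrow> complex). fst p x)" for x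
    by (rule continuous_on_product_then_coordinatewise[OF continuous_on_fst[OF continuous_on_id]])
  have cont2: "continuous_on UNIV (\<lambda>p :: ('a \<Rightarrow> complex) \<times> ('a \<Rightarrow> 'a \<Rightarrow> complex). snd p x k)" for x k
    by (rule continuous_on_product_then_coordinatewise[OF
          continuous_on_product_then_coordinatewise[OF continuous_on_snd[OF continuous_on_id]]])
  have "compact G" "compact \<D>"
    unfolding G_def \<D>_def by (intro compact_Collect_fun; simp)+
  moreover have "closed R"
    unfolding R_def case_prod_unfold Ball_def
    by (intro closed_Collect_all closed_Collect_imp closed_Collect_conj closed_Collect_eq closed_Collect_le
        continuous_intros cont1 cont2) auto
  ultimately have "compact ((G \<times> \<D>) \<inter> R)"
    by (intro compact_Int_closed compact_Times)
  then have "compact (fst ` ((G \<times> \<D>) \<inter> R))"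
    by (intro compact_continuous_image continuous_on_fst continuous_on_id)
  moreover have "fst ` ((G \<times> \<D>) \<inter> R) = unit_ball (HvC U v)"
  proof (intro equalityI subsetI)
    fix g assume "g \<in> fst ` ((G \<times> \<D>) \<inter> R)"
    then obtain D where g: "g \<in> G" and D: "D \<in> \<D>" "(g, D) \<in> R" by auto
    have "\<exists>D'. (g has_derivative D') (at x) \<and> (\<forall>c h. D' (c *\<^sub>C h) = c *\<^sub>C D' h)" if "x \<in> U" for x
    proof (intro exI conjI)
      have "cmod (D x k) \<le> L x / r x * norm k" for k
        using D(1)[unfolded \<D>_def mem_Collect_eq, rule_format, of x k] that by simp
      then have "bounded_linear (D x)"
        using D(2) that by (intro bounded_linear_complexI[where C = "L x / r x"]) (auto simp: R_def)
      then show "(g has_derivative D x) (at x)"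
        using D(2) r[OF that] that by (intro has_derivative_quadratic_remainder[where r="r x" and C="2 * L x / (r x)\<^sup>2"]) (auto simp: R_def)
      show "\<forall>c h. D x (c *\<^sub>C h) = c *\<^sub>C D x h"
        using D(2) that by (simp add: R_def scaleC_complex_def)
    qed
    moreover have "v x * cmod (g x) \<le> 1" if "x \<in> U" for x
    proof -
      have "cmod (g x) \<le> 1 / v x" using g that by (auto simp: G_def dest!: spec[of _ x])
      then show ?thesis using v[OF that] by (simp add: field_simps)
    qed
    moreover have "g x = 0" if "x \<notin> U" for x
      using g that by (auto simp: G_def dest!: spec[of _ x])
    ultimately show "g \<in> unit_ball (HvC U v)"
      unfolding unit_ball_HvC_iff holomorphic_into_whole_iff by blast
  next
    fix g assume "g \<in> unit_ball (HvC U v)"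
    then have hol: "holomorphic_into U whole g" and g0: "\<And>x. x \<notin> U \<Longrightarrow> g x = 0"
      and gb: "\<And>x. x \<in> U \<Longrightarrow> v x * cmod (g x) \<le> 1"
      by (auto simp: unit_ball_HvC_iff)
    have gb': "cmod (g x) \<le> 1 / v x" if "x \<in> U" for x
      using gb[OF that] v[OF that] by (simp add: field_simps)
    obtain D where D: "\<And>x. x \<in> U \<Longrightarrow> (g has_derivative D x) (at x)"
        "\<And>x c h. x \<in> U \<Longrightarrow> D x (c *\<^sub>C h) = c *\<^sub>C D x h"
      using hol unfolding holomorphic_into_whole_iff by metis
    define D' where "D' x = (if x \<in> U then D x else (\<lambda>_. 0))" for x
    have gL: "cmod (g y) \<le> L x" if "x \<in> U" "y \<in> ball x (2 * r x)" for x y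
      using gb'[of y] r[OF that(1)] that(2) by force
    note so = holomorphic_into_second_order[OF hol]
    have "(g, D') \<in> (G \<times> \<D>) \<inter> R"
    proof (intro IntI SigmaI)
      show "g \<in> G" using g0 gb' by (simp add: G_def)
      show "D' \<in> \<D>"
        using so(1)[OF _ _ gL D] r by (auto simp: D'_def \<D>_def)
      show "(g, D') \<in> R"
        using so(2)[OF _ _ gL D] r D(2) has_derivative_bounded_linear[OF D(1)]
        by (auto simp: D'_def R_def scaleC_complex_def linear_simps)
    qed
    then show "g \<in> fst ` ((G \<times> \<D>) \<inter> R)" by force
  qed
  ultimately show ?thesis by simp
qed

section \<open>Finite families: the dual estimate\<close>

text \<open>The junk value of the conjugate index of \<open>1\<close> is \<open>1 / 0 = 0\<close>, hence the case distinction.\<close>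

definition conj_ball :: "real \<Rightarrow> 'i set \<Rightarrow> ('i \<Rightarrow> complex) \<Rightarrow> bool" where
  "conj_ball p I a \<longleftrightarrow> (if p = 1 then \<forall>i\<in>I. cmod (a i) \<le> 1
     else (\<Sum>i\<in>I. cmod (a i) powr conjugate_index p) \<le> 1)"

lemma conjugate_index:
  assumes "1 < p"
  shows "1 < conjugate_index p" "1 / p + 1 / conjugate_index p = 1" "p / conjugate_index p = p - 1"
  using assms by (auto simp: conjugate_index_def field_simps)

text \<open>The approximant must not exceed \<open>z\<close> in modulus, so that its powers cost no
  more than those of \<open>z\<close> in the coefficient constraint. Pulling the points
  \<open>n\<close> of an ordinary net of mesh \<open>\<delta> / 2\<close> towards 0 by
  \<open>\<delta> / 2\<close> offsets their possible excess over \<open>cmod z\<close>.\<close>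

lemma finite_radial_net_complex:
  assumes "0 < \<delta>" "1 \<le> R"
  shows "\<exists>G. finite G \<and> 0 \<in> G \<and> 1 \<in> G \<and> (\<forall>z\<in>G. cmod z \<le> R) \<and>
    (\<forall>z. cmod z \<le> R \<longrightarrow> (\<exists>z'\<in>G. cmod z' \<le> cmod z \<and> cmod (z - z') \<le> \<delta>))"
proof -
  have "compact (cball (0::complex) R)" by simp
  then obtain N where N: "finite N" "cball (0::complex) R \<subseteq> (\<Union>x\<in>N. ball x (\<delta> / 2))"
    using \<open>0 < \<delta>\<close> unfolding compact_eq_totally_bounded by (metis half_gt_zero)
  define sh where "sh n = of_real (max 0 (cmod n - \<delta> / 2)) * sgn n" for n :: complex
  have sh1: "cmod (sh n) = max 0 (cmod n - \<delta> / 2)" for n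
    using \<open>0 < \<delta>\<close> by (cases "n = 0") (auto simp: sh_def norm_mult norm_sgn)
  have sh2: "cmod (n - sh n) \<le> \<delta> / 2" for n
  proof -
    have "n - sh n = of_real (cmod n - max 0 (cmod n - \<delta> / 2)) * sgn n"
      by (simp add: sh_def sgn_eq algebra_simps)
    then have "cmod (n - sh n) \<le> \<bar>cmod n - max 0 (cmod n - \<delta> / 2)\<bar> * 1"
      by (simp only: norm_mult norm_of_real) (intro mult_left_mono, auto simp: norm_sgn)
    then show ?thesis using \<open>0 < \<delta>\<close> by (auto simp: max_def split: if_splits)
  qed
  define G where "G = insert 0 (insert 1 ({z \<in> sh ` N. cmod z \<le> R}))"
  have "\<exists>z'\<in>G. cmod z' \<le> cmod z \<and> cmod (z - z') \<le> \<delta>" if z: "cmod z \<le> R" for z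
  proof -
    obtain n where n: "n \<in> N" "cmod (n - z) < \<delta> / 2"
      using N(2) z by (force simp: dist_norm)
    have "cmod n \<le> cmod z + cmod (n - z)"
      using norm_triangle_ineq[of z "n - z"] by simp
    then have 1: "cmod (sh n) \<le> cmod z" using n by (simp add: sh1)
    have "cmod (z - sh n) \<le> cmod (n - z) + cmod (n - sh n)"
      using norm_triangle_ineq[of "z - n" "n - sh n"] by (simp add: norm_minus_commute)
    then have "cmod (z - sh n) \<le> \<delta>" using n sh2[of n] by linarith
    with 1 z n show ?thesis by (auto simp: G_def)
  qed
  then show ?thesis using N(1) \<open>1 \<le> R\<close>
    by (intro exI[of _ G]) (auto simp: G_def)
qed

text \<open>The prescribed members serve the separation argument: the unit vectors bound the single
  functions \<open>w d\<close> by 1, and the zero vector makes the constant term \<open>b\<close> of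
  the separating functional positive.\<close>

lemma finite_radial_net:
  fixes D :: "'d set"
  assumes "finite D" "0 < \<delta>" "1 \<le> R"
  shows "\<exists>Q. finite Q \<and> (\<lambda>_. 0) \<in> Q \<and> (\<forall>d\<in>D. (\<lambda>d'. if d' = d then 1 else 0) \<in> Q) \<and>
    (\<forall>q\<in>Q. \<forall>d. cmod (q d) \<le> R) \<and>
    (\<forall>z. (\<forall>d\<in>D. cmod (z d) \<le> R) \<longrightarrow>
      (\<exists>q\<in>Q. \<forall>d\<in>D. cmod (q d) \<le> cmod (z d) \<and> cmod (z d - q d) \<le> \<delta>))"
proof -
  obtain G where G: "finite G" "0 \<in> G" "1 \<in> G" "\<And>z. z \<in> G \<Longrightarrow> cmod z \<le> R"
    "\<And>z. cmod z \<le> R \<Longrightarrow> \<exists>z'\<in>G. cmod z' \<le> cmod z \<and> cmod (z - z') \<le> \<delta>"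
    using finite_radial_net_complex[OF assms(2,3)] by metis
  define Q where "Q = {q :: 'd \<Rightarrow> complex. \<forall>d. (d \<in> D \<longrightarrow> q d \<in> G) \<and> (d \<notin> D \<longrightarrow> q d = 0)}"
  have "finite Q"
    unfolding Q_def using assms(1) G(1) by (rule finite_set_of_finite_funs)
  moreover have "\<forall>q\<in>Q. \<forall>d. cmod (q d) \<le> R"
    using G(4) \<open>1 \<le> R\<close> by (auto simp: Q_def) (metis norm_zero order_trans zero_le_one)
  moreover have "\<exists>q\<in>Q. \<forall>d\<in>D. cmod (q d) \<le> cmod (z d) \<and> cmod (z d - q d) \<le> \<delta>"
    if z: "\<forall>d\<in>D. cmod (z d) \<le> R" for z
  proof -
    have "\<forall>d\<in>D. \<exists>r. r \<in> G \<and> cmod r \<le> cmod (z d) \<and> cmod (z d - r) \<le> \<delta>"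
      using z G(5) by blast
    from bchoice[OF this] obtain r where
      r: "\<forall>d\<in>D. r d \<in> G \<and> cmod (r d) \<le> cmod (z d) \<and> cmod (z d - r d) \<le> \<delta>"
      by blast
    then show ?thesis
      by (intro bexI[of _ "\<lambda>d. if d \<in> D then r d else 0"]) (auto simp: Q_def)
  qed
  ultimately show ?thesis
    using G(2,3) by (intro exI[of _ Q]) (auto simp: Q_def)
qed

text \<open>The weighted vectors \<open>t d * w d\<close> have weak \<open>\<ell>\<^sub>p\<close> norm at most \<open>(b' p)\<^bsup>1/p\<^esup>\<close>; Young's inequality
  then splits each \<open>s d\<close> into a part paid for by \<open>\<mu> d\<close> and a part paid for by \<open>b\<close>.\<close>

lemma summing_dual_estimate_gt_1:
  fixes w :: "'d \<Rightarrow> 'g \<Rightarrow> complex" and s :: "'d \<Rightarrow> complex" and p K \<kappa> \<delta> R b :: real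
  assumes p: "1 < p" and "finite D" and K: "0 < K" and \<kappa>: "0 < \<kappa>"
    and \<delta>: "\<delta> * card D \<le> \<kappa>" "0 \<le> \<delta>"
    and R: "0 \<le> R" "(1 + \<kappa>) * (p - 1) * (card D + 1) / \<kappa> \<le> R powr conjugate_index p"
    and unit: "\<And>d. d \<in> D \<Longrightarrow> (\<lambda>d'. if d' = d then 1 else 0) \<in> Q"
    and net: "\<And>z. (\<And>d. d \<in> D \<Longrightarrow> cmod (z d) \<le> R) \<Longrightarrow>
      \<exists>q\<in>Q. \<forall>d\<in>D. cmod (q d) \<le> cmod (z d) \<and> cmod (z d - q d) \<le> \<delta>"
    and \<mu>: "\<And>d. 0 \<le> \<mu> d" and b: "0 \<le> b" and total: "b + (\<Sum>d\<in>D. \<mu> d) = 1"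
    and bound: "\<And>q g. q \<in> Q \<Longrightarrow> g \<in> B \<Longrightarrow>
      cmod (\<Sum>d\<in>D. q d * w d g) \<le> b + (\<Sum>d\<in>D. \<mu> d * cmod (q d) powr conjugate_index p)"
    and summing: "\<And>t W. 0 \<le> W \<Longrightarrow>
      (\<And>a g. conj_ball p D a \<Longrightarrow> g \<in> B \<Longrightarrow> cmod (\<Sum>d\<in>D. a d * (of_real (t d) * w d g)) \<le> W) \<Longrightarrow>
      (\<Sum>d\<in>D. cmod (of_real (t d) * s d) powr p) powr (1 / p) \<le> K * W"
  shows "cmod (\<Sum>d\<in>D. s d) \<le> K * (1 + 2 * \<kappa>)"
proof -
  define p' where "p' = conjugate_index p"
  have p': "p' > 1" "1 / p + 1 / p' = 1" "p / p' = p - 1"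
    using conjugate_index[OF p] by (auto simp: p'_def)
  \<comment> \<open>Strictly positive, because \<open>\<tau>\<close> will be divided by; over
    \<open>D\<close> the increments add up to at most \<open>\<kappa>\<close>.\<close>
  define \<mu>' where "\<mu>' d = \<mu> d + \<kappa> / (card D + 1)" for d
  define b' where "b' = b + \<kappa>"
  have \<mu>': "\<mu>' d > 0" "\<mu> d \<le> \<mu>' d" "\<kappa> / (card D + 1) \<le> \<mu>' d" for d
    using \<mu>[of d] \<kappa> by (auto simp: \<mu>'_def intro!: add_nonneg_pos)
  have b': "b' > 0" "b' \<le> 1 + \<kappa>"
    using b \<kappa> total sum_nonneg[of D \<mu>] \<mu> by (auto simp: b'_def)
  have sum\<mu>': "(\<Sum>d\<in>D. \<mu>' d) \<le> (\<Sum>d\<in>D. \<mu> d) + \<kappa>"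
  proof -
    have "card D * (\<kappa> / (card D + 1)) \<le> \<kappa>" using \<kappa> by (simp add: field_simps)
    then show ?thesis by (simp add: \<mu>'_def sum.distrib)
  qed
  \<comment> \<open>Chosen so that the first term of Young's inequality,
    \<open>\<tau> d powr p' / p'\<close>, is exactly \<open>\<mu>' d\<close>.\<close>
  define \<tau> where "\<tau> d = (p' * \<mu>' d) powr (1 / p')" for d
  have \<tau>: "\<tau> d > 0" "\<tau> d powr p' = p' * \<mu>' d" for d
    using \<mu>'(1)[of d] p' by (auto simp: \<tau>_def powr_powr)
  \<comment> \<open>\<open>T\<close> minimises \<open>(b' + t powr p' / p') / t\<close> over
    \<open>t > 0\<close>, and the minimum is \<open>b' * p / T\<close>.\<close>
  define T where "T = (b' * p) powr (1 / p')"
  have T: "T > 0" "T powr p' = b' * p"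
    using b' p p' by (auto simp: T_def powr_powr)
  have TW: "b' * p / T = (b' * p) powr (1 / p)"
  proof -
    have "1 / p = 1 - 1 / p'" using p' by linarith
    then have "(b' * p) powr (1 / p) = (b' * p) powr 1 / T"
      by (simp only: powr_diff T_def)
    then show ?thesis using b' p by simp
  qed
  have w1: "cmod (w d g) \<le> 1" if "d \<in> D" "g \<in> B" for d g
  proof -
    have 1: "(\<Sum>d'\<in>D. (if d' = d then 1 else 0) * w d' g) = w d g"
      using \<open>finite D\<close> that by (simp add: if_distrib[of "\<lambda>u. u * _"] cong: if_cong)
    have "(\<Sum>d'\<in>D. \<mu> d' * cmod (if d' = d then 1 else 0) powr conjugate_index p)
        \<le> (\<Sum>d\<in>D. \<mu> d)"
      by (intro sum_mono) (use \<mu> in auto)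
    then show ?thesis
      using bound[OF unit[OF that(1)] that(2)] total unfolding 1 by linarith
  qed
  have weak: "cmod (\<Sum>d\<in>D. a d * (of_real (1 / \<tau> d) * w d g)) \<le> (b' * p) powr (1 / p)"
    if a: "conj_ball p D a" and g: "g \<in> B" for a g
  proof -
    have a': "(\<Sum>d\<in>D. cmod (a d) powr p') \<le> 1"
      using a p by (simp add: conj_ball_def p'_def)
    define z where "z d = of_real (T / \<tau> d) * a d" for d
    have zpow: "cmod (z d) powr p' = cmod (a d) powr p' * (b' * p / (p' * \<mu>' d))" for d
      using T \<tau>[of d] by (simp add: z_def norm_mult norm_divide powr_mult powr_divide)
    \<comment> \<open>The lower bound on \<open>R\<close> comes from the worst case here:
      \<open>cmod (a d) = 1\<close>, \<open>b' = 1 + \<kappa>\<close> and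
      \<open>\<mu>' d = \<kappa> / (card D + 1)\<close>.\<close>
    have zR: "cmod (z d) \<le> R" if "d \<in> D" for d
    proof -
      have "cmod (a d) powr p' \<le> 1"
        using a' member_le_sum[of d D "\<lambda>d. cmod (a d) powr p'"] that \<open>finite D\<close> by simp
      then have "cmod (z d) powr p' \<le> 1 * (b' * p / (p' * \<mu>' d))"
        unfolding zpow using b' p p' \<mu>'(1)[of d] by (intro mult_right_mono) auto
      also have "\<dots> = b' * (p - 1) / \<mu>' d"
        unfolding p'(3)[symmetric] by simp
      also have "\<dots> \<le> (1 + \<kappa>) * (p - 1) / (\<kappa> / (card D + 1))"
        using b' p \<kappa> \<mu>'[of d] by (intro frac_le mult_right_mono) auto
      also have "\<dots> \<le> R powr p'" using R by (simp add: p'_def)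
      finally show ?thesis
        using R p' powr_less_mono2[of p' R "cmod (z d)"] by (auto simp: not_le[symmetric])
    qed
    \<comment> \<open>Passing from \<open>z\<close> to \<open>q\<close> cannot raise the penalty,
      since the net is radial, and changes the sum by at most
      \<open>\<delta> * card D \<le> \<kappa>\<close>.\<close>
    obtain q where q: "q \<in> Q" "\<And>d. d \<in> D \<Longrightarrow> cmod (q d) \<le> cmod (z d)"
      "\<And>d. d \<in> D \<Longrightarrow> cmod (z d - q d) \<le> \<delta>"
      using net[of z] zR by blast
    have "(\<Sum>d\<in>D. z d * w d g) = (\<Sum>d\<in>D. q d * w d g) + (\<Sum>d\<in>D. (z d - q d) * w d g)"
      by (simp add: sum.distrib[symmetric] algebra_simps)
    also have "cmod \<dots> \<le> cmod (\<Sum>d\<in>D. q d * w d g) + cmod (\<Sum>d\<in>D. (z d - q d) * w d g)"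
      by (rule norm_triangle_ineq)
    also have "\<dots> \<le> (b + (\<Sum>d\<in>D. \<mu>' d * cmod (z d) powr p')) + \<kappa>"
    proof (rule add_mono)
      have "(\<Sum>d\<in>D. \<mu> d * cmod (q d) powr p') \<le> (\<Sum>d\<in>D. \<mu>' d * cmod (z d) powr p')"
        using \<mu> \<mu>' p' q by (intro sum_mono mult_mono powr_mono2) (auto simp: less_imp_le)
      then show "cmod (\<Sum>d\<in>D. q d * w d g) \<le> b + (\<Sum>d\<in>D. \<mu>' d * cmod (z d) powr p')"
        using bound[OF q(1) g] by (simp add: p'_def)
      have "cmod (\<Sum>d\<in>D. (z d - q d) * w d g) \<le> (\<Sum>d\<in>D. \<delta> * 1)"
      proof (rule order_trans[OF norm_sum], rule sum_mono)
        fix d assume "d \<in> D"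
        then show "cmod ((z d - q d) * w d g) \<le> \<delta> * 1"
          unfolding norm_mult using q w1 g \<delta> by (intro mult_mono) auto
      qed
      then show "cmod (\<Sum>d\<in>D. (z d - q d) * w d g) \<le> \<kappa>" using \<delta> by (simp add: mult.commute)
    qed
    also have "(\<Sum>d\<in>D. \<mu>' d * cmod (z d) powr p') = (\<Sum>d\<in>D. cmod (a d) powr p') * (b' * p / p')"
      unfolding zpow sum_distrib_right using \<mu>'(1) by (intro sum.cong) (auto simp: less_imp_neq[THEN not_sym])
    also have "\<dots> \<le> 1 * (b' * p / p')"
      using a' b' p p' by (intro mult_right_mono) auto
    also have "b + 1 * (b' * p / p') + \<kappa> = b' * p"
    proof -
      have "b' * p / p' = b' * (p - 1)" using p'(3) by (metis times_divide_eq_right)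
      then show ?thesis by (simp add: b'_def algebra_simps)
    qed
    finally have "cmod (\<Sum>d\<in>D. z d * w d g) \<le> b' * p" by simp
    moreover have "(\<Sum>d\<in>D. z d * w d g) = of_real T * (\<Sum>d\<in>D. a d * (of_real (1 / \<tau> d) * w d g))"
      by (simp add: z_def sum_distrib_left field_simps)
    ultimately have "T * cmod (\<Sum>d\<in>D. a d * (of_real (1 / \<tau> d) * w d g)) \<le> b' * p"
      using T(1) by (simp add: norm_mult)
    then show ?thesis using T(1) by (simp add: TW[symmetric] field_simps)
  qed
  \<comment> \<open>Now \<open>cmod (s d) = K * (\<tau> d * y d)\<close>, and the summing inequality
    says that the \<open>p\<close>-th powers of \<open>y\<close> add up to at most
    \<open>b' * p\<close>. The second terms of Young's inequality therefore total at most
    \<open>b'\<close>.\<close>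
  define y where "y d = cmod (of_real (1 / \<tau> d) * s d) / K" for d
  have y0: "y d \<ge> 0" for d using K by (simp add: y_def)
  have "(\<Sum>d\<in>D. cmod (of_real (1 / \<tau> d) * s d) powr p) powr (1 / p) \<le> K * (b' * p) powr (1 / p)"
    by (rule summing) (use weak in auto)
  then have "((\<Sum>d\<in>D. cmod (of_real (1 / \<tau> d) * s d) powr p) powr (1 / p)) powr p
      \<le> (K * (b' * p) powr (1 / p)) powr p"
    using p by (intro powr_mono2) auto
  then have "(\<Sum>d\<in>D. cmod (of_real (1 / \<tau> d) * s d) powr p) \<le> K powr p * (b' * p)"
    using p K b' by (simp add: powr_powr powr_mult sum_nonneg)
  then have sumy: "(\<Sum>d\<in>D. y d powr p) \<le> b' * p"
    using K by (simp add: y_def powr_divide sum_divide_distrib[symmetric] divide_le_eq mult.commute)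
  have "cmod (\<Sum>d\<in>D. s d) \<le> (\<Sum>d\<in>D. K * (\<tau> d * y d))"
  proof (rule order_trans[OF norm_sum], rule sum_mono)
    fix d show "cmod (s d) \<le> K * (\<tau> d * y d)"
      using \<tau>(1)[of d] K by (simp add: y_def norm_mult norm_divide)
  qed
  also have "\<dots> = K * (\<Sum>d\<in>D. \<tau> d * y d)" by (simp add: sum_distrib_left)
  also have "(\<Sum>d\<in>D. \<tau> d * y d) \<le> (\<Sum>d\<in>D. \<mu>' d + y d powr p / p)"
  proof (rule sum_mono)
    fix d
    have "\<tau> d * y d \<le> \<tau> d powr p' / p' + y d powr p / p"
      using p p' \<tau>(1)[of d] y0 by (intro Youngs_inequality) auto
    also have "\<tau> d powr p' / p' = \<mu>' d" using \<tau>(2) p' by simp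
    finally show "\<tau> d * y d \<le> \<mu>' d + y d powr p / p" .
  qed
  also have "\<dots> = (\<Sum>d\<in>D. \<mu>' d) + (\<Sum>d\<in>D. y d powr p) / p"
    by (simp add: sum.distrib sum_divide_distrib)
  also have "(\<Sum>d\<in>D. y d powr p) / p \<le> b'"
    using sumy p by (simp add: divide_le_eq)
  finally have "cmod (\<Sum>d\<in>D. s d) \<le> K * ((\<Sum>d\<in>D. \<mu>' d) + b')"
    using K by simp
  also have "\<dots> \<le> K * (1 + 2 * \<kappa>)"
    using K sum\<mu>' total by (intro mult_left_mono) (auto simp: b'_def)
  finally show ?thesis .
qed

text \<open>For \<open>p = 1\<close> the coefficient vectors form the unit polydisc, which the net
  with \<open>R = 1\<close> does not leave. Hence there are no multipliers, and
  \<open>summing\<close> is applied with \<open>t = 1\<close>.\<close>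

lemma summing_dual_estimate_1:
  fixes w :: "'d \<Rightarrow> 'g \<Rightarrow> complex" and s :: "'d \<Rightarrow> complex" and K \<kappa> \<delta> :: real
  assumes "finite D" and K: "0 < K" and \<delta>: "\<delta> * card D \<le> \<kappa>" "0 \<le> \<delta>"
    and unit: "\<And>d. d \<in> D \<Longrightarrow> (\<lambda>d'. if d' = d then 1 else 0) \<in> Q"
    and net: "\<And>z. (\<And>d. d \<in> D \<Longrightarrow> cmod (z d) \<le> 1) \<Longrightarrow>
      \<exists>q\<in>Q. \<forall>d\<in>D. cmod (z d - q d) \<le> \<delta>"
    and bound: "\<And>q g. q \<in> Q \<Longrightarrow> g \<in> B \<Longrightarrow> cmod (\<Sum>d\<in>D. q d * w d g) \<le> 1"
    and summing: "\<And>t W. 0 \<le> W \<Longrightarrow>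
      (\<And>a g. conj_ball 1 D a \<Longrightarrow> g \<in> B \<Longrightarrow> cmod (\<Sum>d\<in>D. a d * (of_real (t d) * w d g)) \<le> W) \<Longrightarrow>
      (\<Sum>d\<in>D. cmod (of_real (t d) * s d) powr 1) powr (1 / 1) \<le> K * W"
  shows "cmod (\<Sum>d\<in>D. s d) \<le> K * (1 + \<kappa>)"
proof -
  have w1: "cmod (w d g) \<le> 1" if "d \<in> D" "g \<in> B" for d g
    using bound[OF unit[OF that(1)] that(2)] \<open>finite D\<close> that(1)
    by (simp add: if_distrib[of "\<lambda>u. u * _"] cong: if_cong)
  have "cmod (\<Sum>d\<in>D. a d * (of_real 1 * w d g)) \<le> 1 + \<kappa>" if a: "conj_ball 1 D a" and g: "g \<in> B" for a g
  proof -
    obtain q where q: "q \<in> Q" "\<And>d. d \<in> D \<Longrightarrow> cmod (a d - q d) \<le> \<delta>"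
      using net[of a] a by (auto simp: conj_ball_def)
    have "(\<Sum>d\<in>D. a d * (of_real 1 * w d g)) = (\<Sum>d\<in>D. q d * w d g) + (\<Sum>d\<in>D. (a d - q d) * w d g)"
      by (simp add: sum.distrib[symmetric] algebra_simps)
    also have "cmod \<dots> \<le> cmod (\<Sum>d\<in>D. q d * w d g) + cmod (\<Sum>d\<in>D. (a d - q d) * w d g)"
      by (rule norm_triangle_ineq)
    also have "cmod (\<Sum>d\<in>D. (a d - q d) * w d g) \<le> (\<Sum>d\<in>D. \<delta> * 1)"
    proof (rule order_trans[OF norm_sum], rule sum_mono)
      fix d assume "d \<in> D"
      then show "cmod ((a d - q d) * w d g) \<le> \<delta> * 1"
        unfolding norm_mult using q w1 g \<delta> by (intro mult_mono) auto
    qed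
    finally show ?thesis using bound[OF q(1) g] \<delta> by (simp add: mult.commute)
  qed
  moreover have "0 \<le> 1 + \<kappa>" using \<delta> by (smt (verit) mult_nonneg_nonneg of_nat_0_le_iff)
  ultimately have "(\<Sum>d\<in>D. cmod (of_real 1 * s d) powr 1) powr (1 / 1) \<le> K * (1 + \<kappa>)"
    by (intro summing) auto
  then have "(\<Sum>d\<in>D. cmod (s d)) \<le> K * (1 + \<kappa>)" by (simp add: sum_nonneg)
  then show ?thesis using norm_sum order_trans by blast
qed

text \<open>Here \<open>S d\<close> stands for the composition of the functional \<open>d\<close>
  with \<open>f\<close>, and \<open>summing\<close> for the \<open>p\<close>-summing inequality on
  finite combinations of evaluations. If the constraints were infeasible, the separating
  coefficients, tested on weights concentrated at one net vector, would satisfy the hypotheses of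
  the dual estimates, and the conclusion of those would be violated.\<close>

lemma finite_nuclear_representation:
  fixes B :: "('a \<Rightarrow> complex) set" and S :: "'d \<Rightarrow> 'a \<Rightarrow> complex" and p K E :: real
  assumes p: "1 \<le> p" and "compact B" "B \<noteq> {}"
    and absconv: "\<And>g h a b. g \<in> B \<Longrightarrow> h \<in> B \<Longrightarrow> cmod a + cmod b \<le> 1 \<Longrightarrow> (\<lambda>x. a * g x + b * h x) \<in> B"
    and "finite D" and K: "0 < K" "K < E"
    and summing: "\<And>c P W. finite P \<Longrightarrow> P \<subseteq> U \<Longrightarrow> 0 \<le> W \<Longrightarrow>
      (\<And>a g. conj_ball p D a \<Longrightarrow> g \<in> B \<Longrightarrow> cmod (\<Sum>d\<in>D. a d * (\<Sum>x\<in>P. c d x * g x)) \<le> W) \<Longrightarrow>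
      (\<Sum>d\<in>D. cmod (\<Sum>x\<in>P. c d x * S d x) powr p) powr (1 / p) \<le> K * W"
  shows "\<exists>Q l g. finite Q \<and> (\<forall>q\<in>Q. 0 \<le> l q \<and> g q \<in> B) \<and> (\<Sum>q\<in>Q. l q) = 1 \<and>
    (\<forall>d\<in>D. \<forall>x\<in>U. S d x = of_real E * (\<Sum>q\<in>Q. of_real (l q) * q d * g q x)) \<and>
    (\<forall>d\<in>D. if p = 1 then \<forall>q\<in>Q. cmod (q d) \<le> 1
       else (\<Sum>q\<in>Q. l q * cmod (q d) powr conjugate_index p) \<le> 1)"
proof -
  define p' where "p' = conjugate_index p"
  \<comment> \<open>\<open>K * (1 + 2 * \<kappa>)\<close> lies two thirds of the way from
    \<open>K\<close> to \<open>E\<close>.\<close>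
  define \<kappa> where "\<kappa> = (E / K - 1) / 3"
  have \<kappa>: "\<kappa> > 0" "K * (1 + \<kappa>) < E" "K * (1 + 2 * \<kappa>) < E"
    using K by (auto simp: \<kappa>_def field_simps)
  define \<delta> where "\<delta> = \<kappa> / (card D + 1)"
  have \<delta>: "\<delta> > 0" "\<delta> * card D \<le> \<kappa>" using \<kappa>(1) by (auto simp: \<delta>_def field_simps)
  define R where "R = (if p = 1 then 1 else
    max 1 (((1 + \<kappa>) * (p - 1) * (card D + 1) / \<kappa>) powr (1 / p')))"
  have R1: "1 \<le> R" by (simp add: R_def)
  have Rp: "(1 + \<kappa>) * (p - 1) * (card D + 1) / \<kappa> \<le> R powr p'" if "p \<noteq> 1"
  proof -
    have p': "p' > 1" using conjugate_index[of p] that p by (simp add: p'_def)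
    have "(1 + \<kappa>) * (p - 1) * (card D + 1) / \<kappa>
        = (((1 + \<kappa>) * (p - 1) * (card D + 1) / \<kappa>) powr (1 / p')) powr p'"
      using p p' \<kappa>(1) by (simp add: powr_powr)
    also have "\<dots> \<le> R powr p'"
      using p' that by (intro powr_mono2) (auto simp: R_def)
    finally show ?thesis .
  qed
  obtain Q where "finite Q" and Q0: "(\<lambda>_. 0) \<in> Q"
    and unit: "\<And>d. d \<in> D \<Longrightarrow> (\<lambda>d'. if d' = d then 1 else 0) \<in> Q"
    and QR: "\<And>q d. q \<in> Q \<Longrightarrow> cmod (q d) \<le> R"
    and net: "\<And>z. (\<And>d. d \<in> D \<Longrightarrow> cmod (z d) \<le> R) \<Longrightarrow>
      \<exists>q\<in>Q. \<forall>d\<in>D. cmod (q d) \<le> cmod (z d) \<and> cmod (z d - q d) \<le> \<delta>"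
    using finite_radial_net[OF \<open>finite D\<close> \<delta>(1) R1] by (auto; blast)
  \<comment> \<open>Both \<open>l\<close> and \<open>g\<close> are constrained at every index, also
    outside \<open>Q\<close>, so that \<open>\<Theta>\<close> is a closed part of a product of
    compact sets.\<close>
  define \<Theta> where "\<Theta> = {(l :: ('d \<Rightarrow> complex) \<Rightarrow> real, g :: ('d \<Rightarrow> complex) \<Rightarrow> 'a \<Rightarrow> complex).
    (\<forall>q. l q \<in> {0..1}) \<and> (\<Sum>q\<in>Q. l q) = 1 \<and> (\<forall>q. g q \<in> B)}"
  define L where "L = (\<lambda>(d, x) (l :: ('d \<Rightarrow> complex) \<Rightarrow> real, g :: ('d \<Rightarrow> complex) \<Rightarrow> 'a \<Rightarrow> complex).
    of_real E * (\<Sum>q\<in>Q. of_real (l q) * q d * g q x) - S d x)"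
  define M where "M = (\<lambda>d (l :: ('d \<Rightarrow> complex) \<Rightarrow> real, g :: ('d \<Rightarrow> complex) \<Rightarrow> 'a \<Rightarrow> complex).
    (\<Sum>q\<in>Q. l q * cmod (q d) powr p') - 1)"
  define I where "I = (if p = 1 then {} else D)"
  have cont1: "continuous_on A (\<lambda>\<theta> :: (('d \<Rightarrow> complex) \<Rightarrow> real) \<times> (('d \<Rightarrow> complex) \<Rightarrow> 'a \<Rightarrow> complex). fst \<theta> q)" for A q
    by (rule continuous_on_product_then_coordinatewise[OF continuous_on_fst[OF continuous_on_id]])
  have cont2: "continuous_on A (\<lambda>\<theta> :: (('d \<Rightarrow> complex) \<Rightarrow> real) \<times> (('d \<Rightarrow> complex) \<Rightarrow> 'a \<Rightarrow> complex). snd \<theta> q x)" for A q x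
    by (rule continuous_on_product_then_coordinatewise[OF
          continuous_on_product_then_coordinatewise[OF continuous_on_snd[OF continuous_on_id]]])
  have "\<exists>\<theta>\<in>\<Theta>. (\<forall>j\<in>D \<times> U. L j \<theta> = 0) \<and> (\<forall>i\<in>I. M i \<theta> \<le> 0)"
  proof (rule convex_feasibility)
    have "\<Theta> = ({l. \<forall>q. l q \<in> {0..1}} \<times> {g. \<forall>q. g q \<in> B}) \<inter> {\<theta>. (\<Sum>q\<in>Q. fst \<theta> q) = 1}"
      by (auto simp: \<Theta>_def)
    moreover have "closed {\<theta> :: (('d \<Rightarrow> complex) \<Rightarrow> real) \<times> (('d \<Rightarrow> complex) \<Rightarrow> 'a \<Rightarrow> complex). (\<Sum>q\<in>Q. fst \<theta> q) = 1}"
      by (intro closed_Collect_eq continuous_on_sum continuous_on_const cont1)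
    ultimately show "compact \<Theta>"
      by (simp only:) (intro compact_Int_closed compact_Times compact_Collect_fun \<open>compact B\<close> compact_Icc)
    show "finite I" using \<open>finite D\<close> by (simp add: I_def)
    show "continuous_on \<Theta> (L j)" for j
      unfolding L_def case_prod_unfold
      by (intro continuous_intros cont1 cont2)
    show "continuous_on \<Theta> (M i)" for i
      unfolding M_def case_prod_unfold by (intro continuous_intros cont1)
  next
    fix \<theta>\<^sub>1 \<theta>\<^sub>2 and s :: real
    assume "\<theta>\<^sub>1 \<in> \<Theta>" "\<theta>\<^sub>2 \<in> \<Theta>" and s: "0 \<le> s" "s \<le> 1"
    then obtain l1 g1 l2 g2 where th: "\<theta>\<^sub>1 = (l1, g1)" "\<theta>\<^sub>2 = (l2, g2)"
      and l1: "\<And>q. 0 \<le> l1 q" "\<And>q. l1 q \<le> 1" "(\<Sum>q\<in>Q. l1 q) = 1" "\<And>q. g1 q \<in> B"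
      and l2: "\<And>q. 0 \<le> l2 q" "\<And>q. l2 q \<le> 1" "(\<Sum>q\<in>Q. l2 q) = 1" "\<And>q. g2 q \<in> B"
      by (auto simp: \<Theta>_def)
    define l where "l q = (1 - s) * l1 q + s * l2 q" for q
    \<comment> \<open>\<open>L\<close> depends on the parameters only through the products of
      \<open>l q\<close> and \<open>g q\<close>. Averaging \<open>g1 q\<close> and
      \<open>g2 q\<close> with the two shares of \<open>l q\<close> turns these products into convex
      combinations. If \<open>l q = 0\<close>, both shares vanish and any element of
      \<open>B\<close> serves.\<close>
    define g where "g q = (if l q = 0 then g1 q else
      (\<lambda>x. of_real ((1 - s) * l1 q / l q) * g1 q x + of_real (s * l2 q / l q) * g2 q x))" for q
    have l0: "0 \<le> l q" for q using s l1 l2 by (simp add: l_def)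
    have lg: "of_real (l q) * g q x = of_real (1 - s) * (of_real (l1 q) * g1 q x) + of_real s * (of_real (l2 q) * g2 q x)" for q x
    proof (cases "l q = 0")
      case True
      moreover have "0 \<le> (1 - s) * l1 q" "0 \<le> s * l2 q" using s l1 l2 by auto
      ultimately have "(1 - s) * l1 q = 0" "s * l2 q = 0" unfolding l_def by linarith+
      then have "(1 - s = 0 \<or> l1 q = 0)" "s = 0 \<or> l2 q = 0" by simp_all
      with True show ?thesis by auto
    next
      case False
      then have "complex_of_real (l q) \<noteq> 0" by simp
      with False show ?thesis by (simp add: g_def distrib_left del: of_real_eq_0_iff)
    qed
    have "g q \<in> B" for q
    proof (cases "l q = 0")
      case True
      then show ?thesis using l1 by (simp add: g_def)
    next
      case False
      have "cmod (of_real ((1 - s) * l1 q / l q)) + cmod (of_real (s * l2 q / l q)) = ((1 - s) * l1 q + s * l2 q) / l q"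
        unfolding norm_of_real add_divide_distrib using s l1(1)[of q] l2(1)[of q] l0[of q] by simp
      also have "\<dots> \<le> 1" using False by (simp add: l_def)
      finally have "(\<lambda>x. of_real ((1 - s) * l1 q / l q) * g1 q x + of_real (s * l2 q / l q) * g2 q x) \<in> B"
        by (rule absconv[OF l1(4) l2(4)])
      with False show ?thesis by (simp only: g_def if_False)
    qed
    moreover have "l q \<le> 1" for q
      using s convex_bound_le[OF l1(2) l2(2), of "1 - s" s q q] by (simp add: l_def)
    moreover have "(\<Sum>q\<in>Q. l q) = 1"
      using l1(3) l2(3) by (simp add: l_def sum.distrib sum_distrib_left[symmetric])
    ultimately have "(l, g) \<in> \<Theta>" using l0 by (simp add: \<Theta>_def)
    moreover have "L j (l, g) = of_real (1 - s) * L j \<theta>\<^sub>1 + of_real s * L j \<theta>\<^sub>2" for j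
    proof -
      obtain d x where j: "j = (d, x)" by fastforce
      have "(\<Sum>q\<in>Q. of_real (l q) * q d * g q x)
          = (\<Sum>q\<in>Q. of_real (1 - s) * (of_real (l1 q) * q d * g1 q x) + of_real s * (of_real (l2 q) * q d * g2 q x))"
      proof (rule sum.cong[OF refl])
        fix q
        have "of_real (l q) * q d * g q x = q d * (of_real (l q) * g q x)" by simp
        then show "of_real (l q) * q d * g q x
          = of_real (1 - s) * (of_real (l1 q) * q d * g1 q x) + of_real s * (of_real (l2 q) * q d * g2 q x)"
          unfolding lg by (simp add: algebra_simps)
      qed
      then have sum_eq: "(\<Sum>q\<in>Q. of_real (l q) * q d * g q x) = of_real (1 - s) * (\<Sum>q\<in>Q. of_real (l1 q) * q d * g1 q x)
          + of_real s * (\<Sum>q\<in>Q. of_real (l2 q) * q d * g2 q x)"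
        by (simp only: sum.distrib sum_distrib_left)
      show ?thesis
        unfolding L_def j th prod.case sum_eq by (simp add: algebra_simps)
    qed
    moreover have "M i (l, g) \<le> (1 - s) * M i \<theta>\<^sub>1 + s * M i \<theta>\<^sub>2" for i
      by (simp add: M_def th l_def distrib_right sum.distrib mult.assoc sum_distrib_left[symmetric])
        (simp add: algebra_simps)
    ultimately show "\<exists>\<theta>\<in>\<Theta>. (\<forall>j\<in>D \<times> U. L j \<theta> = of_real (1 - s) * L j \<theta>\<^sub>1 + of_real s * L j \<theta>\<^sub>2) \<and>
        (\<forall>i\<in>I. M i \<theta> \<le> (1 - s) * M i \<theta>\<^sub>1 + s * M i \<theta>\<^sub>2)" by blast
  next
    fix J' :: "('d \<times> 'a) set" and c :: "'d \<times> 'a \<Rightarrow> complex" and \<mu>0 :: "'d \<Rightarrow> real"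
    assume J': "finite J'" "J' \<subseteq> D \<times> U" and \<mu>0: "\<And>i. 0 \<le> \<mu>0 i"
    show "\<exists>\<theta>\<in>\<Theta>. Re (\<Sum>j\<in>J'. c j * L j \<theta>) + (\<Sum>i\<in>I. \<mu>0 i * M i \<theta>) \<le> 0"
    proof (rule ccontr)
      assume "\<not> ?thesis"
      then have pos: "0 < Re (\<Sum>j\<in>J'. c j * L j \<theta>) + (\<Sum>i\<in>I. \<mu>0 i * M i \<theta>)" if "\<theta> \<in> \<Theta>" for \<theta>
        using that by force
      define P where "P = snd ` J'"
      have P: "finite P" "P \<subseteq> U" using J' by (auto simp: P_def)
      define c' where "c' d x = (if (d, x) \<in> J' then c (d, x) else 0)" for d x
      define w where "w d g = (\<Sum>x\<in>P. c' d x * g x)" for d and g :: "'a \<Rightarrow> complex"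
      define s where "s d = (\<Sum>x\<in>P. c' d x * S d x)" for d
      define \<mu>1 where "\<mu>1 d = (if d \<in> I then \<mu>0 d else 0)" for d
      have \<mu>1: "0 \<le> \<mu>1 d" for d using \<mu>0 by (simp add: \<mu>1_def)
      have key: "0 < - E * cmod (\<Sum>d\<in>D. q d * w d g) - Re (\<Sum>d\<in>D. s d)
          + (\<Sum>d\<in>D. \<mu>1 d * (cmod (q d) powr p' - 1))" if q: "q \<in> Q" and g: "g \<in> B" for q g
      proof -
        define W where "W = (\<Sum>d\<in>D. q d * w d g)"
        \<comment> \<open>Rotates \<open>W\<close> to \<open>- cmod W\<close>. For
          \<open>W = 0\<close> it is 0, which is still admissible since only
          \<open>cmod u \<le> 1\<close> is required.\<close>
        define u where "u = - cnj (sgn W)"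
        have uW: "u * W = - of_real (cmod W)"
        proof -
          have "u * W = - (of_real ((cmod W)\<^sup>2) / of_real (cmod W))"
            unfolding complex_norm_square by (simp add: u_def sgn_eq)
          then show ?thesis by (simp add: power2_eq_square)
        qed
        have "cmod u \<le> 1" by (simp add: u_def norm_sgn)
        then have g': "(\<lambda>x. u * g x) \<in> B"
          using absconv[OF g g, of u 0] by simp
        \<comment> \<open>All weight on the single net vector \<open>q\<close>: the equations then
          contribute \<open>- E * cmod W\<close>, and the inequalities contribute the powers of this
          \<open>q\<close>.\<close>
        define \<theta> where "\<theta> = ((\<lambda>q'. if q' = q then 1 else 0) :: ('d \<Rightarrow> complex) \<Rightarrow> real, \<lambda>_ :: 'd \<Rightarrow> complex. \<lambda>x. u * g x)"
        have "\<theta> \<in> \<Theta>" using g' q \<open>finite Q\<close> by (auto simp: \<theta>_def \<Theta>_def)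
        have pick: "(\<Sum>q'\<in>Q. of_real (if q' = q then 1 else 0) * F q') = F q" for F :: "_ \<Rightarrow> complex"
          using q \<open>finite Q\<close> by (simp add: if_distrib[of of_real] if_distrib[of "\<lambda>u. u * _"] cong: if_cong)
        have pick': "(\<Sum>q'\<in>Q. (if q' = q then 1 else 0) * F q') = F q" for F :: "_ \<Rightarrow> real"
          using q \<open>finite Q\<close> by (simp add: if_distrib[of "\<lambda>u. u * _"] cong: if_cong)
        have "(\<Sum>j\<in>J'. c j * L j \<theta>) = (\<Sum>(d, x)\<in>D \<times> P. c' d x * L (d, x) \<theta>)"
          using J' \<open>finite D\<close> P(1)
          by (intro sum.mono_neutral_cong_left) (auto simp: c'_def P_def intro: rev_image_eqI split: if_splits)
        also have "\<dots> = (\<Sum>d\<in>D. \<Sum>x\<in>P. c' d x * (of_real E * (q d * (u * g x)) - S d x))"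
          by (simp add: sum.cartesian_product[symmetric] L_def \<theta>_def mult.assoc pick)
        also have "\<dots> = of_real E * (u * W) - (\<Sum>d\<in>D. s d)"
          by (simp add: W_def w_def s_def right_diff_distrib sum_subtractf sum_distrib_left mult_ac)
        finally have 1: "Re (\<Sum>j\<in>J'. c j * L j \<theta>) = - E * cmod W - Re (\<Sum>d\<in>D. s d)"
          by (simp add: uW)
        have "(\<Sum>i\<in>I. \<mu>0 i * M i \<theta>) = (\<Sum>d\<in>D. \<mu>1 d * (cmod (q d) powr p' - 1))"
          using \<open>finite D\<close> unfolding M_def \<theta>_def
          by (intro sum.mono_neutral_cong_left) (auto simp: \<mu>1_def I_def pick')
        with 1 pos[OF \<open>\<theta> \<in> \<Theta>\<close>] show ?thesis by (simp add: W_def)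
      qed
      obtain g0 where g0: "g0 \<in> B" using \<open>B \<noteq> {}\<close> by auto
      \<comment> \<open>The value of the separating functional at the zero vector of the net, where
        all powers vanish (\<open>0 powr x = 0\<close> for every \<open>x\<close>).\<close>
      define b where "b = - Re (\<Sum>d\<in>D. s d) - (\<Sum>d\<in>D. \<mu>1 d)"
      have b: "b > 0" using key[OF Q0 g0] by (simp add: b_def sum_negf)
      \<comment> \<open>\<open>V\<close> equals \<open>- Re (\<Sum>d\<in>D. s d)\<close> and is thus
        at most the modulus of that sum. Scaling by \<open>E / V\<close> gives the multipliers total
        1 and the scaled sum modulus at least \<open>E\<close>, which the dual estimates
        contradict.\<close>
      define V where "V = b + (\<Sum>d\<in>D. \<mu>1 d)"
      have V: "V > 0" using b \<mu>1 by (simp add: V_def add_pos_nonneg sum_nonneg)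
      have bound: "E * cmod (\<Sum>d\<in>D. q d * w d g) \<le> b + (\<Sum>d\<in>D. \<mu>1 d * cmod (q d) powr p')"
        if "q \<in> Q" "g \<in> B" for q g
        using key[OF that] by (simp add: b_def right_diff_distrib sum_subtractf)
      define w2 where "w2 d g = of_real (E / V) * w d g" for d g
      define s2 where "s2 d = of_real (E / V) * s d" for d
      have E: "E > 0" using K by simp
      have bound2: "cmod (\<Sum>d\<in>D. q d * w2 d g) \<le> b / V + (\<Sum>d\<in>D. \<mu>1 d / V * cmod (q d) powr p')"
        if "q \<in> Q" "g \<in> B" for q g
      proof -
        have "(\<Sum>d\<in>D. q d * w2 d g) = of_real (E / V) * (\<Sum>d\<in>D. q d * w d g)"
          by (simp add: w2_def sum_distrib_left mult_ac)
        then have "cmod (\<Sum>d\<in>D. q d * w2 d g) = E * cmod (\<Sum>d\<in>D. q d * w d g) / V"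
          using E V by (simp add: norm_mult norm_divide)
        also have "\<dots> \<le> (b + (\<Sum>d\<in>D. \<mu>1 d * cmod (q d) powr p')) / V"
          using bound[OF that] V by (intro divide_right_mono) auto
        finally show ?thesis by (simp add: add_divide_distrib sum_divide_distrib)
      qed
      have summing2: "(\<Sum>d\<in>D. cmod (of_real (t d) * s2 d) powr p) powr (1 / p) \<le> K * W"
        if "0 \<le> W" "\<And>a g. conj_ball p D a \<Longrightarrow> g \<in> B \<Longrightarrow> cmod (\<Sum>d\<in>D. a d * (of_real (t d) * w2 d g)) \<le> W" for t W
      proof -
        have e: "(\<Sum>x\<in>P. of_real (t d * (E / V)) * c' d x * g x) = of_real (t d) * w2 d g" for d g
          by (simp add: w2_def w_def sum_distrib_left mult_ac)
        have s2: "s2 d = w2 d (S d)" for d by (simp add: s2_def s_def w2_def w_def)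
        show ?thesis
          using summing[OF P that(1), of "\<lambda>d x. of_real (t d * (E / V)) * c' d x"] that(2)
          unfolding e s2 by blast
      qed
      have total: "b / V + (\<Sum>d\<in>D. \<mu>1 d / V) = 1"
        using V by (simp add: V_def sum_divide_distrib[symmetric] add_divide_distrib[symmetric])
      have "cmod (\<Sum>d\<in>D. s2 d) < E"
      proof (cases "p = 1")
        case True
        have "\<mu>1 d = 0" for d using True by (simp add: \<mu>1_def I_def)
        then have "cmod (\<Sum>d\<in>D. q d * w2 d g) \<le> 1" if "q \<in> Q" "g \<in> B" for q g
          using bound2[OF that] total by simp
        moreover have "\<exists>q\<in>Q. \<forall>d\<in>D. cmod (z d - q d) \<le> \<delta>" if "\<And>d. d \<in> D \<Longrightarrow> cmod (z d) \<le> 1" for z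
          using net[of z] that True by (auto simp: R_def)
        ultimately have "cmod (\<Sum>d\<in>D. s2 d) \<le> K * (1 + \<kappa>)"
          using summing2 unit \<delta> True
          by (intro summing_dual_estimate_1[OF \<open>finite D\<close> K(1) \<delta>(2), where Q=Q and B=B and w=w2]) auto
        then show ?thesis using \<kappa> by simp
      next
        case False
        then have "1 < p" using p by simp
        have "cmod (\<Sum>d\<in>D. s2 d) \<le> K * (1 + 2 * \<kappa>)"
          by (rule summing_dual_estimate_gt_1[OF \<open>1 < p\<close> \<open>finite D\<close> K(1) \<kappa>(1) \<delta>(2), where Q=Q and B=B and w=w2
              and b="b / V" and \<mu>="\<lambda>d. \<mu>1 d / V" and R=R])
            (use \<delta> R1 Rp[OF False] unit net \<mu>1 V b total bound2 summing2 in \<open>auto simp: p'_def\<close>)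
        then show ?thesis using \<kappa> by simp
      qed
      moreover have "E \<le> cmod (\<Sum>d\<in>D. s2 d)"
      proof -
        have "(\<Sum>d\<in>D. s2 d) = of_real (E / V) * (\<Sum>d\<in>D. s d)"
          by (simp add: s2_def sum_distrib_left)
        then have "cmod (\<Sum>d\<in>D. s2 d) = E / V * cmod (\<Sum>d\<in>D. s d)"
          using E V by (simp add: norm_mult norm_divide)
        moreover have "V \<le> cmod (\<Sum>d\<in>D. s d)"
          using abs_Re_le_cmod[of "\<Sum>d\<in>D. s d"] by (simp add: V_def b_def)
        then have "E / V * V \<le> E / V * cmod (\<Sum>d\<in>D. s d)"
          using E V by (intro mult_left_mono) auto
        ultimately show ?thesis using V by simp
      qed
      ultimately show False by simp
    qed
  qed
  then obtain l g where lg: "(l, g) \<in> \<Theta>" "\<And>d x. d \<in> D \<Longrightarrow> x \<in> U \<Longrightarrow> L (d, x) (l, g) = 0"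
    "\<And>i. i \<in> I \<Longrightarrow> M i (l, g) \<le> 0" by fast
  have "\<forall>d\<in>D. \<forall>x\<in>U. S d x = of_real E * (\<Sum>q\<in>Q. of_real (l q) * q d * g q x)"
    using lg(2) by (auto simp: L_def)
  moreover have "\<forall>d\<in>D. if p = 1 then \<forall>q\<in>Q. cmod (q d) \<le> 1
       else (\<Sum>q\<in>Q. l q * cmod (q d) powr conjugate_index p) \<le> 1"
    using lg(3) QR by (auto simp: I_def M_def R_def p'_def)
  ultimately show ?thesis
    using \<open>finite Q\<close> lg(1) by (intro exI[of _ Q] exI[of _ l] exI[of _ g]) (auto simp: \<Theta>_def)
qed

section \<open>Norms and duals\<close>

lemma scaleC_zero_left: "0 *\<^sub>C (x::'a::complex_vector) = 0"
  using scaleC_add_left[of 0 0 x] by simp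

lemma scaleC_zero_right: "c *\<^sub>C (0::'a::complex_vector) = 0"
  using scaleC_add_right[of c 0 "0::'a"] by simp

lemma scaleC_minus_one: "(- 1) *\<^sub>C (x::'a::complex_vector) = - x"
proof -
  have "x + (- 1) *\<^sub>C x = (1 + - 1) *\<^sub>C x"
    unfolding scaleC_add_left scaleC_one ..
  then show ?thesis by (simp add: scaleC_zero_left eq_neg_iff_add_eq_0 add.commute)
qed

lemma scaleC_fun_apply [simp]: "(c *\<^sub>C f) x = c *\<^sub>C f x"
  by (simp add: scaleC_fun_def)

lemma scaleC_complex [simp]: "c *\<^sub>C z = c * (z :: complex)"
  by (simp add: scaleC_complex_def)

lemma sum_fun_apply [simp]: "(\<Sum>i\<in>A. F i) x = (\<Sum>i\<in>A. F i x)"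
  by (induction A rule: infinite_finite_induct) auto

lemma pts_whole [simp]: "pts whole = UNIV" and nrm_whole [simp]: "nrm whole = norm"
  by (simp_all add: whole_def)

definition complex_subspace :: "'a::complex_vector set \<Rightarrow> bool" where
  "complex_subspace S \<longleftrightarrow> 0 \<in> S \<and> (\<forall>x\<in>S. \<forall>y\<in>S. x + y \<in> S) \<and> (\<forall>c. \<forall>x\<in>S. c *\<^sub>C x \<in> S)"

lemma complex_subspaceD:
  assumes "complex_subspace S"
  shows "0 \<in> S" "x \<in> S \<Longrightarrow> y \<in> S \<Longrightarrow> x + y \<in> S" "x \<in> S \<Longrightarrow> c *\<^sub>C x \<in> S"
    "x \<in> S \<Longrightarrow> y \<in> S \<Longrightarrow> x - y \<in> S"
proof -
  show "x - y \<in> S" if "x \<in> S" "y \<in> S"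
  proof -
    have "x - y = x + (- 1) *\<^sub>C y" by (simp add: scaleC_minus_one)
    with assms that show ?thesis unfolding complex_subspace_def by metis
  qed
qed (use assms in \<open>auto simp: complex_subspace_def\<close>)

lemma complex_subspace_sum:
  assumes "complex_subspace S" "\<And>i. i \<in> I \<Longrightarrow> x i \<in> S"
  shows "(\<Sum>i\<in>I. c i *\<^sub>C x i) \<in> S"
  using assms(2)
  by (induction I rule: infinite_finite_induct) (auto simp: complex_subspaceD[OF assms(1)])

lemma complex_subspace_UNIV [simp]: "complex_subspace UNIV"
  by (simp add: complex_subspace_def)

lemma bounded_opsD:
  assumes "T \<in> bounded_ops X Y"
  shows "x \<notin> pts X \<Longrightarrow> T x = 0" "x \<in> pts X \<Longrightarrow> T x \<in> pts Y"
    "x \<in> pts X \<Longrightarrow> y \<in> pts X \<Longrightarrow> T (x + y) = T x + T y" "x \<in> pts X \<Longrightarrow> T (c *\<^sub>C x) = c *\<^sub>C T x"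
  using assms by (auto simp: bounded_ops_def)

lemma bounded_ops_sum:
  assumes T: "T \<in> bounded_ops X Y" and X: "complex_subspace (pts X)"
    and x: "\<And>i. i \<in> I \<Longrightarrow> x i \<in> pts X"
  shows "T (\<Sum>i\<in>I. c i *\<^sub>C x i) = (\<Sum>i\<in>I. c i *\<^sub>C T (x i))"
proof -
  have T0: "T 0 = 0"
    using bounded_opsD(4)[OF T complex_subspaceD(1)[OF X], of 0] by (simp add: scaleC_zero_left)
  show ?thesis using x
  proof (induction I rule: infinite_finite_induct)
    case (insert i I)
    then have "T (c i *\<^sub>C x i + (\<Sum>i\<in>I. c i *\<^sub>C x i)) = T (c i *\<^sub>C x i) + T (\<Sum>i\<in>I. c i *\<^sub>C x i)"
      by (intro bounded_opsD(3)[OF T] complex_subspaceD[OF X] complex_subspace_sum[OF X]) auto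
    with insert show ?case by (simp add: bounded_opsD(4)[OF T])
  qed (auto simp: T0)
qed

lemma bounded_ops_whole_subspace:
  "complex_subspace (bounded_ops X (whole :: 'b::complex_normed_vector nspace))"
  unfolding complex_subspace_def
proof (intro conjI ballI allI)
  show "0 \<in> bounded_ops X (whole :: 'b nspace)"
    by (auto simp: bounded_ops_def scaleC_zero_right intro: exI[of _ 0])
next
  fix S T assume S: "S \<in> bounded_ops X (whole :: 'b nspace)" and T: "T \<in> bounded_ops X (whole :: 'b nspace)"
  obtain C D where "\<forall>x\<in>pts X. norm (S x) \<le> C * nrm X x" "\<forall>x\<in>pts X. norm (T x) \<le> D * nrm X x"
    using S T by (auto simp: bounded_ops_def)
  then have "\<forall>x\<in>pts X. norm (S x + T x) \<le> (C + D) * nrm X x"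
    using norm_triangle_mono by (fastforce simp: distrib_right)
  with S T show "S + T \<in> bounded_ops X (whole :: 'b nspace)"
    by (auto simp: bounded_ops_def scaleC_add_right)
next
  fix c T assume T: "T \<in> bounded_ops X (whole :: 'b nspace)"
  obtain C where "\<forall>x\<in>pts X. norm (T x) \<le> C * nrm X x"
    using T by (auto simp: bounded_ops_def)
  then have "\<forall>x\<in>pts X. norm (c *\<^sub>C T x) \<le> (cmod c * C) * nrm X x"
    by (auto simp: norm_scaleC mult.assoc intro!: mult_left_mono)
  then have "\<exists>C. \<forall>x\<in>pts X. norm (c *\<^sub>C T x) \<le> C * nrm X x" by blast
  moreover have "c *\<^sub>C d *\<^sub>C y = d *\<^sub>C c *\<^sub>C y" for d and y :: 'b
    by (simp add: scaleC_scaleC mult.commute)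
  ultimately show "c *\<^sub>C T \<in> bounded_ops X (whole :: 'b nspace)"
    using T by (auto simp: bounded_ops_def scaleC_add_right scaleC_zero_right)
qed

lemma pts_dual: "pts (dual X) = bounded_ops X whole"
  and nrm_dual: "nrm (dual X) \<phi> = (SUP x\<in>unit_ball X. cmod (\<phi> x))"
  by (simp_all add: dual_def)

lemma dual_subspace: "complex_subspace (pts (dual X))"
  by (simp add: pts_dual bounded_ops_whole_subspace)

text \<open>The properties of \<open>X\<close> on which the estimates for the dual norm rest; the
  triangle inequality of the dual norm comes from the complex numbers. The same locale covers
  \<open>whole\<close>, \<open>HvC\<close>, \<open>Gv\<close> and their duals.\<close>

locale seminormed_nspace =
  fixes X :: "'a::complex_vector nspace"
  assumes subspace: "complex_subspace (pts X)"
    and nrm_nonneg: "x \<in> pts X \<Longrightarrow> 0 \<le> nrm X x"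
    and nrm_scaleC: "x \<in> pts X \<Longrightarrow> nrm X (c *\<^sub>C x) = cmod c * nrm X x"
begin

lemma zero_in_unit_ball: "0 \<in> unit_ball X"
  using complex_subspaceD(1)[OF subspace] nrm_scaleC[of 0 0]
  by (simp add: unit_ball_def scaleC_zero_left)

lemma dual_bdd_above:
  assumes "\<phi> \<in> pts (dual X)"
  shows "bdd_above ((\<lambda>x. cmod (\<phi> x)) ` unit_ball X)"
proof -
  obtain C where C: "\<forall>x\<in>pts X. cmod (\<phi> x) \<le> C * nrm X x"
    using assms by (auto simp: pts_dual bounded_ops_def)
  have "cmod (\<phi> x) \<le> \<bar>C\<bar>" if "x \<in> unit_ball X" for x
  proof -
    have "C * nrm X x \<le> \<bar>C\<bar> * 1"
      using that nrm_nonneg[of x] by (intro mult_mono) (auto simp: unit_ball_def)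
    then show ?thesis using bspec[OF C, of x] that by (auto simp: unit_ball_def)
  qed
  then show ?thesis by (intro bdd_aboveI2) auto
qed

lemma dual_upper:
  assumes "\<phi> \<in> pts (dual X)" "x \<in> unit_ball X"
  shows "cmod (\<phi> x) \<le> nrm (dual X) \<phi>"
  unfolding nrm_dual using assms dual_bdd_above by (intro cSUP_upper) auto

lemma dual_nonneg: "\<phi> \<in> pts (dual X) \<Longrightarrow> 0 \<le> nrm (dual X) \<phi>"
  using dual_upper[OF _ zero_in_unit_ball, of \<phi>] order_trans[OF norm_ge_zero] by blast

lemma dual_least:
  assumes "\<And>x. x \<in> unit_ball X \<Longrightarrow> cmod (\<phi> x) \<le> C"
  shows "nrm (dual X) \<phi> \<le> C"
  unfolding nrm_dual using assms zero_in_unit_ball by (intro cSUP_least) auto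

lemma dual_bound:
  assumes "\<phi> \<in> pts (dual X)" "x \<in> pts X"
  shows "cmod (\<phi> x) \<le> nrm (dual X) \<phi> * nrm X x"
proof (cases "nrm X x = 0")
  case True
  \<comment> \<open>A point of seminorm 0 cannot be normalised; the boundedness constant shows that
    \<open>\<phi>\<close> vanishes there.\<close>
  obtain C where "\<forall>x\<in>pts X. cmod (\<phi> x) \<le> C * nrm X x"
    using assms(1) by (auto simp: pts_dual bounded_ops_def)
  from bspec[OF this assms(2)] True show ?thesis by simp
next
  case False
  then have pos: "nrm X x > 0" using nrm_nonneg[OF assms(2)] by simp
  define y where "y = of_real (1 / nrm X x) *\<^sub>C x"
  have "y \<in> unit_ball X"
    using pos assms(2) complex_subspaceD(3)[OF subspace] by (simp add: y_def unit_ball_def nrm_scaleC norm_divide)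
  then have "cmod (\<phi> y) \<le> nrm (dual X) \<phi>" by (rule dual_upper[OF assms(1)])
  moreover have "\<phi> y = of_real (1 / nrm X x) * \<phi> x"
    using assms bounded_opsD(4)[of \<phi> X whole] by (simp add: y_def pts_dual)
  ultimately show ?thesis
    using pos by (simp add: norm_mult norm_divide field_simps)
qed

lemma dual_scaleC:
  assumes "\<phi> \<in> pts (dual X)"
  shows "nrm (dual X) (c *\<^sub>C \<phi>) = cmod c * nrm (dual X) \<phi>"
proof -
  have le: "nrm (dual X) (c *\<^sub>C \<phi>) \<le> cmod c * nrm (dual X) \<phi>" if "\<phi> \<in> pts (dual X)" for c \<phi>
    by (rule dual_least) (simp add: norm_mult mult_left_mono dual_upper[OF that])
  show ?thesis
  proof (cases "c = 0")
    case True
    have "nrm (dual X) (c *\<^sub>C \<phi>) \<ge> 0"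
      using assms complex_subspaceD(3)[OF dual_subspace] by (intro dual_nonneg) auto
    with le[OF assms, of c] True show ?thesis by simp
  next
    case False
    have "nrm (dual X) (inverse c *\<^sub>C c *\<^sub>C \<phi>) \<le> cmod (inverse c) * nrm (dual X) (c *\<^sub>C \<phi>)"
      using assms complex_subspaceD(3)[OF dual_subspace] by (intro le) auto
    then have "cmod c * nrm (dual X) \<phi> \<le> nrm (dual X) (c *\<^sub>C \<phi>)"
      using False by (simp add: scaleC_scaleC scaleC_one norm_inverse norm_divide field_simps)
    with le[OF assms, of c] show ?thesis by simp
  qed
qed

lemma dual_triangle:
  assumes "\<phi> \<in> pts (dual X)" "\<psi> \<in> pts (dual X)"
  shows "nrm (dual X) (\<phi> + \<psi>) \<le> nrm (dual X) \<phi> + nrm (dual X) \<psi>"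
  by (rule dual_least)
    (auto intro!: order_trans[OF norm_triangle_ineq] add_mono dual_upper assms)

text \<open>Equality holds on the whole ambient type, because members of \<open>bounded_ops\<close>
  are 0 off the points.\<close>

lemma dual_eq_zero:
  assumes "\<phi> \<in> pts (dual X)" "nrm (dual X) \<phi> = 0"
  shows "\<phi> = 0"
proof
  fix x
  show "\<phi> x = 0 x"
    using dual_bound[OF assms(1), of x] assms by (cases "x \<in> pts X") (auto simp: pts_dual bounded_ops_def)
qed

end

lemma seminormed_nspace_whole: "seminormed_nspace (whole :: 'b::complex_normed_vector nspace)"
  by unfold_locales (simp_all add: norm_scaleC)

lemma seminormed_nspace_dual:
  assumes "seminormed_nspace X"
  shows "seminormed_nspace (dual X)"
proof -
  interpret seminormed_nspace X by fact
  show ?thesis by unfold_locales (auto simp: dual_subspace dual_nonneg dual_scaleC)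
qed

section \<open>The scalar weighted space, point evaluations and the predual\<close>

lemma pts_HvC: "pts (HvC U v) = {f. holomorphic_into U whole f \<and> (\<forall>x. x \<notin> U \<longrightarrow> f x = 0) \<and>
      bdd_above ((\<lambda>x. v x * cmod (f x)) ` U)}"
  by (simp add: Hv_def)

lemma nrm_HvC_le: "(\<And>x. x \<in> U \<Longrightarrow> v x * cmod (f x) \<le> C) \<Longrightarrow> 0 \<le> C \<Longrightarrow> nrm (HvC U v) f \<le> C"
  by (auto simp: Hv_def intro!: cSup_least)

lemma nrm_HvC_upper:
  "f \<in> pts (HvC U v) \<Longrightarrow> x \<in> U \<Longrightarrow> v x * cmod (f x) \<le> nrm (HvC U v) f"
  by (auto simp: Hv_def intro!: cSup_upper)

lemma nrm_HvC_nonneg: "f \<in> pts (HvC U v) \<Longrightarrow> 0 \<le> nrm (HvC U v) f"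
  by (auto simp: Hv_def intro!: cSup_upper)

lemma holomorphic_into_combination:
  fixes f g :: "'a::complex_normed_vector \<Rightarrow> complex"
  assumes "holomorphic_into U whole f" "holomorphic_into U whole g"
  shows "holomorphic_into U whole (\<lambda>x. a * f x + b * g x)"
  unfolding holomorphic_into_whole_iff
proof
  fix x assume "x \<in> U"
  then obtain D E where D: "(f has_derivative D) (at x)" "\<forall>c h. D (c *\<^sub>C h) = c *\<^sub>C D h"
    and E: "(g has_derivative E) (at x)" "\<forall>c h. E (c *\<^sub>C h) = c *\<^sub>C E h"
    using assms unfolding holomorphic_into_whole_iff by metis
  show "\<exists>D. ((\<lambda>x. a * f x + b * g x) has_derivative D) (at x) \<and> (\<forall>c h. D (c *\<^sub>C h) = c *\<^sub>C D h)"
    using D(2) E(2)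
    by (intro exI[of _ "\<lambda>h. a * D h + b * E h"] conjI derivative_intros D(1) E(1))
      (simp add: algebra_simps)
qed

lemma HvC_combination:
  assumes f: "f \<in> pts (HvC U v)" and g: "g \<in> pts (HvC U v)" and v: "\<And>x. x \<in> U \<Longrightarrow> 0 \<le> v x"
  shows "(\<lambda>x. a * f x + b * g x) \<in> pts (HvC U v)"
    and "nrm (HvC U v) (\<lambda>x. a * f x + b * g x) \<le> cmod a * nrm (HvC U v) f + cmod b * nrm (HvC U v) g"
proof -
  have le: "v x * cmod (a * f x + b * g x) \<le> cmod a * nrm (HvC U v) f + cmod b * nrm (HvC U v) g"
    if x: "x \<in> U" for x
  proof -
    have "v x * cmod (a * f x + b * g x) \<le> v x * (cmod a * cmod (f x) + cmod b * cmod (g x))"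
      using v[OF x] norm_triangle_ineq[of "a * f x" "b * g x"] by (intro mult_left_mono) (auto simp: norm_mult)
    also have "\<dots> = cmod a * (v x * cmod (f x)) + cmod b * (v x * cmod (g x))"
      by (simp add: algebra_simps)
    also have "\<dots> \<le> cmod a * nrm (HvC U v) f + cmod b * nrm (HvC U v) g"
      using nrm_HvC_upper[OF f x] nrm_HvC_upper[OF g x] by (intro add_mono mult_left_mono) auto
    finally show ?thesis .
  qed
  show "(\<lambda>x. a * f x + b * g x) \<in> pts (HvC U v)"
    using f g le unfolding pts_HvC by (auto intro!: holomorphic_into_combination bdd_aboveI2)
  show "nrm (HvC U v) (\<lambda>x. a * f x + b * g x) \<le> cmod a * nrm (HvC U v) f + cmod b * nrm (HvC U v) g"
    using le nrm_HvC_nonneg[OF f] nrm_HvC_nonneg[OF g] by (intro nrm_HvC_le) auto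
qed

lemma zero_in_HvC: "0 \<in> pts (HvC U v)"
proof -
  have "holomorphic_into U whole (0 :: 'a \<Rightarrow> complex)"
    unfolding holomorphic_into_whole_iff zero_fun_def by (auto intro!: exI[of _ "\<lambda>_. 0"])
  then show ?thesis by (auto simp: pts_HvC intro: bdd_aboveI2)
qed

lemma seminormed_nspace_HvC:
  assumes "weight U v"
  shows "seminormed_nspace (HvC U v)"
proof
  have v: "0 \<le> v x" if "x \<in> U" for x using assms that by (simp add: weight_def less_imp_le)
  note comb = HvC_combination[where U=U and v=v, OF _ _ v]
  have sc: "c *\<^sub>C f \<in> pts (HvC U v)" "nrm (HvC U v) (c *\<^sub>C f) \<le> cmod c * nrm (HvC U v) f"
    if "f \<in> pts (HvC U v)" for c f
    using comb[OF that that, of c 0] by (simp_all add: scaleC_fun_def)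
  show "complex_subspace (pts (HvC U v))"
    unfolding complex_subspace_def
    using zero_in_HvC comb(1)[of _ _ 1 1] sc by (simp add: plus_fun_def)
  show "0 \<le> nrm (HvC U v) f" if "f \<in> pts (HvC U v)" for f
    using that by (rule nrm_HvC_nonneg)
  show "nrm (HvC U v) (c *\<^sub>C f) = cmod c * nrm (HvC U v) f" if f: "f \<in> pts (HvC U v)" for f c
  proof (cases "c = 0")
    case True
    then show ?thesis using sc[OF f, of c] nrm_HvC_nonneg[OF sc(1)[OF f, of c]] by simp
  next
    case False
    have "nrm (HvC U v) (inverse c *\<^sub>C c *\<^sub>C f) \<le> cmod (inverse c) * nrm (HvC U v) (c *\<^sub>C f)"
      by (intro sc f)
    then have "cmod c * nrm (HvC U v) f \<le> nrm (HvC U v) (c *\<^sub>C f)"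
      using False by (simp add: scaleC_scaleC scaleC_one norm_inverse norm_divide field_simps)
    with sc(2)[OF f, of c] show ?thesis by simp
  qed
qed

lemma unit_ball_HvC_combination:
  assumes "weight U v" "g \<in> unit_ball (HvC U v)" "h \<in> unit_ball (HvC U v)" "cmod a + cmod b \<le> 1"
  shows "(\<lambda>x. a * g x + b * h x) \<in> unit_ball (HvC U v)"
proof -
  have v: "0 \<le> v x" if "x \<in> U" for x using assms that by (simp add: weight_def less_imp_le)
  have gh: "g \<in> pts (HvC U v)" "h \<in> pts (HvC U v)" "nrm (HvC U v) g \<le> 1" "nrm (HvC U v) h \<le> 1"
    using assms by (auto simp: unit_ball_def)
  have "cmod a * nrm (HvC U v) g + cmod b * nrm (HvC U v) h \<le> cmod a * 1 + cmod b * 1"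
    using gh by (intro add_mono mult_left_mono) auto
  then show ?thesis
    using HvC_combination[OF gh(1,2) v, where a=a and b=b] assms(4) by (auto simp: unit_ball_def)
qed

text \<open>Evaluation at \<open>x\<close> is continuous for the compact-open topology because
  \<open>{x}\<close> is compact: the preimage of an open set is subbasic.\<close>

lemma Delta_in_Gv:
  assumes "weight U v" "x \<in> U"
  shows "Delta U v x \<in> pts (Gv U v)"
proof -
  interpret seminormed_nspace "HvC U v" by (rule seminormed_nspace_HvC) fact
  note sub = complex_subspaceD[OF subspace]
  have vx: "v x > 0" using assms by (simp add: weight_def)
  have "cmod (g x) \<le> 1 / v x * nrm (HvC U v) g" if "g \<in> pts (HvC U v)" for g
    using nrm_HvC_upper[OF that assms(2)] vx by (simp add: field_simps)
  then have "\<exists>C. \<forall>g\<in>pts (HvC U v). cmod (g x) \<le> C * nrm (HvC U v) g" by blast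
  then have "Delta U v x \<in> pts (dual (HvC U v))"
    by (auto simp: pts_dual bounded_ops_def Delta_def sub(2,3))
  moreover have "continuous_map (subtopology (compact_open U) (unit_ball (HvC U v))) euclidean (Delta U v x)"
    unfolding continuous_map_def
  proof (intro conjI allI impI)
    fix W :: "complex set" assume "openin euclidean W"
    then have "openin (compact_open U) {g. g ` {x} \<subseteq> W}"
      unfolding compact_open_def using assms(2)
      by (intro topology_generated_by_Basis) (auto intro!: exI[of _ "{x}"] exI[of _ W])
    moreover have "{g \<in> topspace (subtopology (compact_open U) (unit_ball (HvC U v))). Delta U v x g \<in> W}
        = {g. g ` {x} \<subseteq> W} \<inter> unit_ball (HvC U v)"
    proof -
      \<comment> \<open>The empty compact set makes the whole function type subbasic, so the
        topology lives on all functions.\<close>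
      have "{g :: 'a \<Rightarrow> complex. True} \<in> {{f. f ` K \<subseteq> W} |K W. compact K \<and> K \<subseteq> U \<and> open W}"
        by (rule CollectI, rule exI[of _ "{}"], rule exI[of _ UNIV]) auto
      then have "topspace (compact_open U :: ('a \<Rightarrow> complex) topology) = UNIV"
        unfolding compact_open_def topology_generated_by_topspace by auto
      then show ?thesis by (auto simp: Delta_def unit_ball_def)
    qed
    ultimately show "openin (subtopology (compact_open U) (unit_ball (HvC U v)))
        {g \<in> topspace (subtopology (compact_open U) (unit_ball (HvC U v))). Delta U v x g \<in> W}"
      unfolding openin_subtopology by blast
  qed auto
  ultimately show ?thesis by (simp add: Gv_def)
qed

lemma continuous_map_scaleC:
  assumes "continuous_map X euclidean (f :: _ \<Rightarrow> complex)"
  shows "continuous_map X euclidean (c *\<^sub>C f)"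
proof -
  have "continuous_map X euclidean ((\<lambda>z. c * z) \<circ> f)"
    using assms by (rule continuous_map_compose) (auto intro: continuous_intros)
  then show ?thesis by (simp add: scaleC_fun_def comp_def)
qed

lemma Gv_subset_dual: "pts (Gv U v) \<subseteq> pts (dual (HvC U v))" and nrm_Gv: "nrm (Gv U v) = nrm (dual (HvC U v))"
  by (auto simp: Gv_def)

lemma seminormed_nspace_Gv:
  assumes "weight U v"
  shows "seminormed_nspace (Gv U v)"
proof
  interpret H: seminormed_nspace "HvC U v" by (rule seminormed_nspace_HvC) fact
  interpret D: seminormed_nspace "dual (HvC U v)" by (rule seminormed_nspace_dual[OF H.seminormed_nspace_axioms])
  show "complex_subspace (pts (Gv U v))"
    unfolding complex_subspace_def Gv_def
    using complex_subspaceD[OF D.subspace] continuous_map_add continuous_map_scaleC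
    by (auto simp: plus_fun_def zero_fun_def)
  show "0 \<le> nrm (Gv U v) \<phi>" if "\<phi> \<in> pts (Gv U v)" for \<phi>
    using that Gv_subset_dual by (auto simp: nrm_Gv intro: D.nrm_nonneg)
  show "nrm (Gv U v) (c *\<^sub>C \<phi>) = cmod c * nrm (Gv U v) \<phi>" if "\<phi> \<in> pts (Gv U v)" for \<phi> c
    using D.nrm_scaleC[OF subsetD[OF Gv_subset_dual that]] by (simp only: nrm_Gv)
qed

text \<open>The converse of Hoelder's inequality; it reduces weak \<open>p\<close>-norms to norms of
  linear combinations.\<close>

lemma lp_norm_le_by_duality:
  fixes \<beta> :: "'d \<Rightarrow> complex"
  assumes "1 \<le> p" "finite D" "0 \<le> W"
    and dual: "\<And>a. conj_ball p D a \<Longrightarrow> cmod (\<Sum>d\<in>D. a d * \<beta> d) \<le> W"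
  shows "(\<Sum>d\<in>D. cmod (\<beta> d) powr p) powr (1 / p) \<le> W"
proof -
  have sgn_mult: "cnj (sgn z) * z = of_real (cmod z)" for z :: complex
  proof -
    have "cnj (sgn z) * z = of_real ((cmod z)\<^sup>2) / of_real (cmod z)"
      unfolding complex_norm_square by (simp add: sgn_eq)
    then show ?thesis by (simp add: power2_eq_square)
  qed
  show ?thesis
  proof (cases "p = 1")
    case True
    have "(\<Sum>d\<in>D. cnj (sgn (\<beta> d)) * \<beta> d) = of_real (\<Sum>d\<in>D. cmod (\<beta> d))"
      by (simp add: sgn_mult)
    moreover have "conj_ball p D (\<lambda>d. cnj (sgn (\<beta> d)))"
      using True by (simp add: conj_ball_def norm_sgn)
    ultimately have "cmod (of_real (\<Sum>d\<in>D. cmod (\<beta> d))) \<le> W"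
      using dual[of "\<lambda>d. cnj (sgn (\<beta> d))"] by simp
    then have "(\<Sum>d\<in>D. cmod (\<beta> d)) \<le> W"
      unfolding norm_of_real by simp
    then show ?thesis using True by (simp add: sum_nonneg)
  next
    case False
    then have p: "1 < p" using assms by simp
    define p' where "p' = conjugate_index p"
    have p': "p' > 1" "1 / p + 1 / p' = 1" "p / p' = p - 1"
      using conjugate_index[OF p] by (auto simp: p'_def)
    define A where "A = (\<Sum>d\<in>D. cmod (\<beta> d) powr p)"
    have "A \<ge> 0" by (simp add: A_def sum_nonneg)
    show ?thesis
    proof (cases "A = 0")
      case True
      then show ?thesis using \<open>0 \<le> W\<close> by (simp add: A_def)
    next
      case False
      then have A: "A > 0" using \<open>A \<ge> 0\<close> by simp
      \<comment> \<open>The equality case of Hoelder's inequality, with phases that make all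
        products nonnegative. Since \<open>p' * (p - 1) = p\<close>, the divisor
        \<open>A powr (1 / p')\<close> normalises the sum of the powers to 1.\<close>
      define a where "a d = of_real (cmod (\<beta> d) powr (p - 1) / A powr (1 / p')) * cnj (sgn (\<beta> d))" for d
      have "p' * (p - 1) = p" using p'(1) unfolding p'(3)[symmetric] by simp
      then have apow: "cmod (a d) powr p' = cmod (\<beta> d) powr p / A" for d
        using A p'(1) p
        by (cases "\<beta> d = 0")
          (simp_all add: a_def norm_mult norm_sgn norm_divide powr_divide powr_powr mult.commute)
      have "conj_ball p D a"
        using p A by (simp add: conj_ball_def p'_def[symmetric] apow A_def sum_divide_distrib[symmetric])
      moreover have "(\<Sum>d\<in>D. a d * \<beta> d) = of_real (A powr (1 / p))"
      proof -
        have "a d * \<beta> d = of_real (cmod (\<beta> d) powr p / A powr (1 / p'))" for d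
        proof -
          have "a d * \<beta> d = of_real (cmod (\<beta> d) powr (p - 1) / A powr (1 / p') * cmod (\<beta> d))"
            using sgn_mult[of "\<beta> d"] by (simp add: a_def)
          moreover have "cmod (\<beta> d) powr (p - 1) * cmod (\<beta> d) = cmod (\<beta> d) powr p"
            by (cases "\<beta> d = 0") (use p in \<open>simp_all add: powr_diff\<close>)
          ultimately show ?thesis by simp
        qed
        then have "(\<Sum>d\<in>D. a d * \<beta> d) = of_real (A / A powr (1 / p'))"
          by (simp add: A_def sum_divide_distrib)
        also have "A / A powr (1 / p') = A powr (1 - 1 / p')"
          using A by (simp add: powr_diff)
        also have "1 - 1 / p' = 1 / p" using p' by linarith
        finally show ?thesis .
      qed
      ultimately show ?thesis using dual[of a] by (simp add: A_def)
    qed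
  qed
qed

section \<open>Finite sets of functionals\<close>

text \<open>Replaces the supremum over functionals on \<open>X\<close> by norms of combinations in
  \<open>X\<close>: pairing \<open>a\<close> with the values \<open>\<phi> (u d)\<close> is applying
  \<open>\<phi>\<close> to the combination with coefficients \<open>a\<close>, and duality converts
  the resulting bounds into one for the weak norm.\<close>

lemma p_summing_finite_set:
  assumes p: "1 \<le> p" and T: "T \<in> bounded_ops X (whole :: 'b::complex_normed_vector nspace)"
    and X: "seminormed_nspace X" and C: "C \<in> summing_constants p X whole T"
    and D: "finite D" and W: "0 \<le> W" and u: "\<And>d. d \<in> D \<Longrightarrow> u d \<in> pts X"
    and weak: "\<And>a. conj_ball p D a \<Longrightarrow> nrm X (\<Sum>d\<in>D. a d *\<^sub>C u d) \<le> W"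
  shows "(\<Sum>d\<in>D. norm (T (u d)) powr p) powr (1 / p) \<le> C * W"
proof -
  interpret X: seminormed_nspace X by fact
  interpret X': seminormed_nspace "dual X" by (rule seminormed_nspace_dual[OF X])
  obtain e where e: "bij_betw e {1..card D} D"
    using ex_bij_betw_finite_nat[OF D] ex_bij_betw_nat_finite_1[OF D] by blast
  have reindex: "(\<Sum>i=1..card D. F (e i)) = (\<Sum>d\<in>D. F d)" for F :: "_ \<Rightarrow> real"
    using sum.reindex_bij_betw[OF e] by simp
  have "weak_lp_norm p X (card D) (u \<circ> e) \<le> W"
    unfolding weak_lp_norm_def
  proof (rule cSUP_least)
    show "unit_ball (dual X) \<noteq> {}" using X'.zero_in_unit_ball by blast
    fix \<phi> assume "\<phi> \<in> unit_ball (dual X)"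
    then have \<phi>: "\<phi> \<in> pts (dual X)" "nrm (dual X) \<phi> \<le> 1" by (auto simp: unit_ball_def)
    have "(\<Sum>d\<in>D. cmod (\<phi> (u d)) powr p) powr (1 / p) \<le> W"
    proof (rule lp_norm_le_by_duality[OF p D W])
      fix a assume a: "conj_ball p D a"
      have in_X: "(\<Sum>d\<in>D. a d *\<^sub>C u d) \<in> pts X"
        by (rule complex_subspace_sum[OF X.subspace u])
      have "(\<Sum>d\<in>D. a d * \<phi> (u d)) = \<phi> (\<Sum>d\<in>D. a d *\<^sub>C u d)"
        using bounded_ops_sum[OF _ X.subspace, of \<phi> whole D u a] u \<phi>(1) by (simp add: pts_dual)
      also have "cmod \<dots> \<le> nrm (dual X) \<phi> * nrm X (\<Sum>d\<in>D. a d *\<^sub>C u d)"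
        by (rule X.dual_bound[OF \<phi>(1) in_X])
      also have "\<dots> \<le> 1 * W"
        using \<phi> weak[OF a] X.nrm_nonneg[OF in_X] by (intro mult_mono) auto
      finally show "cmod (\<Sum>d\<in>D. a d * \<phi> (u d)) \<le> W" by simp
    qed
    then show "(\<Sum>i=1..card D. cmod (\<phi> ((u \<circ> e) i)) powr p) powr (1 / p) \<le> W"
      using reindex[of "\<lambda>d. cmod (\<phi> (u d)) powr p"] by simp
  qed
  moreover have "(\<Sum>i=1..n. norm (T (x i)) powr p) powr (1 / p) \<le> C * weak_lp_norm p X n x"
    if "\<forall>i\<in>{1..n}. x i \<in> pts X" for n x
    using C that by (simp add: summing_constants_def)
  moreover have "\<forall>i\<in>{1..card D}. (u \<circ> e) i \<in> pts X"
    using e u by (auto simp: bij_betw_def)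
  then have "(\<Sum>i=1..card D. norm (T ((u \<circ> e) i)) powr p) powr (1 / p)
      \<le> C * weak_lp_norm p X (card D) (u \<circ> e)"
    using calculation by blast
  moreover have "0 \<le> C" using C by (simp add: summing_constants_def)
  ultimately have "(\<Sum>i=1..card D. norm (T ((u \<circ> e) i)) powr p) powr (1 / p) \<le> C * W"
    using mult_left_mono order_trans by blast
  then show ?thesis using reindex[of "\<lambda>d. norm (T (u d)) powr p"] by simp
qed

text \<open>The index \<open>q\<close> ranges over the net of coefficient vectors; block \<open>q\<close> carries the weight
  \<open>l q\<^bsup>1/p\<^esup>\<close> on the function side and \<open>l q\<^bsup>1 - 1/p\<^esup>\<close> on the coefficient side.\<close>

lemma finite_functionals_p_compact:
  fixes f :: "'a::complex_normed_vector \<Rightarrow> 'b::complex_normed_vector"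
  assumes U: "open U" "weight U v" and p: "1 \<le> p" and lin: "is_linearization U v whole f T"
    and C: "C \<in> summing_constants p (Gv U v) whole T"
    and D: "finite D" "D \<subseteq> pts (dual whole)" and m: "0 \<le> m" "\<And>d z. d \<in> D \<Longrightarrow> cmod (d z) \<le> m * norm z"
    and E: "C * m < E"
  shows "\<exists>N \<beta> g. (\<forall>j. 0 \<le> \<beta> j \<and> g j \<in> unit_ball (HvC U v)) \<and> (\<Sum>j<N. \<beta> j powr p) \<le> E powr p \<and>
    (\<forall>d\<in>D. \<exists>r. conj_ball p {..<N::nat} r \<and> (\<forall>x\<in>U. d (f x) = (\<Sum>j<N. r j * (of_real (\<beta> j) * g j x))))"
proof -
  define B where "B = unit_ball (HvC U v)"
  interpret H: seminormed_nspace "HvC U v" by (rule seminormed_nspace_HvC) fact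
  have B0: "0 \<in> B" using H.zero_in_unit_ball by (simp add: B_def)
  have T: "T \<in> bounded_ops (Gv U v) whole" and TD: "\<And>x. x \<in> U \<Longrightarrow> T (Delta U v x) = f x"
    using lin by (auto simp: is_linearization_def)
  have G: "seminormed_nspace (Gv U v)" by (rule seminormed_nspace_Gv) fact
  interpret G: seminormed_nspace "Gv U v" by (rule G)
  have C0: "0 \<le> C" using C by (simp add: summing_constants_def)
  \<comment> \<open>The midpoint is positive even if \<open>C * m = 0\<close> and leaves a gap below
    \<open>E\<close>.\<close>
  define K where "K = (C * m + E) / 2"
  have Cm: "0 \<le> C * m" using C0 m by simp
  have K: "0 < K" "K < E" "C * m \<le> K" using Cm E by (auto simp: K_def)
  have summing: "(\<Sum>d\<in>D. cmod (\<Sum>x\<in>P. c d x * d (f x)) powr p) powr (1 / p) \<le> K * W"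
    if P: "finite P" "P \<subseteq> U" and W: "0 \<le> W"
      and weak: "\<And>a g. conj_ball p D a \<Longrightarrow> g \<in> B \<Longrightarrow> cmod (\<Sum>d\<in>D. a d * (\<Sum>x\<in>P. c d x * g x)) \<le> W"
    for c P W
  proof -
    define u where "u d = (\<Sum>x\<in>P. c d x *\<^sub>C Delta U v x)" for d
    have \<Delta>: "Delta U v x \<in> pts (Gv U v)" if "x \<in> P" for x
      using Delta_in_Gv[OF U(2)] that P by blast
    have u: "u d \<in> pts (Gv U v)" for d
      unfolding u_def by (rule complex_subspace_sum[OF G.subspace \<Delta>])
    have TW: "(\<Sum>d\<in>D. norm (T (u d)) powr p) powr (1 / p) \<le> C * W"
    proof (rule p_summing_finite_set[OF p T G C D(1) W u])
      fix a assume a: "conj_ball p D a"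
      show "nrm (Gv U v) (\<Sum>d\<in>D. a d *\<^sub>C u d) \<le> W"
        \<comment> \<open>The norm of \<open>Gv\<close> is the supremum over \<open>B\<close>, so
          \<open>weak\<close> is just what has to be shown.\<close>
        unfolding nrm_Gv
      proof (rule H.dual_least)
        fix g assume g: "g \<in> unit_ball (HvC U v)"
        then have "Delta U v x g = g x" for x by (simp add: Delta_def unit_ball_def)
        then show "cmod ((\<Sum>d\<in>D. a d *\<^sub>C u d) g) \<le> W"
          using weak[OF a] g by (simp add: u_def B_def)
      qed
    qed
    have "d (T (u d)) = (\<Sum>x\<in>P. c d x * d (f x))" if "d \<in> D" for d
    proof -
      have "T (u d) = (\<Sum>x\<in>P. c d x *\<^sub>C T (Delta U v x))"
        unfolding u_def by (rule bounded_ops_sum[OF T G.subspace \<Delta>])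
      then have "T (u d) = (\<Sum>x\<in>P. c d x *\<^sub>C f x)"
        using TD P by (simp add: subset_iff)
      moreover have "d \<in> bounded_ops whole whole" using D that by (auto simp: pts_dual)
      ultimately show ?thesis
        using bounded_ops_sum[of d whole whole P f "c d"] by simp
    qed
    then have "cmod (\<Sum>x\<in>P. c d x * d (f x)) \<le> m * norm (T (u d))" if "d \<in> D" for d
      using m(2)[OF that, of "T (u d)"] that by simp
    then have "(\<Sum>d\<in>D. cmod (\<Sum>x\<in>P. c d x * d (f x)) powr p) \<le> (\<Sum>d\<in>D. (m * norm (T (u d))) powr p)"
      using p by (intro sum_mono powr_mono2) auto
    also have "\<dots> = m powr p * (\<Sum>d\<in>D. norm (T (u d)) powr p)"
      using m by (simp add: powr_mult sum_distrib_left)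
    finally have "(\<Sum>d\<in>D. cmod (\<Sum>x\<in>P. c d x * d (f x)) powr p) \<le> m powr p * (\<Sum>d\<in>D. norm (T (u d)) powr p)" .
    then have "(\<Sum>d\<in>D. cmod (\<Sum>x\<in>P. c d x * d (f x)) powr p) powr (1 / p)
        \<le> (m powr p * (\<Sum>d\<in>D. norm (T (u d)) powr p)) powr (1 / p)"
      using p by (intro powr_mono2) (auto intro: sum_nonneg)
    also have "\<dots> = m * (\<Sum>d\<in>D. norm (T (u d)) powr p) powr (1 / p)"
      using m p by (simp add: powr_mult powr_powr sum_nonneg)
    also have "\<dots> \<le> m * (C * W)"
      using m TW by (intro mult_left_mono) auto
    also have "\<dots> \<le> K * W"
      using mult_right_mono[OF K(3) W] by (simp add: mult_ac)
    finally show ?thesis .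
  qed
  have "\<exists>Q l g. finite Q \<and> (\<forall>q\<in>Q. 0 \<le> l q \<and> g q \<in> B) \<and> (\<Sum>q\<in>Q. l q) = 1 \<and>
    (\<forall>d\<in>D. \<forall>x\<in>U. d (f x) = of_real E * (\<Sum>q\<in>Q. of_real (l q) * q d * g q x)) \<and>
    (\<forall>d\<in>D. if p = 1 then \<forall>q\<in>Q. cmod (q d) \<le> 1
       else (\<Sum>q\<in>Q. l q * cmod (q d) powr conjugate_index p) \<le> 1)"
  proof (rule finite_nuclear_representation[OF p _ _ _ D(1) K(1,2), where S="\<lambda>d x. d (f x)"])
    show "compact B" unfolding B_def by (rule compact_unit_ball_HvC[OF U])
    show "B \<noteq> {}" using B0 by blast
    show "(\<lambda>x. a * g x + b * h x) \<in> B" if "g \<in> B" "h \<in> B" "cmod a + cmod b \<le> 1" for g h a b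
      using unit_ball_HvC_combination[OF U(2)] that by (simp add: B_def)
  qed (use summing in blast)
  then obtain Q l g where Q: "finite Q" and lg': "\<forall>q\<in>Q. 0 \<le> l q \<and> g q \<in> B"
    and suml: "(\<Sum>q\<in>Q. l q) = 1"
    and rep: "\<forall>d\<in>D. \<forall>x\<in>U. d (f x) = of_real E * (\<Sum>q\<in>Q. of_real (l q) * q d * g q x)"
    and coef: "\<forall>d\<in>D. if p = 1 then \<forall>q\<in>Q. cmod (q d) \<le> 1
       else (\<Sum>q\<in>Q. l q * cmod (q d) powr conjugate_index p) \<le> 1"
    by blast
  have lg: "0 \<le> l q" "g q \<in> B" if "q \<in> Q" for q
    using lg' that by auto
  obtain e where e: "bij_betw e {..<card Q} Q"
    using ex_bij_betw_nat_finite[OF Q] by (auto simp: atLeast0LessThan)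
  have eQ: "e j \<in> Q" if "j < card Q" for j using e that by (auto simp: bij_betw_def)
  have E0: "E > 0" using K by simp
  define \<beta> where "\<beta> j = (if j < card Q then E * l (e j) powr (1 / p) else 0)" for j
  define g' where "g' j = (if j < card Q then g (e j) else 0)" for j
  have "(\<Sum>j<card Q. \<beta> j powr p) = (\<Sum>j<card Q. E powr p * l (e j))"
    using E0 p lg(1) eQ by (intro sum.cong) (auto simp: \<beta>_def powr_mult powr_powr)
  also have "\<dots> = E powr p * (\<Sum>q\<in>Q. l q)"
    using sum.reindex_bij_betw[OF e, of l] by (simp add: sum_distrib_left[symmetric])
  finally have \<beta>: "(\<Sum>j<card Q. \<beta> j powr p) \<le> E powr p" by (simp add: suml)
  have "\<exists>r. conj_ball p {..<card Q} r \<and> (\<forall>x\<in>U. d (f x) = (\<Sum>j<card Q. r j * (of_real (\<beta> j) * g' j x)))"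
    if d: "d \<in> D" for d
  proof (intro exI conjI ballI)
    \<comment> \<open>For \<open>p = 1\<close> the exponent is 0, and a block with
      \<open>l (e j) = 0\<close> gets the factor \<open>0 powr 0 = 0\<close>; its contribution to
      the sum is 0 anyway.\<close>
    define r where "r j = e j d * of_real (l (e j) powr (1 - 1 / p))" for j
    show "conj_ball p {..<card Q} r"
    proof (cases "p = 1")
      case True
      then show ?thesis
        using bspec[OF coef d] eQ lg(1) by (auto simp: conj_ball_def r_def norm_mult)
    next
      case False
      then have p1: "1 < p" using p by simp
      define p' where "p' = conjugate_index p"
      have p': "p' > 1" "1 / p + 1 / p' = 1"
        using conjugate_index[OF p1] by (auto simp: p'_def)
      have "1 - 1 / p = 1 / p'" using p' by linarith
      then have "(1 - 1 / p) * p' = 1 / p' * p'" by (simp only:)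
      then have "(1 - 1 / p) * p' = 1" using p' by simp
      then have "cmod (r j) powr p' = l (e j) * cmod (e j d) powr p'" if "j < card Q" for j
        using lg(1)[OF eQ[OF that]] p' by (simp add: r_def norm_mult powr_mult powr_powr)
      then have "(\<Sum>j<card Q. cmod (r j) powr p') = (\<Sum>q\<in>Q. l q * cmod (q d) powr p')"
        using sum.reindex_bij_betw[OF e, of "\<lambda>q. l q * cmod (q d) powr p'"] by simp
      then show ?thesis using bspec[OF coef d] False by (simp add: conj_ball_def p'_def)
    qed
    fix x assume x: "x \<in> U"
    have "r j * (of_real (\<beta> j) * g' j x) = of_real E * (of_real (l (e j)) * e j d * g (e j) x)"
      if j: "j < card Q" for j
    proof -
      have "l (e j) powr (1 - 1 / p) * l (e j) powr (1 / p) = l (e j)"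
        using lg(1)[OF eQ[OF j]] by (simp add: powr_add[symmetric])
      then have "of_real (l (e j) powr (1 - 1 / p)) * of_real (l (e j) powr (1 / p)) = complex_of_real (l (e j))"
        by (simp only: of_real_mult[symmetric])
      moreover have "r j * (of_real (\<beta> j) * g' j x) = of_real E * ((of_real (l (e j) powr (1 - 1 / p)) *
          of_real (l (e j) powr (1 / p))) * e j d * g (e j) x)"
        using j by (simp add: r_def \<beta>_def g'_def)
      ultimately show ?thesis by simp
    qed
    then have "(\<Sum>j<card Q. r j * (of_real (\<beta> j) * g' j x)) = (\<Sum>q\<in>Q. of_real E * (of_real (l q) * q d * g q x))"
      using sum.reindex_bij_betw[OF e, of "\<lambda>q. of_real E * (of_real (l q) * q d * g q x)"] by simp
    then show "d (f x) = (\<Sum>j<card Q. r j * (of_real (\<beta> j) * g' j x))"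
      using bspec[OF bspec[OF rep d] x] by (simp add: sum_distrib_left)
  qed
  moreover have "\<forall>j. 0 \<le> \<beta> j \<and> g' j \<in> unit_ball (HvC U v)"
    using E0 lg eQ B0 by (auto simp: \<beta>_def g'_def B_def)
  ultimately show ?thesis using \<beta> by blast
qed

section \<open>Infinite sequences of blocks\<close>

text \<open>An initial segment of the enumeration meets only finitely many rows, so bounds for
  finitely many full rows control all partial sums.\<close>

lemma nonneg_block_sum:
  fixes F :: "nat \<Rightarrow> nat \<Rightarrow> real"
  assumes F: "\<And>n j. 0 \<le> F n j" "\<And>n j. N n \<le> j \<Longrightarrow> F n j = 0"
    and bound: "\<And>m. (\<Sum>n<m. \<Sum>j<N n. F n j) \<le> T"
  shows "summable (\<lambda>k. case prod_decode k of (n, j) \<Rightarrow> F n j)"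
    and "(\<Sum>k. case prod_decode k of (n, j) \<Rightarrow> F n j) \<le> T"
proof -
  have le: "(\<Sum>k<M. case prod_decode k of (n, j) \<Rightarrow> F n j) \<le> T" for M
  proof -
    have F2: "j < N n" if "F n j \<noteq> 0" for n j
      using F(2)[of n j] that by (simp add: linorder_not_le[symmetric]) blast
    define A where "A = prod_decode ` {..<M}"
    define m where "m = Suc (Max (insert 0 (fst ` A)))"
    have "finite A" by (simp add: A_def)
    then have m: "n < m" if "(n, j) \<in> A" for n j
      using that unfolding m_def by (auto simp: less_Suc_eq_le intro!: Max_ge rev_image_eqI)
    have "(\<Sum>k<M. case prod_decode k of (n, j) \<Rightarrow> F n j) = (\<Sum>(n, j)\<in>A. F n j)"
      unfolding A_def by (subst sum.reindex) (auto simp: inj_on_def o_def)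
    also have "\<dots> = (\<Sum>(n, j)\<in>A \<inter> Sigma {..<m} (\<lambda>n. {..<N n}). F n j)"
      using \<open>finite A\<close> m F2 by (intro sum.mono_neutral_right) auto
    also have "\<dots> \<le> (\<Sum>(n, j)\<in>Sigma {..<m} (\<lambda>n. {..<N n}). F n j)"
      using F(1) by (intro sum_mono2) auto
    also have "\<dots> = (\<Sum>n<m. \<Sum>j<N n. F n j)"
      by (simp add: sum.Sigma)
    finally show ?thesis using bound[of m] by simp
  qed
  show s: "summable (\<lambda>k. case prod_decode k of (n, j) \<Rightarrow> F n j)"
    using F(1) le by (intro summableI_nonneg_bounded[where x=T]) (auto split: prod.split)
  show "(\<Sum>k. case prod_decode k of (n, j) \<Rightarrow> F n j) \<le> T"
    using s le by (rule suminf_le_const)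
qed

text \<open>Absolute summability permits regrouping the enumerated series into rows, and the row
  sums identify its limit.\<close>

lemma block_sums:
  fixes H :: "nat \<Rightarrow> nat \<Rightarrow> complex"
  assumes abs: "summable (\<lambda>k. cmod (case prod_decode k of (n, j) \<Rightarrow> H n j))"
    and H: "\<And>n j. N n \<le> j \<Longrightarrow> H n j = 0"
    and rows: "(\<lambda>n. \<Sum>j<N n. H n j) sums s"
  shows "(\<lambda>k. case prod_decode k of (n, j) \<Rightarrow> H n j) sums s"
proof -
  obtain S where S: "(\<lambda>k. case prod_decode k of (n, j) \<Rightarrow> H n j) sums S"
    using summable_norm_cancel[OF abs] by (auto simp: summable_def)
  have "((\<lambda>k. case prod_decode k of (n, j) \<Rightarrow> H n j) has_sum S) UNIV"
    by (rule norm_summable_imp_has_sum[OF abs S])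
  then have "((\<lambda>(n, j). H n j) has_sum S) (Sigma UNIV (\<lambda>_. UNIV))"
    using has_sum_reindex_bij_betw[OF bij_prod_decode, of "\<lambda>(n, j). H n j" S] by simp
  moreover have "((\<lambda>j. case (n, j) of (n, j) \<Rightarrow> H n j) has_sum (\<Sum>j<N n. H n j)) UNIV" for n
    using H by (intro has_sum_finite_neutralI[of "{..<N n}"]) auto
  ultimately have "((\<lambda>n. \<Sum>j<N n. H n j) has_sum S) UNIV"
    by (rule has_sum_SigmaD)
  then have "S = s"
    using has_sum_imp_sums sums_unique2 rows by blast
  with S show ?thesis by simp
qed

text \<open>A pointwise series is enough: the products of \<open>cmod (a k)\<close> with the norms
  of \<open>X k\<close> are summable, for \<open>p > 1\<close> by Young's inequality, and the tails
  of their sum dominate the weighted norms of the remainders. The same series supplies the absolute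
  convergence that \<open>sums\<close> may presuppose.\<close>

lemma p_conv_HvC_I:
  assumes p: "1 \<le> p" and v: "weight U v" and y: "y \<in> pts (HvC U v)"
    and a: "a \<in> coefficient_ball p" and X: "X \<in> lp_seqs p (HvC U v)"
    and sums: "\<And>x. x \<in> U \<Longrightarrow> summable (\<lambda>k. cmod (a k * X k x)) \<Longrightarrow> (\<lambda>k. a k * X k x) sums y x"
  shows "y \<in> p_conv p (HvC U v) X"
proof -
  have Xp: "X k \<in> pts (HvC U v)" for k using X by (simp add: lp_seqs_def)
  have Xs: "summable (\<lambda>k. nrm (HvC U v) (X k) powr p)" using X by (simp add: lp_seqs_def)
  interpret seminormed_nspace "HvC U v" by (rule seminormed_nspace_HvC) fact
  have nn: "0 \<le> nrm (HvC U v) (X k)" for k by (rule nrm_nonneg[OF Xp])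
  have abs: "summable (\<lambda>k. cmod (a k) * nrm (HvC U v) (X k))"
  proof (cases "p = 1")
    case True
    then have "cmod (a k) * nrm (HvC U v) (X k) \<le> nrm (HvC U v) (X k) powr p" for k
      using a nn[of k] mult_right_mono[of "cmod (a k)" 1] by (simp add: coefficient_ball_def)
    then show ?thesis
      using nn by (intro summable_comparison_test[OF _ Xs]) (auto simp: abs_mult)
  next
    case False
    then have p1: "1 < p" using p by simp
    define p' where "p' = conjugate_index p"
    have p': "p' > 1" "1 / p + 1 / p' = 1" using conjugate_index[OF p1] by (auto simp: p'_def)
    have "summable (\<lambda>k. cmod (a k) powr p')"
      using a False by (simp add: coefficient_ball_def lp_seqs_def p'_def)
    then have S: "summable (\<lambda>k. cmod (a k) powr p' / p' + nrm (HvC U v) (X k) powr p / p)"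
      by (intro summable_add summable_divide Xs)
    have "cmod (a k) * nrm (HvC U v) (X k) \<le> cmod (a k) powr p' / p' + nrm (HvC U v) (X k) powr p / p" for k
      using p1 p' nn by (intro Youngs_inequality) auto
    then show ?thesis
      using nn by (intro summable_comparison_test[OF _ S]) (auto simp: abs_mult)
  qed
  have pw: "v x * cmod (a k * X k x) \<le> cmod (a k) * nrm (HvC U v) (X k)" if "x \<in> U" for x k
    using mult_left_mono[OF nrm_HvC_upper[OF Xp[of k] that], of "cmod (a k)"]
    by (simp add: norm_mult mult_ac)
  have vpos: "v x > 0" if "x \<in> U" for x using v that by (simp add: weight_def)
  have abs_x: "summable (\<lambda>k. cmod (a k * X k x))" if "x \<in> U" for x
  proof -
    have "cmod (a k * X k x) \<le> cmod (a k) * nrm (HvC U v) (X k) / v x" for k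
      using pw[OF that] vpos[OF that] by (simp add: field_simps)
    then show ?thesis
      by (intro summable_comparison_test[OF _ summable_divide[OF abs]]) auto
  qed
  have abs_shift: "summable (\<lambda>k. cmod (a (k + n)) * nrm (HvC U v) (X (k + n)))" for n
    using summable_iff_shift[of "\<lambda>k. cmod (a k) * nrm (HvC U v) (X k)" n] abs by simp
  have tail: "nrm (HvC U v) (y - (\<Sum>k<n. a k *\<^sub>C X k)) \<le> (\<Sum>k. cmod (a (k + n)) * nrm (HvC U v) (X (k + n)))" for n
  proof (rule nrm_HvC_le)
    show "0 \<le> (\<Sum>k. cmod (a (k + n)) * nrm (HvC U v) (X (k + n)))"
      using nn abs_shift by (intro suminf_nonneg) auto
    fix x assume x: "x \<in> U"
    have "(\<lambda>k. a k * X k x) sums y x" by (rule sums[OF x abs_x[OF x]])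
    then have "(\<lambda>k. a (k + n) * X (k + n) x) sums (y x - (\<Sum>k<n. a k * X k x))"
      using sums_iff_shift[of "\<lambda>k. a k * X k x" n] by simp
    then have eq: "(y - (\<Sum>k<n. a k *\<^sub>C X k)) x = (\<Sum>k. a (k + n) * X (k + n) x)"
      using sums_unique by fastforce
    have sm: "summable (\<lambda>k. cmod (a (k + n) * X (k + n) x))"
      using abs_x[OF x] summable_iff_shift[of "\<lambda>k. cmod (a k * X k x)" n] by simp
    have "v x * cmod ((y - (\<Sum>k<n. a k *\<^sub>C X k)) x) \<le> v x * (\<Sum>k. cmod (a (k + n) * X (k + n) x))"
      unfolding eq using vpos[OF x] sm by (intro mult_left_mono summable_norm) auto
    also have "\<dots> = (\<Sum>k. v x * cmod (a (k + n) * X (k + n) x))"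
      using sm by (rule suminf_mult[symmetric])
    also have "\<dots> \<le> (\<Sum>k. cmod (a (k + n)) * nrm (HvC U v) (X (k + n)))"
      using pw[OF x] sm abs_shift by (intro suminf_le summable_mult) auto
    finally show "v x * cmod ((y - (\<Sum>k<n. a k *\<^sub>C X k)) x) \<le> (\<Sum>k. cmod (a (k + n)) * nrm (HvC U v) (X (k + n)))" .
  qed
  have "(\<lambda>n. nrm (HvC U v) (y - (\<Sum>k<n. a k *\<^sub>C X k))) \<longlonglongrightarrow> 0"
  proof (rule tendsto_sandwich[OF _ _ tendsto_const suminf_exist_split2[OF abs]])
    show "\<forall>\<^sub>F n in sequentially. 0 \<le> nrm (HvC U v) (y - (\<Sum>k<n. a k *\<^sub>C X k))"
      using complex_subspaceD(4)[OF subspace y complex_subspace_sum[OF subspace Xp]]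
      by (intro always_eventually allI nrm_HvC_nonneg)
  qed (use tail in auto)
  then show ?thesis using y a by (auto simp: p_conv_def)
qed

text \<open>\<open>c n\<close> is the share of the coefficient ball given to block \<open>n\<close>:
  coefficients are multiplied by it and vectors divided by it. Block 0 may take a share arbitrarily
  close to 1, so dividing by it costs little; the other blocks use what remains,
  geometrically.\<close>

lemma block_factors_exist:
  assumes p: "1 \<le> p" and c0: "0 < c0" "c0 < 1"
  shows "\<exists>c. c 0 = c0 \<and> (\<forall>n. 0 < c n) \<and>
    (if p = 1 then c \<longlonglongrightarrow> 0 \<and> (\<forall>n. c n \<le> 1)
     else \<forall>m. (\<Sum>n<m. c n powr conjugate_index p) \<le> 1)"
proof (cases "p = 1")
  case True
  define c where "c n = c0 * (1 / 2) ^ n" for n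
  have "c \<longlonglongrightarrow> c0 * 0"
    unfolding c_def by (intro tendsto_mult tendsto_const LIMSEQ_power_zero) auto
  moreover have "c n \<le> 1 * 1" for n
    unfolding c_def using c0 by (intro mult_mono power_le_one) auto
  ultimately show ?thesis
    using c0 True by (intro exI[of _ c]) (auto simp: c_def)
next
  case False
  then have p1: "1 < p" using p by simp
  define p' where "p' = conjugate_index p"
  have p': "p' > 1" using conjugate_index[OF p1] by (simp add: p'_def)
  define \<theta> where "\<theta> = c0 powr p'"
  have \<theta>: "0 < \<theta>" "\<theta> < 1"
    using c0 p' powr_less_mono2[of p' c0 1] by (auto simp: \<theta>_def)
  define c where "c n = (if n = 0 then c0 else ((1 - \<theta>) * (1 / 2) ^ n) powr (1 / p'))" for n
  have cp: "c (Suc n) powr p' = (1 - \<theta>) * (1 / 2) ^ Suc n" for n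
    using \<theta> p' by (simp add: c_def powr_powr)
  have "(\<Sum>n<m. c n powr p') \<le> 1" for m
  proof -
    \<comment> \<open>One more term, so that the term \<open>n = 0\<close> can be split off also
      when \<open>m = 0\<close>.\<close>
    have "(\<Sum>n<m. c n powr p') \<le> (\<Sum>n<Suc m. c n powr p')" by simp
    also have "\<dots> = \<theta> + (\<Sum>n<m. (1 - \<theta>) * (1 / 2) ^ Suc n)"
      unfolding sum.lessThan_Suc_shift cp by (simp add: c_def \<theta>_def)
    also have "(\<Sum>n<m. (1 - \<theta>) * (1 / 2) ^ Suc n) = (1 - \<theta>) * (1 - (1 / 2) ^ m)"
      by (induction m) (simp_all add: algebra_simps)
    also have "\<theta> + (1 - \<theta>) * (1 - (1 / 2) ^ m) \<le> \<theta> + (1 - \<theta>) * 1"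
      using \<theta> by (intro add_left_mono mult_left_mono) auto
    finally show ?thesis by simp
  qed
  then show ?thesis
    using False c0 \<theta> by (intro exI[of _ c]) (auto simp: c_def p'_def)
qed

text \<open>The bounds \<open>M\<close> are prescribed first and the nets refined to meet them. The
  partial sums of the series are the approximants of \<open>y\<close> in successive nets.\<close>

lemma telescoping_in_nets:
  fixes A :: "nat \<Rightarrow> ('b::real_normed_vector \<Rightarrow> complex) set" and K :: "('b \<Rightarrow> complex) set"
  assumes M: "\<And>n. 0 < M n"
    and nets: "\<And>e. 0 < e \<Longrightarrow> \<exists>A. finite A \<and> A \<subseteq> K \<and> (\<forall>y\<in>K. \<exists>a\<in>A. \<forall>z. cmod (y z - a z) \<le> e * norm z)"
    and K: "K \<subseteq> P" and diff: "\<And>a b. a \<in> P \<Longrightarrow> b \<in> P \<Longrightarrow> a - b \<in> P"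
  shows "\<exists>D. D 0 \<subseteq> K \<and> (\<forall>n. finite (D n) \<and> D n \<subseteq> P) \<and>
    (\<forall>n. \<forall>d\<in>D (Suc n). \<forall>z. cmod (d z) \<le> M (Suc n) * norm z) \<and>
    (\<forall>y\<in>K. \<exists>d. (\<forall>n. d n \<in> D n) \<and> (\<forall>z. (\<lambda>n. d n z) sums y z))"
proof -
  \<comment> \<open>At most half of two neighbouring bounds, so that two successive errors together
    stay within \<open>M (Suc n)\<close>; the other term forces convergence to 0.\<close>
  define \<epsilon> where "\<epsilon> n = min (inverse (real (Suc n))) (min (M n) (M (Suc n)) / 2)" for n
  have \<epsilon>M: "\<epsilon> n \<le> M n / 2" "\<epsilon> n \<le> M (Suc n) / 2" for n
    by (auto simp: \<epsilon>_def min_def)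
  have \<epsilon>: "0 < \<epsilon> n" "\<epsilon> (Suc n) + \<epsilon> n \<le> M (Suc n)" for n
    using M[of n] M[of "Suc n"] \<epsilon>M(1)[of "Suc n"] \<epsilon>M(2)[of n] by (simp_all add: \<epsilon>_def)
  have "\<epsilon> \<longlonglongrightarrow> 0"
  proof (rule tendsto_sandwich[OF _ _ tendsto_const LIMSEQ_inverse_real_of_nat])
    show "\<forall>\<^sub>F n in sequentially. 0 \<le> \<epsilon> n" using \<epsilon>(1) by (simp add: less_imp_le)
    show "\<forall>\<^sub>F n in sequentially. \<epsilon> n \<le> inverse (real (Suc n))" by (simp add: \<epsilon>_def)
  qed
  obtain A where A: "\<And>n. finite (A n)" "\<And>n. A n \<subseteq> K"
    "\<And>n y. y \<in> K \<Longrightarrow> \<exists>a\<in>A n. \<forall>z. cmod (y z - a z) \<le> \<epsilon> n * norm z"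
    using nets[OF \<epsilon>(1)] by metis
  \<comment> \<open>Arbitrary differences of net points may be large. Only those within the bound
    are kept; differences of approximants of a common \<open>y\<close> are among them.\<close>
  define D where "D n = (case n of 0 \<Rightarrow> A 0 | Suc n \<Rightarrow>
    {d \<in> (\<lambda>(a, b). a - b) ` (A (Suc n) \<times> A n). \<forall>z. cmod (d z) \<le> M (Suc n) * norm z})" for n
  have "\<exists>d. (\<forall>n. d n \<in> D n) \<and> (\<forall>z. (\<lambda>n. d n z) sums y z)" if y: "y \<in> K" for y
  proof -
    obtain a where a: "\<And>n. a n \<in> A n" "\<And>n z. cmod (y z - a n z) \<le> \<epsilon> n * norm z"
      using A(3)[OF y] by metis
    define d where "d n = (case n of 0 \<Rightarrow> a 0 | Suc n \<Rightarrow> a (Suc n) - a n)" for n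
    have "d n \<in> D n" for n
    proof (cases n)
      case (Suc k)
      have "cmod (a (Suc k) z - a k z) \<le> M (Suc k) * norm z" for z
      proof -
        have "cmod (a (Suc k) z - a k z) \<le> cmod (y z - a (Suc k) z) + cmod (y z - a k z)"
          using norm_triangle_ineq4[of "y z - a k z" "y z - a (Suc k) z"] by simp
        also have "\<dots> \<le> (\<epsilon> (Suc k) + \<epsilon> k) * norm z"
          using a(2)[of z "Suc k"] a(2)[of z k] by (simp add: distrib_right)
        also have "\<dots> \<le> M (Suc k) * norm z"
          using \<epsilon>(2) by (intro mult_right_mono) auto
        finally show ?thesis .
      qed
      then show ?thesis using Suc a(1) by (auto simp: d_def D_def intro!: rev_image_eqI)
    qed (simp add: d_def D_def a(1))
    moreover have "(\<lambda>n. d n z) sums y z" for z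
    proof -
      have part: "(\<Sum>k<Suc n. d k z) = a n z" for n
        by (induction n) (simp_all add: d_def)
      have "(\<lambda>n. \<epsilon> n * norm z) \<longlonglongrightarrow> 0"
        using tendsto_mult_left_zero[OF \<open>\<epsilon> \<longlonglongrightarrow> 0\<close>] .
      then have "(\<lambda>n. a n z - y z) \<longlonglongrightarrow> 0"
        by (rule Lim_null_comparison[rotated]) (use a(2) in \<open>auto simp: norm_minus_commute\<close>)
      then have "(\<lambda>n. \<Sum>k<Suc n. d k z) \<longlonglongrightarrow> y z"
        unfolding part by (simp add: LIM_zero_iff)
      then show ?thesis unfolding sums_def by (rule filterlim_sequentially_Suc[THEN iffD1])
    qed
    ultimately show ?thesis by blast
  qed
  moreover have "finite (D n) \<and> D n \<subseteq> P" for n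
    using A K diff by (cases n) (auto simp: D_def subset_iff)
  ultimately show ?thesis
    using A(2) by (intro exI[of _ D]) (auto simp: D_def)
qed

section \<open>Relatively compact sets of functionals\<close>

context seminormed_nspace
begin

lemma Metric_space_dual: "Metric_space (pts (dual X)) (ndist (dual X))"
proof -
  interpret D: seminormed_nspace "dual X" by (rule seminormed_nspace_dual[OF seminormed_nspace_axioms])
  note sub = complex_subspaceD[OF D.subspace]
  show ?thesis
  proof
    show "0 \<le> ndist (dual X) \<phi> \<psi>" for \<phi> \<psi>
      by (simp add: ndist_def D.nrm_nonneg sub)
    show "ndist (dual X) \<phi> \<psi> = ndist (dual X) \<psi> \<phi>" for \<phi> \<psi>
    proof (cases "\<phi> \<in> pts (dual X) \<and> \<psi> \<in> pts (dual X)")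
      case True
      then have "nrm (dual X) ((- 1) *\<^sub>C (\<psi> - \<phi>)) = nrm (dual X) (\<psi> - \<phi>)"
        by (subst D.nrm_scaleC) (auto simp: sub)
      then show ?thesis by (simp add: ndist_def scaleC_minus_one)
    qed (auto simp: ndist_def)
    show "(ndist (dual X) \<phi> \<psi> = 0) = (\<phi> = \<psi>)"
      if "\<phi> \<in> pts (dual X)" "\<psi> \<in> pts (dual X)" for \<phi> \<psi>
    proof
      assume "ndist (dual X) \<phi> \<psi> = 0"
      then have "\<phi> - \<psi> = 0" using that by (intro dual_eq_zero) (auto simp: ndist_def sub)
      then show "\<phi> = \<psi>" by simp
    next
      assume "\<phi> = \<psi>"
      then show "ndist (dual X) \<phi> \<psi> = 0"
        using D.zero_in_unit_ball D.nrm_scaleC[of 0 0] by (simp add: ndist_def unit_ball_def scaleC_zero_left)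
    qed
    show "ndist (dual X) \<phi> \<omega> \<le> ndist (dual X) \<phi> \<psi> + ndist (dual X) \<psi> \<omega>"
      if "\<phi> \<in> pts (dual X)" "\<psi> \<in> pts (dual X)" "\<omega> \<in> pts (dual X)" for \<phi> \<psi> \<omega>
      using that dual_triangle[of "\<phi> - \<psi>" "\<psi> - \<omega>"] by (simp add: ndist_def sub)
  qed
qed

text \<open>Total boundedness is passed from the closure to \<open>K\<close>, because the centres
  must lie in \<open>K\<close>: they become the first finite set and have to obey the bound of
  \<open>K\<close> itself.\<close>

lemma relatively_compact_dual_nets:
  assumes K: "relatively_compact (dual X) K" and "0 < e"
  shows "\<exists>A. finite A \<and> A \<subseteq> K \<and> (\<forall>y\<in>K. \<exists>a\<in>A. nrm (dual X) (y - a) < e)"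
proof -
  interpret M: Metric_space "pts (dual X)" "ndist (dual X)" by (rule Metric_space_dual)
  have sub: "complex_subspace (pts (dual X))" by (rule dual_subspace)
  have KX: "K \<subseteq> pts (dual X)" and comp: "compactin M.mtopology (M.mtopology closure_of K)"
    using K by (auto simp: relatively_compact_def ntop_def)
  then have "M.mtotally_bounded (M.mtopology closure_of K)"
    by (intro M.compactin_imp_mtotally_bounded)
  then have "M.mtotally_bounded K"
    by (rule M.mtotally_bounded_subset) (simp add: closure_of_subset KX)
  then obtain A where A: "finite A" "A \<subseteq> K" "K \<subseteq> (\<Union>a\<in>A. M.mball a e)"
    using \<open>0 < e\<close> unfolding M.mtotally_bounded_def by meson
  have "\<exists>a\<in>A. nrm (dual X) (y - a) < e" if y: "y \<in> K" for y
  proof -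
    obtain a where "a \<in> A" "y \<in> M.mball a e" using A(3) y by blast
    then have "ndist (dual X) y a < e" by (simp add: M.commute)
    then show ?thesis using \<open>a \<in> A\<close> A(2) KX y by (auto simp: ndist_def split: if_splits)
  qed
  with A show ?thesis by blast
qed

lemma relatively_compact_dual_bounded:
  assumes K: "relatively_compact (dual X) K"
  shows "\<exists>C. \<forall>y\<in>K. nrm (dual X) y \<le> C"
proof -
  have KX: "K \<subseteq> pts (dual X)" using K by (simp add: relatively_compact_def)
  obtain A where A: "finite A" "A \<subseteq> K" "\<And>y. y \<in> K \<Longrightarrow> \<exists>a\<in>A. nrm (dual X) (y - a) < 1"
    using relatively_compact_dual_nets[OF K, of 1] by auto
  have "nrm (dual X) y \<le> 1 + Max (insert 0 (nrm (dual X) ` A))" if y: "y \<in> K" for y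
  proof -
    obtain a where a: "a \<in> A" "nrm (dual X) (y - a) < 1" using A(3)[OF y] by blast
    have "nrm (dual X) ((y - a) + a) \<le> nrm (dual X) (y - a) + nrm (dual X) a"
      using y a A(2) KX by (intro dual_triangle complex_subspaceD(4)[OF dual_subspace]) auto
    moreover have "nrm (dual X) a \<le> Max (insert 0 (nrm (dual X) ` A))"
      using A(1) a(1) by (intro Max_ge) auto
    ultimately show ?thesis using a(2) by simp
  qed
  then show ?thesis by blast
qed

end

section \<open>Composition with \<open>f\<close>: single functionals, compact sets, holomorphic
  mappings\<close>

lemma composition_in_HvC:
  fixes f :: "'a::complex_normed_vector \<Rightarrow> 'b::complex_normed_vector"
  assumes v: "weight U v" and f: "f \<in> pts (Hv U v whole)" and y: "y \<in> pts (dual whole)"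
  shows "y \<circ> f \<in> pts (HvC U v)"
    and "nrm (HvC U v) (y \<circ> f) \<le> nrm (dual whole) y * nrm (Hv U v whole) f"
proof -
  interpret F: seminormed_nspace "whole :: 'b nspace" by (rule seminormed_nspace_whole)
  have vpos: "0 \<le> v x" if "x \<in> U" for x using v that by (simp add: weight_def less_imp_le)
  have fhol: "holomorphic_into U whole f" and f0: "\<And>x. x \<notin> U \<Longrightarrow> f x = 0"
    and fbdd: "bdd_above ((\<lambda>x. v x * norm (f x)) ` U)"
    using f by (auto simp: Hv_def)
  have fle: "v x * norm (f x) \<le> nrm (Hv U v whole) f" if "x \<in> U" for x
    using fbdd that by (auto simp: Hv_def intro!: cSup_upper)
  have fn: "0 \<le> nrm (Hv U v whole) f"
    using fbdd by (auto simp: Hv_def intro!: cSup_upper)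
  have ybd: "cmod (y z) \<le> nrm (dual whole) y * norm z" for z
    using F.dual_bound[OF y, of z] by simp
  have yadd: "y (a + b) = y a + y b" and ysc: "y (c *\<^sub>C a) = c * y a" for a b c
    using y by (auto simp: pts_dual bounded_ops_def)
  have blin: "bounded_linear y"
    by (rule bounded_linear_complexI[OF yadd ysc ybd])
  have le: "v x * cmod ((y \<circ> f) x) \<le> nrm (dual whole) y * nrm (Hv U v whole) f" if x: "x \<in> U" for x
  proof -
    have "v x * cmod (y (f x)) \<le> v x * (nrm (dual whole) y * norm (f x))"
      using vpos[OF x] ybd by (intro mult_left_mono) auto
    also have "\<dots> = nrm (dual whole) y * (v x * norm (f x))" by simp
    also have "\<dots> \<le> nrm (dual whole) y * nrm (Hv U v whole) f"
      using fle[OF x] F.dual_nonneg[OF y] by (intro mult_left_mono)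
    finally show ?thesis by simp
  qed
  have "holomorphic_into U whole (y \<circ> f)"
    unfolding holomorphic_into_whole_iff
  proof
    fix x assume "x \<in> U"
    then obtain D where D: "(f has_derivative D) (at x)" "\<forall>c h. D (c *\<^sub>C h) = c *\<^sub>C D h"
      using fhol unfolding holomorphic_into_whole_iff by blast
    have "((y \<circ> f) has_derivative (\<lambda>h. y (D h))) (at x)"
      unfolding comp_def by (rule bounded_linear.has_derivative[OF blin D(1)])
    then show "\<exists>D. ((y \<circ> f) has_derivative D) (at x) \<and> (\<forall>c h. D (c *\<^sub>C h) = c *\<^sub>C D h)"
      using D(2) ysc by (intro exI[of _ "\<lambda>h. y (D h)"]) simp
  qed
  moreover have "y 0 = 0" using ysc[of 0 0] by (simp add: scaleC_zero_left)
  ultimately show "y \<circ> f \<in> pts (HvC U v)"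
    using f0 bdd_aboveI2[OF le] by (simp add: pts_HvC)
  show "nrm (HvC U v) (y \<circ> f) \<le> nrm (dual whole) y * nrm (Hv U v whole) f"
    using le fn F.dual_nonneg[OF y] by (intro nrm_HvC_le) auto
qed

text \<open>The \<open>p\<close>-th power of \<open>e\<close> is a budget. Block 0, whose
  functionals are bounded by \<open>m\<close>, uses \<open>b powr p\<close> with \<open>b\<close>
  slightly above \<open>C * m\<close>; the later blocks share the difference geometrically, which is
  possible because their functionals can be made as small as desired.\<close>

lemma transposed_image_p_conv:
  fixes f :: "'a::complex_normed_vector \<Rightarrow> 'b::complex_normed_vector"
  assumes U: "open U" "weight U v" and p: "1 \<le> p" and f: "f \<in> pts (Hv U v whole)"
    and lin: "is_linearization U v whole f T"
    and C: "C \<in> summing_constants p (Gv U v) whole T"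
    and K: "K \<subseteq> pts (dual whole)" and m: "0 \<le> m" "\<And>y z. y \<in> K \<Longrightarrow> cmod (y z) \<le> m * norm z"
    and nets: "\<And>e. 0 < e \<Longrightarrow> \<exists>A. finite A \<and> A \<subseteq> K \<and> (\<forall>y\<in>K. \<exists>a\<in>A. \<forall>z. cmod (y z - a z) \<le> e * norm z)"
    and e: "C * m < e"
  shows "\<exists>X\<in>lp_seqs p (HvC U v). lp_norm p (HvC U v) X \<le> e \<and> (\<forall>y\<in>K. y \<circ> f \<in> p_conv p (HvC U v) X)"
proof -
  interpret H: seminormed_nspace "HvC U v" by (rule seminormed_nspace_HvC) fact
  have C0: "0 \<le> C" using C by (simp add: summing_constants_def)
  have Cm: "0 \<le> C * m" using C0 m by simp
  \<comment> \<open>In \<open>C * m < a < b < e\<close> the first gap gives block 0 its strict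
    inequality, the second absorbs the division by \<open>c 0 = a / b\<close>, and the third is left
    for the later blocks.\<close>
  define a where "a = C * m + (e - C * m) / 3"
  define b where "b = C * m + 2 * (e - C * m) / 3"
  have ab: "C * m < a" "0 < a" "a < b" "0 < b" "b < e"
    using Cm e by (auto simp: a_def b_def field_simps)
  obtain c where c0: "c 0 = a / b" and cpos: "\<And>n. 0 < c n"
    and c: "if p = 1 then c \<longlonglongrightarrow> 0 \<and> (\<forall>n. c n \<le> 1)
      else \<forall>m. (\<Sum>n<m. c n powr conjugate_index p) \<le> 1"
    using block_factors_exist[OF p, of "a / b"] ab by auto
  define \<zeta> where "\<zeta> = e powr p - b powr p"
  have \<zeta>: "\<zeta> > 0" using ab p powr_less_mono2[of p b e] by (simp add: \<zeta>_def)
  define \<gamma> where "\<gamma> n = (\<zeta> * (1 / 2) ^ n) powr (1 / p)" for n :: nat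
  have \<gamma>: "\<gamma> n > 0" "\<gamma> n powr p = \<zeta> * (1 / 2) ^ n" for n
    using \<zeta> p by (auto simp: \<gamma>_def powr_powr)
  \<comment> \<open>Dividing by \<open>C + 1\<close> ensures
    \<open>C * M n < c n * \<gamma> n\<close>, also for \<open>C = 0\<close>.\<close>
  define M where "M n = c n * \<gamma> n / (C + 1)" for n
  have Mpos: "M n > 0" for n using cpos \<gamma> C0 by (simp add: M_def)
  define E where "E n = (if n = 0 then a else c n * \<gamma> n)" for n
  obtain D where D0: "D 0 \<subseteq> K" and D: "\<And>n. finite (D n)" "\<And>n. D n \<subseteq> pts (dual whole)"
    and DM: "\<And>n d z. d \<in> D (Suc n) \<Longrightarrow> cmod (d z) \<le> M (Suc n) * norm z"
    and tele: "\<And>y. y \<in> K \<Longrightarrow> \<exists>d. (\<forall>n. d n \<in> D n) \<and> (\<forall>z. (\<lambda>n. d n z) sums y z)"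
    using telescoping_in_nets[where M=M and K=K and P="pts (dual whole)", OF Mpos nets K
        complex_subspaceD(4)[OF dual_subspace]] by auto
  define Rep where "Rep n N \<beta> g \<longleftrightarrow> (\<forall>j. 0 \<le> \<beta> j \<and> g j \<in> unit_ball (HvC U v)) \<and> (\<Sum>j<N. \<beta> j powr p) \<le> E n powr p \<and>
    (\<forall>d\<in>D n. \<exists>r. conj_ball p {..<N::nat} r \<and> (\<forall>x\<in>U. d (f x) = (\<Sum>j<N. r j * (of_real (\<beta> j) * g j x))))"
    for n N \<beta> g
  have "\<exists>N \<beta> g. Rep n N \<beta> g" for n
    unfolding Rep_def
  proof (cases n)
    case 0
    then show "\<exists>N \<beta> g. (\<forall>j. 0 \<le> \<beta> j \<and> g j \<in> unit_ball (HvC U v)) \<and> (\<Sum>j<N. \<beta> j powr p) \<le> E n powr p \<and>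
      (\<forall>d\<in>D n. \<exists>r. conj_ball p {..<N::nat} r \<and> (\<forall>x\<in>U. d (f x) = (\<Sum>j<N. r j * (of_real (\<beta> j) * g j x))))"
      using D0 m ab by (intro finite_functionals_p_compact[OF U p lin C D, where m = m]) (auto simp: E_def)
  next
    case (Suc k)
    have "C * M n < E n"
    proof -
      have "C * M n = C / (C + 1) * E n" using Suc by (simp add: M_def E_def)
      also have "\<dots> < 1 * E n" using C0 Suc cpos \<gamma>(1) by (intro mult_strict_right_mono) (auto simp: E_def)
      finally show ?thesis by simp
    qed
    then show "\<exists>N \<beta> g. (\<forall>j. 0 \<le> \<beta> j \<and> g j \<in> unit_ball (HvC U v)) \<and> (\<Sum>j<N. \<beta> j powr p) \<le> E n powr p \<and>
      (\<forall>d\<in>D n. \<exists>r. conj_ball p {..<N::nat} r \<and> (\<forall>x\<in>U. d (f x) = (\<Sum>j<N. r j * (of_real (\<beta> j) * g j x))))"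
      using DM Mpos[of n] Suc by (intro finite_functionals_p_compact[OF U p lin C D, where m = "M n"]) auto
  qed
  then obtain N \<beta> g where Rep: "\<And>n. Rep n (N n) (\<beta> n) (g n)" by metis
  have \<beta>0: "0 \<le> \<beta> n j" and g: "g n j \<in> unit_ball (HvC U v)" and \<beta>E: "(\<Sum>j<N n. \<beta> n j powr p) \<le> E n powr p"
    and rep: "d \<in> D n \<Longrightarrow> \<exists>r. conj_ball p {..<N n} r \<and>
      (\<forall>x\<in>U. d (f x) = (\<Sum>j<N n. r j * (of_real (\<beta> n j) * g n j x)))" for n j d
    using Rep[of n] by (auto simp: Rep_def)
  define F where "F n j = (if j < N n then (\<beta> n j / c n) powr p else 0)" for n j
  have rowF: "(\<Sum>j<N n. F n j) \<le> (if n = 0 then b powr p else \<zeta> * (1 / 2) ^ n)" for n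
  proof -
    have "(\<Sum>j<N n. F n j) = (\<Sum>j<N n. \<beta> n j powr p) / c n powr p"
      using \<beta>0 cpos[of n] by (simp add: F_def powr_divide sum_divide_distrib)
    also have "\<dots> \<le> E n powr p / c n powr p"
      using \<beta>E by (intro divide_right_mono) auto
    also have "\<dots> = (E n / c n) powr p"
      using cpos[of n] ab \<gamma>(1)[of n] by (simp add: powr_divide E_def)
    also have "E n / c n = (if n = 0 then b else \<gamma> n)"
      using cpos[of n] ab by (auto simp: E_def c0)
    finally show ?thesis using \<gamma>(2)[of n] by (auto split: if_splits)
  qed
  have sumF: "(\<Sum>n<l. \<Sum>j<N n. F n j) \<le> e powr p" for l
  proof -
    \<comment> \<open>Again one extra row, so that row 0 can be split off for every
      \<open>l\<close>.\<close>
    have "(\<Sum>n<l. \<Sum>j<N n. F n j) \<le> (\<Sum>n<Suc l. \<Sum>j<N n. F n j)"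
      by (simp add: F_def sum_nonneg)
    also have "\<dots> \<le> (\<Sum>n<Suc l. if n = 0 then b powr p else \<zeta> * (1 / 2) ^ n)"
      by (intro sum_mono rowF)
    also have "\<dots> = b powr p + (\<Sum>n<l. \<zeta> * (1 / 2) ^ Suc n)"
      unfolding sum.lessThan_Suc_shift by simp
    also have "(\<Sum>n<l. \<zeta> * (1 / 2) ^ Suc n) = \<zeta> * (1 - (1 / 2) ^ l)"
      by (induction l) (simp_all add: algebra_simps)
    also have "b powr p + \<zeta> * (1 - (1 / 2) ^ l) \<le> b powr p + \<zeta> * 1"
      using \<zeta> by (intro add_left_mono mult_left_mono) auto
    finally show ?thesis by (simp add: \<zeta>_def)
  qed
  note F = nonneg_block_sum[of F N "e powr p", OF _ _ sumF]
  \<comment> \<open>The vectors do not depend on \<open>y\<close>; only the coefficients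
    \<open>\<alpha>\<close> below do, and they carry the compensating factor
    \<open>c n\<close>.\<close>
  define X where "X k = (case prod_decode k of (n, j) \<Rightarrow>
    if j < N n then of_real (\<beta> n j / c n) *\<^sub>C g n j else 0)" for k
  have gp: "g n j \<in> pts (HvC U v)" "nrm (HvC U v) (g n j) \<le> 1" for n j
    using g[of n j] by (auto simp: unit_ball_def)
  have Xp: "X k \<in> pts (HvC U v)" for k
    using gp(1) complex_subspaceD[OF H.subspace] by (auto simp: X_def split: prod.split)
  have Xn: "nrm (HvC U v) (X k) powr p \<le> (case prod_decode k of (n, j) \<Rightarrow> F n j)" for k
  proof -
    obtain n j where k: "prod_decode k = (n, j)" by fastforce
    show ?thesis
    proof (cases "j < N n")
      case True
      then have "nrm (HvC U v) (X k) = \<beta> n j / c n * nrm (HvC U v) (g n j)"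
        using \<beta>0 cpos[of n] gp(1) by (simp add: X_def k H.nrm_scaleC norm_divide del: of_real_divide)
      also have "\<dots> \<le> \<beta> n j / c n * 1"
        using \<beta>0 cpos[of n] gp(2) by (intro mult_left_mono) auto
      finally have "nrm (HvC U v) (X k) powr p \<le> (\<beta> n j / c n) powr p"
        using p H.nrm_nonneg[OF Xp] by (intro powr_mono2) auto
      then show ?thesis using True by (simp add: k F_def)
    next
      case False
      then show ?thesis
        using H.nrm_scaleC[OF zero_in_HvC, of 0] p by (simp add: k F_def X_def scaleC_zero_left)
    qed
  qed
  have F0: "0 \<le> F n j" and FN: "N n \<le> j \<Longrightarrow> F n j = 0" for n j by (simp_all add: F_def)
  have Xs: "summable (\<lambda>k. nrm (HvC U v) (X k) powr p)"
    using Xn by (intro summable_comparison_test[OF _ F(1)[OF F0 FN]]) auto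
  then have X: "X \<in> lp_seqs p (HvC U v)" using Xp by (simp add: lp_seqs_def)
  have "(\<Sum>k. nrm (HvC U v) (X k) powr p) \<le> (\<Sum>k. case prod_decode k of (n, j) \<Rightarrow> F n j)"
    using Xn Xs F(1)[OF F0 FN] by (intro suminf_le)
  also have "\<dots> \<le> e powr p" by (rule F(2)[OF F0 FN])
  finally have "lp_norm p (HvC U v) X \<le> (e powr p) powr (1 / p)"
    unfolding lp_norm_def using p Xs by (intro powr_mono2) (auto intro: suminf_nonneg)
  then have Xe: "lp_norm p (HvC U v) X \<le> e" using p ab by (simp add: powr_powr)
  have "y \<circ> f \<in> p_conv p (HvC U v) X" if y: "y \<in> K" for y
  proof -
    obtain d where d: "\<And>n. d n \<in> D n" "\<And>z. (\<lambda>n. d n z) sums y z" using tele[OF y] by blast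
    have "\<forall>n. \<exists>r. conj_ball p {..<N n} r \<and>
      (\<forall>x\<in>U. d n (f x) = (\<Sum>j<N n. r j * (of_real (\<beta> n j) * g n j x)))"
      using rep[OF d(1)] by blast
    from choice[OF this] obtain r where r: "\<And>n. conj_ball p {..<N n} (r n)"
      "\<And>n x. x \<in> U \<Longrightarrow> d n (f x) = (\<Sum>j<N n. r n j * (of_real (\<beta> n j) * g n j x))"
      by blast
    define \<alpha> where "\<alpha> k = (case prod_decode k of (n, j) \<Rightarrow> if j < N n then of_real (c n) * r n j else 0)" for k
    have "\<alpha> \<in> coefficient_ball p"
    proof (cases "p = 1")
      case True
      have \<alpha>c: "cmod (\<alpha> k) \<le> c n" if "prod_decode k = (n, j)" for k n j
        using r(1)[of n] True cpos[of n] mult_left_mono[of "cmod (r n j)" 1 "c n"] that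
        by (auto simp: \<alpha>_def conj_ball_def norm_mult)
      have c': "c \<longlonglongrightarrow> 0" "\<And>n. c n \<le> 1" using c True by auto
      have "\<alpha> \<longlonglongrightarrow> 0"
      proof (rule LIMSEQ_I)
        fix \<epsilon> :: real assume \<epsilon>: "0 < \<epsilon>"
        obtain n0 where n0: "\<And>n. n \<ge> n0 \<Longrightarrow> norm (c n - 0) < \<epsilon>"
          using LIMSEQ_D[OF c'(1) \<epsilon>] by blast
        \<comment> \<open>Outside these finitely many positions either \<open>n \<ge> n0\<close>,
          where \<open>c n\<close> is small, or the entry is padding with value 0.\<close>
        define A where "A = prod_encode ` (Sigma {..<n0} (\<lambda>n. {..<N n}))"
        have "finite A" by (simp add: A_def)
        have "cmod (\<alpha> k) < \<epsilon>" if "k \<notin> A" for k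
        proof -
          obtain n j where k: "prod_decode k = (n, j)" by fastforce
          then have "k = prod_encode (n, j)" by (metis prod_decode_inverse)
          with that have "\<not> (n < n0 \<and> j < N n)" by (auto simp: A_def)
          then consider "n \<ge> n0" | "\<not> j < N n" by linarith
          then show ?thesis
          proof cases
            case 1
            then show ?thesis using n0[OF 1] \<alpha>c[OF k] cpos[of n] by simp
          next
            case 2
            then show ?thesis using \<epsilon> by (simp add: \<alpha>_def k)
          qed
        qed
        moreover have "k \<notin> A" if k: "k \<ge> Suc (Max (insert 0 A))" for k
        proof
          assume "k \<in> A"
          then have "k \<le> Max (insert 0 A)" using \<open>finite A\<close> by (intro Max_ge) auto
          with k show False by linarith
        qed
        ultimately show "\<exists>n0. \<forall>n\<ge>n0. norm (\<alpha> n - 0) < \<epsilon>" by (metis diff_zero)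
      qed
      moreover have "cmod (\<alpha> k) \<le> 1" for k
        using \<alpha>c[of k] c'(2) by (metis order_trans prod.exhaust)
      ultimately show ?thesis using True by (simp add: coefficient_ball_def)
    next
      case False
      define p' where "p' = conjugate_index p"
      have p': "p' > 1" using conjugate_index(1)[of p] p False by (simp add: p'_def)
      define F' where "F' n j = (if j < N n then (c n * cmod (r n j)) powr p' else 0)" for n j
      have row: "(\<Sum>j<N n. F' n j) \<le> c n powr p'" for n
      proof -
        have "(\<Sum>j<N n. F' n j) = c n powr p' * (\<Sum>j<N n. cmod (r n j) powr p')"
          using cpos[of n] by (simp add: F'_def powr_mult sum_distrib_left)
        also have "\<dots> \<le> c n powr p' * 1"
          using r(1)[of n] False by (intro mult_left_mono) (auto simp: conj_ball_def p'_def)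
        finally show ?thesis by simp
      qed
      have "(\<Sum>n<l. \<Sum>j<N n. F' n j) \<le> 1" for l
      proof -
        have "(\<Sum>n<l. \<Sum>j<N n. F' n j) \<le> (\<Sum>n<l. c n powr p')" by (intro sum_mono row)
        also have "\<dots> \<le> 1" using c False by (simp add: p'_def)
        finally show ?thesis .
      qed
      note sF = nonneg_block_sum[of F' N 1, OF _ _ this]
      have eq: "(case prod_decode k of (n, j) \<Rightarrow> F' n j) = cmod (\<alpha> k) powr p'" for k
        using p' by (auto simp: \<alpha>_def F'_def norm_mult abs_of_pos[OF cpos] split: prod.split)
      have "summable (\<lambda>k. cmod (\<alpha> k) powr p')" "(\<Sum>k. cmod (\<alpha> k) powr p') \<le> 1"
        using sF unfolding eq by (simp_all add: F'_def)
      moreover have "0 \<le> (\<Sum>k. cmod (\<alpha> k) powr p')"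
        using calculation by (intro suminf_nonneg) auto
      ultimately show ?thesis
        using False p' powr_mono2[of "1 / p'" "\<Sum>k. cmod (\<alpha> k) powr p'" 1]
        by (simp add: coefficient_ball_def lp_seqs_def lp_norm_def p'_def)
    qed
    moreover have "y \<circ> f \<in> pts (HvC U v)"
      using composition_in_HvC(1)[OF U(2) f] y K by blast
    moreover have "(\<lambda>k. \<alpha> k * X k x) sums (y \<circ> f) x"
      if x: "x \<in> U" and abs: "summable (\<lambda>k. cmod (\<alpha> k * X k x))" for x
    proof -
      define H where "H n j = (if j < N n then r n j * (of_real (\<beta> n j) * g n j x) else 0)" for n j
      have eq: "\<alpha> k * X k x = (case prod_decode k of (n, j) \<Rightarrow> H n j)" for k
        using cpos by (auto simp: \<alpha>_def X_def H_def less_imp_neq[THEN not_sym] split: prod.split)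
      have "(\<Sum>j<N n. H n j) = d n (f x)" for n
        using r(2)[OF x] by (simp add: H_def)
      then have "(\<lambda>n. \<Sum>j<N n. H n j) sums y (f x)"
        using d(2) by simp
      moreover have "H n j = 0" if "N n \<le> j" for n j using that by (simp add: H_def)
      ultimately have "(\<lambda>k. case prod_decode k of (n, j) \<Rightarrow> H n j) sums y (f x)"
        using abs unfolding eq by (intro block_sums[where N = N])
      then show ?thesis by (simp add: eq)
    qed
    ultimately show ?thesis
      by (intro p_conv_HvC_I[OF p U(2) _ _ X])
  qed
  then show ?thesis using X Xe by blast
qed

text \<open>Composition with \<open>f\<close> is a bounded linear map from the dual into the
  weighted space, of norm at most that of \<open>f\<close>, and so preserves holomorphy and weighted
  bounds. Applying it to the remainder of \<open>g\<close> gives the remainder of the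
  composite.\<close>

lemma transposed_comp_in_Hv:
  fixes f :: "'a::complex_normed_vector \<Rightarrow> 'b::complex_normed_vector"
  assumes v: "weight U v" and f: "f \<in> pts (Hv U v whole)" and g: "g \<in> pts (Hv U v (dual whole))"
  shows "transposed f \<circ> g \<in> pts (Hv U v (HvC U v))"
proof -
  interpret F: seminormed_nspace "whole :: 'b nspace" by (rule seminormed_nspace_whole)
  interpret H: seminormed_nspace "HvC U v" by (rule seminormed_nspace_HvC) fact
  note comp = composition_in_HvC[OF v f]
  note sub = complex_subspaceD[OF dual_subspace]
  have nf: "0 \<le> nrm (Hv U v whole) f"
    using f by (auto simp: Hv_def intro!: cSup_upper)
  have ghol: "holomorphic_into U (dual whole) g" and g0: "\<And>x. x \<notin> U \<Longrightarrow> g x = 0"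
    and gbdd: "bdd_above ((\<lambda>x. v x * nrm (dual whole) (g x)) ` U)"
    using g by (auto simp: Hv_def)
  have gp: "g x \<in> pts (dual whole)" for x
    using ghol g0 sub(1) by (cases "x \<in> U") (auto simp: holomorphic_into_def)
  have "holomorphic_into U (HvC U v) (transposed f \<circ> g)"
    unfolding holomorphic_into_def
  proof (intro conjI ballI)
    show "(transposed f \<circ> g) ` U \<subseteq> pts (HvC U v)"
      using comp(1)[OF gp] by (auto simp: transposed_def)
    fix x assume "x \<in> U"
    then obtain D where D: "D \<in> bounded_ops whole (dual whole)"
      and lim: "((\<lambda>h. nrm (dual whole) (g (x + h) - g x - D h) / norm h) \<longlongrightarrow> 0) (at 0)"
      using ghol by (auto simp: holomorphic_into_def)
    have Dp: "D h \<in> pts (dual whole)" for h using bounded_opsD(2)[OF D] by simp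
    obtain C where C: "\<And>h. nrm (dual whole) (D h) \<le> C * norm h"
      using D by (auto simp: bounded_ops_def)
    have "nrm (HvC U v) (D h \<circ> f) \<le> (C * nrm (Hv U v whole) f) * norm h" for h
      using order_trans[OF comp(2)[OF Dp] mult_right_mono[OF C nf]] by (simp add: mult_ac)
    then have "(\<lambda>h. D h \<circ> f) \<in> bounded_ops whole (HvC U v)"
      using comp(1)[OF Dp] bounded_opsD(3,4)[OF D]
      by (auto simp: bounded_ops_def fun_eq_iff)
    moreover have "((\<lambda>h. nrm (HvC U v) ((transposed f \<circ> g) (x + h) - (transposed f \<circ> g) x - (D h \<circ> f)) / norm h)
        \<longlongrightarrow> 0) (at 0)"
    proof (rule Lim_null_comparison)
      show "((\<lambda>h. nrm (dual whole) (g (x + h) - g x - D h) / norm h * nrm (Hv U v whole) f) \<longlongrightarrow> 0) (at 0)"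
        by (rule tendsto_mult_left_zero[OF lim])
      have "norm (nrm (HvC U v) ((transposed f \<circ> g) (x + h) - (transposed f \<circ> g) x - (D h \<circ> f)) / norm h)
          \<le> nrm (dual whole) (g (x + h) - g x - D h) / norm h * nrm (Hv U v whole) f" for h
      proof -
        define y where "y = g (x + h) - g x - D h"
        have y: "y \<in> pts (dual whole)" unfolding y_def by (intro sub gp Dp)
        have "(transposed f \<circ> g) (x + h) - (transposed f \<circ> g) x - (D h \<circ> f) = y \<circ> f"
          by (simp add: transposed_def y_def fun_eq_iff)
        then show ?thesis
          using comp(2)[OF y] H.nrm_nonneg[OF comp(1)[OF y]]
          by (simp add: y_def[symmetric] divide_right_mono)
      qed
      then show "\<forall>\<^sub>F h in at 0. norm (nrm (HvC U v) ((transposed f \<circ> g) (x + h) - (transposed f \<circ> g) x - (D h \<circ> f)) / norm h)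
          \<le> nrm (dual whole) (g (x + h) - g x - D h) / norm h * nrm (Hv U v whole) f"
        by (intro always_eventually allI)
    qed
    ultimately show "\<exists>D\<in>bounded_ops whole (HvC U v).
      ((\<lambda>h. nrm (HvC U v) ((transposed f \<circ> g) (x + h) - (transposed f \<circ> g) x - D h) / norm h) \<longlongrightarrow> 0) (at 0)"
      by (intro bexI[of _ "\<lambda>h. D h \<circ> f"])
  qed
  moreover have "(transposed f \<circ> g) x = 0" if "x \<notin> U" for x
    using g0[OF that] by (auto simp: transposed_def)
  moreover have "bdd_above ((\<lambda>x. v x * nrm (HvC U v) ((transposed f \<circ> g) x)) ` U)"
  proof -
    obtain M where M: "\<And>x. x \<in> U \<Longrightarrow> v x * nrm (dual whole) (g x) \<le> M"
      using gbdd by (auto simp: bdd_above_def)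
    have "v x * nrm (HvC U v) ((transposed f \<circ> g) x) \<le> M * nrm (Hv U v whole) f" if x: "x \<in> U" for x
    proof -
      have "v x * nrm (HvC U v) (g x \<circ> f) \<le> v x * (nrm (dual whole) (g x) * nrm (Hv U v whole) f)"
        using v x comp(2)[OF gp] by (intro mult_left_mono) (auto simp: weight_def less_imp_le)
      also have "\<dots> \<le> M * nrm (Hv U v whole) f"
        using mult_right_mono[OF M[OF x] nf] by (simp add: mult_ac)
      finally show ?thesis by (simp add: transposed_def)
    qed
    then show ?thesis by (rule bdd_aboveI2)
  qed
  ultimately show ?thesis by (simp add: Hv_def)
qed

theorem corollary2p17:
  fixes U :: "'a::complex_banach set"
    and v :: "'a \<Rightarrow> real"
    and p :: real
    and f :: "'a \<Rightarrow> 'b::complex_banach"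
    and g :: "'a \<Rightarrow> 'b \<Rightarrow> complex"
    and Tf :: "(('a \<Rightarrow> complex) \<Rightarrow> complex) \<Rightarrow> 'b"
  assumes "open U"
    and "weight U v"
    and "1 \<le> p"
    and "f \<in> pts (Hv U v whole)"
    and "g \<in> HvK U v (dual whole)"
    and "is_linearization U v whole f Tf"
    and "Tf \<in> pts (p_summing p (Gv U v) whole)"
  shows "transposed f \<circ> g \<in> pts (HvKp p U v (HvC U v)) \<and>
    nrm (HvKp p U v (HvC U v)) (transposed f \<circ> g)
      \<le> nrm (p_summing p (Gv U v) whole) Tf * nrm (Hv U v (dual whole)) g"
proof -
  interpret F: seminormed_nspace "whole :: 'b nspace" by (rule seminormed_nspace_whole)
  interpret F': seminormed_nspace "dual (whole :: 'b nspace)" by (rule seminormed_nspace_dual) unfold_locales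
  define K where "K = weighted_image U v g"
  define K' where "K' = weighted_image U v (transposed f \<circ> g)"
  define m where "m = nrm (Hv U v (dual whole)) g"
  define C\<^sub>0 where "C\<^sub>0 = nrm (p_summing p (Gv U v) whole) Tf"
  have vpos: "0 < v x" if "x \<in> U" for x using assms(2) that by (simp add: weight_def)
  have ghol: "holomorphic_into U (dual whole) g" and g0: "\<forall>x. x \<notin> U \<longrightarrow> g x = 0"
    and rc: "relatively_compact (dual whole) K"
    using assms(5) by (auto simp: HvK_def K_def)
  have gp: "g x \<in> pts (dual whole)" if "x \<in> U" for x
    using ghol that by (auto simp: holomorphic_into_def)
  have KX: "K \<subseteq> pts (dual whole)" using rc by (simp add: relatively_compact_def)
  have vg: "nrm (dual whole) (of_real (v x) *\<^sub>C g x) = v x * nrm (dual whole) (g x)" if "x \<in> U" for x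
    using F'.nrm_scaleC[OF gp[OF that]] vpos[OF that] by simp
  \<comment> \<open>Membership in \<open>HvK\<close> asks only for relative compactness; boundedness
    follows from it and makes the supremum \<open>m\<close> meaningful.\<close>
  have gbdd: "bdd_above ((\<lambda>x. v x * nrm (dual whole) (g x)) ` U)"
  proof -
    obtain M where "\<forall>y\<in>K. nrm (dual whole) y \<le> M"
      using F.relatively_compact_dual_bounded[OF rc] by blast
    then show ?thesis
      using vg by (intro bdd_aboveI2[where M = M]) (auto simp: K_def weighted_image_def)
  qed
  then have "g \<in> pts (Hv U v (dual whole))"
    using ghol g0 by (simp add: Hv_def)
  then have tfg: "transposed f \<circ> g \<in> pts (Hv U v (HvC U v))"
    by (rule transposed_comp_in_Hv[OF assms(2,4)])
  have m0: "0 \<le> m" using gbdd by (auto simp: m_def Hv_def intro!: cSup_upper)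
  have Km: "cmod (y z) \<le> m * norm z" if y: "y \<in> K" for y z
  proof -
    obtain x where x: "x \<in> U" "y = of_real (v x) *\<^sub>C g x" using y by (auto simp: K_def weighted_image_def)
    have "nrm (dual whole) y \<le> m"
      using gbdd x vg[OF x(1)] by (auto simp: m_def Hv_def intro!: cSup_upper)
    then have "nrm (dual whole) y * norm z \<le> m * norm z" by (intro mult_right_mono) auto
    moreover have "cmod (y z) \<le> nrm (dual whole) y * norm z"
      using F.dual_bound[of y z] y KX by auto
    ultimately show ?thesis by simp
  qed
  have nets: "\<exists>A. finite A \<and> A \<subseteq> K \<and> (\<forall>y\<in>K. \<exists>a\<in>A. \<forall>z. cmod (y z - a z) \<le> e * norm z)" if e: "0 < e" for e
  proof -
    obtain A where A: "finite A" "A \<subseteq> K" "\<And>y. y \<in> K \<Longrightarrow> \<exists>a\<in>A. nrm (dual whole) (y - a) < e"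
      using F.relatively_compact_dual_nets[OF rc e] by blast
    have "\<exists>a\<in>A. \<forall>z. cmod (y z - a z) \<le> e * norm z" if y: "y \<in> K" for y
    proof -
      obtain a where a: "a \<in> A" "nrm (dual whole) (y - a) < e" using A(3)[OF y] by blast
      have "cmod (y z - a z) \<le> e * norm z" for z
      proof -
        have "y - a \<in> pts (dual whole)"
          using y a A(2) KX by (intro complex_subspaceD(4)[OF dual_subspace]) auto
        from F.dual_bound[OF this, of z] have "cmod (y z - a z) \<le> nrm (dual whole) (y - a) * norm z" by simp
        also have "\<dots> \<le> e * norm z" using a(2) by (intro mult_right_mono) auto
        finally show ?thesis .
      qed
      with a show ?thesis by blast
    qed
    with A show ?thesis by blast
  qed
  \<comment> \<open>The scalar \<open>v x\<close> can be moved inside, so the weighted image of the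
    composite consists of the functions \<open>y \<circ> f\<close> with \<open>y\<close> in
    \<open>K\<close>.\<close>
  have K': "\<exists>y\<in>K. y' = y \<circ> f" if "y' \<in> K'" for y'
    using that by (auto simp: K'_def K_def weighted_image_def transposed_def fun_eq_iff)
  have S: "summing_constants p (Gv U v) whole Tf \<noteq> {}" "C\<^sub>0 = Inf (summing_constants p (Gv U v) whole Tf)"
    using assms(7) by (auto simp: p_summing_def C\<^sub>0_def)
  have bdd: "bdd_below (summing_constants p (Gv U v) whole Tf)"
    by (auto simp: summing_constants_def bdd_below_def)
  \<comment> \<open>\<open>C\<^sub>0\<close> is an infimum, so only bounds \<open>e\<close> strictly
    above \<open>C\<^sub>0 * m\<close> can be reached directly; as \<open>mKp\<close> is an infimum
    too, this suffices.\<close>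
  have seq: "\<exists>X\<in>lp_seqs p (HvC U v). lp_norm p (HvC U v) X \<le> e \<and> K' \<subseteq> p_conv p (HvC U v) X"
    if e: "C\<^sub>0 * m < e" for e
  proof -
    \<comment> \<open>The denominator \<open>m + 1\<close> also covers \<open>m = 0\<close>.\<close>
    define \<eta> where "\<eta> = (e - C\<^sub>0 * m) / (m + 1)"
    have "\<eta> > 0" using e m0 by (simp add: \<eta>_def)
    then obtain C where C: "C \<in> summing_constants p (Gv U v) whole Tf" "C < C\<^sub>0 + \<eta>"
      using cInf_less_iff[OF S(1) bdd, of "C\<^sub>0 + \<eta>"] S(2) by auto
    have "C * m \<le> (C\<^sub>0 + \<eta>) * m" using C(2) m0 by (intro mult_right_mono) auto
    also have "\<dots> < C\<^sub>0 * m + \<eta> * (m + 1)" using \<open>\<eta> > 0\<close> by (simp add: algebra_simps)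
    also have "\<dots> = e" using m0 by (simp add: \<eta>_def)
    finally have "C * m < e" .
    have "\<exists>X\<in>lp_seqs p (HvC U v). lp_norm p (HvC U v) X \<le> e \<and> (\<forall>y\<in>K. y \<circ> f \<in> p_conv p (HvC U v) X)"
      by (rule transposed_image_p_conv[OF assms(1-4,6) C(1) KX m0 _ _ \<open>C * m < e\<close>]) (use Km nets in blast)+
    then show ?thesis using K' by blast
  qed
  have "relatively_p_compact p (HvC U v) K'"
    using seq[of "C\<^sub>0 * m + 1"] by (auto simp: relatively_p_compact_def)
  moreover have "mKp p (HvC U v) K' \<le> C\<^sub>0 * m"
  proof (rule field_le_epsilon)
    fix e :: real assume "0 < e"
    then obtain X where X: "X \<in> lp_seqs p (HvC U v)" "lp_norm p (HvC U v) X \<le> C\<^sub>0 * m + e"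
        "K' \<subseteq> p_conv p (HvC U v) X"
      using seq[of "C\<^sub>0 * m + e"] by auto
    have "mKp p (HvC U v) K' \<le> lp_norm p (HvC U v) X"
      unfolding mKp_def using X by (intro cInf_lower) (auto simp: lp_norm_def bdd_below_def intro: exI[of _ 0])
    with X(2) show "mKp p (HvC U v) K' \<le> C\<^sub>0 * m + e" by simp
  qed
  ultimately show ?thesis
    using tfg by (simp add: HvKp_def K'_def C\<^sub>0_def m_def)
qed

end
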